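(* Let $(A,\Delta_A,\epsilon_A)$ and $(B,\Delta_B,\epsilon_B)$ be counital coassociative $k$-coalgebras and let $\tau:B\otimes A\rightarrow A\otimes B$ be a bijective $k$-linear map. Then $(A\otimes B,\Delta_{A\otimes_{\tau} B},\epsilon_{A\otimes_{\tau} B})$ is a counital coassociative coalgebra if and only if the following identities hold: $(\epsilon_A\otimes 1)\tau=1\otimes\epsilon_A$ as maps $B\otimes A\to B$ (identifying $k\otimes B\cong B\cong B\otimes k$), $(1\otimes\epsilon_B)\tau=\epsilon_B\otimes 1$ as maps $B\otimes A\to A$ (identifying $A\otimes k\cong A\cong k\otimes A$), and $$(\Delta_A\otimes\Delta_B)\,\tau=(1\otimes\tau\otimes 1)(\tau\otimes\tau)(1\otimes\tau\otimes 1)(\Delta_B\otimes\Delta_A)$$ as maps $B\otimes A\to A\otimes A\otimes B\otimes B$.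
   Context: $k$ is a field, $\otimes=\otimes_k$, and $1$ denotes identity maps. The maps are $\Delta_{A\otimes_\tau B}=(1\otimes\tau^{-1}\otimes 1)(\Delta_A\otimes\Delta_B):A\otimes B\to (A\otimes B)\otimes(A\otimes B)$ and $\epsilon_{A\otimes_\tau B}=\epsilon_A\otimes\epsilon_B:A\otimes B\to k\otimes k\cong k$. *)

theory Defs
  imports "HOL-Algebra.Module" "HOL-Algebra.AbelCoset"
begin

section \<open>Linear and bilinear maps\<close>

definition linear_maps ::
    "('k, 'r) ring_scheme \<Rightarrow> ('k, 'a, 'm) module_scheme \<Rightarrow> ('k, 'b, 'n) module_scheme \<Rightarrow> ('a \<Rightarrow> 'b) set"
  where "linear_maps K M N =
    {f \<in> carrier M \<rightarrow> carrier N.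
       (\<forall>x\<in>carrier M. \<forall>y\<in>carrier M. f (x \<oplus>\<^bsub>M\<^esub> y) = f x \<oplus>\<^bsub>N\<^esub> f y) \<and>
       (\<forall>c\<in>carrier K. \<forall>x\<in>carrier M. f (c \<odot>\<^bsub>M\<^esub> x) = c \<odot>\<^bsub>N\<^esub> f x)}"

definition bilinear_maps ::
    "('k, 'r) ring_scheme \<Rightarrow> ('k, 'a, 'm) module_scheme \<Rightarrow> ('k, 'b, 'n) module_scheme \<Rightarrow>
     ('k, 'w, 'o) module_scheme \<Rightarrow> ('a \<Rightarrow> 'b \<Rightarrow> 'w) set"
  where "bilinear_maps K A B W =
    {f. (\<forall>a\<in>carrier A. f a \<in> linear_maps K B W) \<and>
        (\<forall>b\<in>carrier B. (\<lambda>a. f a b) \<in> linear_maps K A W)}"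


section \<open>Tensor products\<close>

text \<open>A module record extends a ring record, so it has two fields (\<open>mult\<close> and \<open>one\<close>) that
  play no role for modules; they are left \<open>undefined\<close> in the constructions below.\<close>

definition free_module :: "('k, 'r) ring_scheme \<Rightarrow> 'x set \<Rightarrow> ('k, 'x \<Rightarrow> 'k) module"
  where "free_module K S =
    \<lparr>carrier = {c. (\<forall>x. c x \<in> carrier K) \<and> (\<forall>x. x \<notin> S \<longrightarrow> c x = \<zero>\<^bsub>K\<^esub>) \<and> finite {x. c x \<noteq> \<zero>\<^bsub>K\<^esub>}},
     monoid.mult = undefined, one = undefined,
     zero = (\<lambda>x. \<zero>\<^bsub>K\<^esub>), add = (\<lambda>c d x. c x \<oplus>\<^bsub>K\<^esub> d x),
     smult = (\<lambda>a c x. a \<otimes>\<^bsub>K\<^esub> c x)\<rparr>"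

definition free_gen :: "('k, 'r) ring_scheme \<Rightarrow> 'x \<Rightarrow> 'x \<Rightarrow> 'k"
  where "free_gen K x = (\<lambda>y. if y = x then \<one>\<^bsub>K\<^esub> else \<zero>\<^bsub>K\<^esub>)"

definition submodule_span :: "('k, 'r) ring_scheme \<Rightarrow> ('k, 'a, 'm) module_scheme \<Rightarrow> 'a set \<Rightarrow> 'a set"
  where "submodule_span K M S = \<Inter>{H. submodule H K M \<and> S \<subseteq> H}"

definition quotient_module :: "('k, 'a, 'm) module_scheme \<Rightarrow> 'a set \<Rightarrow> ('k, 'a set) module"
  where "quotient_module M H =
    \<lparr>carrier = a_rcosets\<^bsub>M\<^esub> H, monoid.mult = undefined, one = undefined,
     zero = H, add = (\<lambda>X Y. X <+>\<^bsub>M\<^esub> Y),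
     smult = (\<lambda>a X. \<Union>x\<in>X. H +>\<^bsub>M\<^esub> (a \<odot>\<^bsub>M\<^esub> x))\<rparr>"

definition tensor_relators ::
    "('k, 'r) ring_scheme \<Rightarrow> ('k, 'a, 'm) module_scheme \<Rightarrow> ('k, 'b, 'n) module_scheme \<Rightarrow>
     ('a \<times> 'b \<Rightarrow> 'k) set"
  where "tensor_relators K A B =
    (let F = free_module K (carrier A \<times> carrier B); g = (\<lambda>a b. free_gen K (a, b)) in
     {g (a \<oplus>\<^bsub>A\<^esub> a') b \<ominus>\<^bsub>F\<^esub> (g a b \<oplus>\<^bsub>F\<^esub> g a' b) | a a' b.
        a \<in> carrier A \<and> a' \<in> carrier A \<and> b \<in> carrier B} \<union>
     {g a (b \<oplus>\<^bsub>B\<^esub> b') \<ominus>\<^bsub>F\<^esub> (g a b \<oplus>\<^bsub>F\<^esub> g a b') | a b b'.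
        a \<in> carrier A \<and> b \<in> carrier B \<and> b' \<in> carrier B} \<union>
     {g (c \<odot>\<^bsub>A\<^esub> a) b \<ominus>\<^bsub>F\<^esub> (c \<odot>\<^bsub>F\<^esub> g a b) | c a b.
        c \<in> carrier K \<and> a \<in> carrier A \<and> b \<in> carrier B} \<union>
     {g a (c \<odot>\<^bsub>B\<^esub> b) \<ominus>\<^bsub>F\<^esub> (c \<odot>\<^bsub>F\<^esub> g a b) | c a b.
        c \<in> carrier K \<and> a \<in> carrier A \<and> b \<in> carrier B})"

definition tensor_kernel ::
    "('k, 'r) ring_scheme \<Rightarrow> ('k, 'a, 'm) module_scheme \<Rightarrow> ('k, 'b, 'n) module_scheme \<Rightarrow>
     ('a \<times> 'b \<Rightarrow> 'k) set"
  where "tensor_kernel K A B =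
    submodule_span K (free_module K (carrier A \<times> carrier B)) (tensor_relators K A B)"

definition tensor ::
    "('k, 'r) ring_scheme \<Rightarrow> ('k, 'a, 'm) module_scheme \<Rightarrow> ('k, 'b, 'n) module_scheme \<Rightarrow>
     ('k, ('a \<times> 'b \<Rightarrow> 'k) set) module"
  where "tensor K A B =
    quotient_module (free_module K (carrier A \<times> carrier B)) (tensor_kernel K A B)"

definition pure_tensor ::
    "('k, 'r) ring_scheme \<Rightarrow> ('k, 'a, 'm) module_scheme \<Rightarrow> ('k, 'b, 'n) module_scheme \<Rightarrow>
     'a \<Rightarrow> 'b \<Rightarrow> ('a \<times> 'b \<Rightarrow> 'k) set"
  where "pure_tensor K A B a b =
    tensor_kernel K A B +>\<^bsub>free_module K (carrier A \<times> carrier B)\<^esub> free_gen K (a, b)"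

definition free_eval ::
    "('k, 'r) ring_scheme \<Rightarrow> ('k, 'w, 'o) module_scheme \<Rightarrow> ('x \<Rightarrow> 'w) \<Rightarrow> ('x \<Rightarrow> 'k) \<Rightarrow> 'w"
  where "free_eval K W f c = (\<Oplus>\<^bsub>W\<^esub>x\<in>{x. c x \<noteq> \<zero>\<^bsub>K\<^esub>}. c x \<odot>\<^bsub>W\<^esub> f x)"

text \<open>The linear map on the tensor product induced by a bilinear map \<open>f\<close>, computed on an arbitrary
  representative of a coset; the choice does not matter when \<open>f\<close> is bilinear: see \<open>tensor_lift_linear\<close>,
  \<open>tensor_lift_pure\<close> and \<open>tensor_ext\<close> below.\<close>

definition tensor_lift ::
    "('k, 'r) ring_scheme \<Rightarrow> ('k, 'w, 'o) module_scheme \<Rightarrow> ('a \<Rightarrow> 'b \<Rightarrow> 'w) \<Rightarrow>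
     ('a \<times> 'b \<Rightarrow> 'k) set \<Rightarrow> 'w"
  where "tensor_lift K W f X = free_eval K W (\<lambda>(a, b). f a b) (SOME c. c \<in> X)"


section \<open>Canonical maps between tensor products\<close>

text \<open>\<open>f \<otimes> g : A \<otimes> B \<rightarrow> A' \<otimes> B'\<close>; only the codomains \<open>A'\<close>, \<open>B'\<close> are needed as arguments.\<close>

definition tensor_map ::
    "('k, 'r) ring_scheme \<Rightarrow> ('k, 'c, 'm) module_scheme \<Rightarrow> ('k, 'd, 'n) module_scheme \<Rightarrow>
     ('a \<Rightarrow> 'c) \<Rightarrow> ('b \<Rightarrow> 'd) \<Rightarrow> ('a \<times> 'b \<Rightarrow> 'k) set \<Rightarrow> ('c \<times> 'd \<Rightarrow> 'k) set"
  where "tensor_map K A' B' f g =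
    tensor_lift K (tensor K A' B') (\<lambda>a b. pure_tensor K A' B' (f a) (g b))"

text \<open>The associativity isomorphism \<open>(X \<otimes> Y) \<otimes> Z \<rightarrow> X \<otimes> (Y \<otimes> Z)\<close> and its inverse.\<close>

definition tensor_assoc ::
    "('k, 'r) ring_scheme \<Rightarrow> ('k, 'x, 'm) module_scheme \<Rightarrow> ('k, 'y, 'n) module_scheme \<Rightarrow>
     ('k, 'z, 'o) module_scheme \<Rightarrow> (('x \<times> 'y \<Rightarrow> 'k) set \<times> 'z \<Rightarrow> 'k) set \<Rightarrow>
     ('x \<times> ('y \<times> 'z \<Rightarrow> 'k) set \<Rightarrow> 'k) set"
  where "tensor_assoc K X Y Z =
    tensor_lift K (tensor K X (tensor K Y Z))
      (\<lambda>t z. tensor_lift K (tensor K X (tensor K Y Z))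
        (\<lambda>x y. pure_tensor K X (tensor K Y Z) x (pure_tensor K Y Z y z)) t)"

definition tensor_assoc_inv ::
    "('k, 'r) ring_scheme \<Rightarrow> ('k, 'x, 'm) module_scheme \<Rightarrow> ('k, 'y, 'n) module_scheme \<Rightarrow>
     ('k, 'z, 'o) module_scheme \<Rightarrow> ('x \<times> ('y \<times> 'z \<Rightarrow> 'k) set \<Rightarrow> 'k) set \<Rightarrow>
     (('x \<times> 'y \<Rightarrow> 'k) set \<times> 'z \<Rightarrow> 'k) set"
  where "tensor_assoc_inv K X Y Z =
    tensor_lift K (tensor K (tensor K X Y) Z)
      (\<lambda>x. tensor_lift K (tensor K (tensor K X Y) Z)
        (\<lambda>y z. pure_tensor K (tensor K X Y) Z (pure_tensor K X Y x y) z))"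

definition ground_module :: "('k, 'r) ring_scheme \<Rightarrow> ('k, 'k) module"
  where "ground_module K =
    \<lparr>carrier = carrier K, monoid.mult = monoid.mult K, one = one K,
     zero = zero K, add = add K, smult = monoid.mult K\<rparr>"

text \<open>The identifications \<open>k \<otimes> X \<cong> X\<close> and \<open>X \<otimes> k \<cong> X\<close>.\<close>

definition left_unitor ::
    "('k, 'r) ring_scheme \<Rightarrow> ('k, 'x, 'm) module_scheme \<Rightarrow> ('k \<times> 'x \<Rightarrow> 'k) set \<Rightarrow> 'x"
  where "left_unitor K X = tensor_lift K X (\<lambda>c x. c \<odot>\<^bsub>X\<^esub> x)"

definition right_unitor ::
    "('k, 'r) ring_scheme \<Rightarrow> ('k, 'x, 'm) module_scheme \<Rightarrow> ('x \<times> 'k \<Rightarrow> 'k) set \<Rightarrow> 'x"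
  where "right_unitor K X = tensor_lift K X (\<lambda>x c. c \<odot>\<^bsub>X\<^esub> x)"

text \<open>For \<open>f : Y \<otimes> Z \<rightarrow> Y' \<otimes> Z'\<close>, the map \<open>1 \<otimes> f \<otimes> 1 : X \<otimes> Y \<otimes> Z \<otimes> W \<rightarrow> X \<otimes> Y' \<otimes> Z' \<otimes> W\<close>
  with both fourfold products bracketed in pairs, that is the composite
  \<open>(X \<otimes> Y) \<otimes> (Z \<otimes> W) \<rightarrow> X \<otimes> (Y \<otimes> (Z \<otimes> W)) \<rightarrow> X \<otimes> ((Y \<otimes> Z) \<otimes> W) \<rightarrow>
   X \<otimes> ((Y' \<otimes> Z') \<otimes> W) \<rightarrow> X \<otimes> (Y' \<otimes> (Z' \<otimes> W)) \<rightarrow> (X \<otimes> Y') \<otimes> (Z' \<otimes> W)\<close>.\<close>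

definition middle_map ::
    "('k, 'r) ring_scheme \<Rightarrow> ('k, 'x, 'm1) module_scheme \<Rightarrow> ('k, 'y, 'm2) module_scheme \<Rightarrow>
     ('k, 'z, 'm3) module_scheme \<Rightarrow> ('k, 'w, 'm4) module_scheme \<Rightarrow>
     ('k, 'y1, 'm5) module_scheme \<Rightarrow> ('k, 'z1, 'm6) module_scheme \<Rightarrow>
     (('y \<times> 'z \<Rightarrow> 'k) set \<Rightarrow> ('y1 \<times> 'z1 \<Rightarrow> 'k) set) \<Rightarrow>
     (('x \<times> 'y \<Rightarrow> 'k) set \<times> ('z \<times> 'w \<Rightarrow> 'k) set \<Rightarrow> 'k) set \<Rightarrow>
     (('x \<times> 'y1 \<Rightarrow> 'k) set \<times> ('z1 \<times> 'w \<Rightarrow> 'k) set \<Rightarrow> 'k) set"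
  where "middle_map K X Y Z W Y' Z' f =
    tensor_assoc_inv K X Y' (tensor K Z' W) \<circ>
    tensor_map K X (tensor K Y' (tensor K Z' W)) id (tensor_assoc K Y' Z' W) \<circ>
    tensor_map K X (tensor K (tensor K Y' Z') W) id (tensor_map K (tensor K Y' Z') W f id) \<circ>
    tensor_map K X (tensor K (tensor K Y Z) W) id (tensor_assoc_inv K Y Z W) \<circ>
    tensor_assoc K X Y (tensor K Z W)"


section \<open>Coalgebras\<close>

locale coalgebra = module K C
  for K :: "('k, 'r) ring_scheme" and C :: "('k, 'c, 'm) module_scheme" +
  fixes \<Delta> :: "'c \<Rightarrow> ('c \<times> 'c \<Rightarrow> 'k) set" and \<epsilon> :: "'c \<Rightarrow> 'k"
  assumes comult_linear: "\<Delta> \<in> linear_maps K C (tensor K C C)"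
    and counit_linear: "\<epsilon> \<in> linear_maps K C (ground_module K)"
    and coassoc: "\<And>x. x \<in> carrier C \<Longrightarrow>
      tensor_assoc K C C C (tensor_map K (tensor K C C) C \<Delta> id (\<Delta> x)) =
      tensor_map K C (tensor K C C) id \<Delta> (\<Delta> x)"
    and left_counit: "\<And>x. x \<in> carrier C \<Longrightarrow>
      left_unitor K C (tensor_map K (ground_module K) C \<epsilon> id (\<Delta> x)) = x"
    and right_counit: "\<And>x. x \<in> carrier C \<Longrightarrow>
      right_unitor K C (tensor_map K C (ground_module K) id \<epsilon> (\<Delta> x)) = x"

text \<open>The structure maps of \<open>A \<otimes>\<^sub>\<tau> B\<close>. The inverse of \<open>\<tau> : B \<otimes> A \<rightarrow> A \<otimes> B\<close> is taken between
  carriers, hence \<open>inv_into\<close>.\<close>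

definition twisted_comult ::
    "('k, 'r) ring_scheme \<Rightarrow> ('k, 'a, 'm) module_scheme \<Rightarrow> ('k, 'b, 'n) module_scheme \<Rightarrow>
     ('a \<Rightarrow> ('a \<times> 'a \<Rightarrow> 'k) set) \<Rightarrow> ('b \<Rightarrow> ('b \<times> 'b \<Rightarrow> 'k) set) \<Rightarrow>
     (('b \<times> 'a \<Rightarrow> 'k) set \<Rightarrow> ('a \<times> 'b \<Rightarrow> 'k) set) \<Rightarrow>
     ('a \<times> 'b \<Rightarrow> 'k) set \<Rightarrow> (('a \<times> 'b \<Rightarrow> 'k) set \<times> ('a \<times> 'b \<Rightarrow> 'k) set \<Rightarrow> 'k) set"
  where "twisted_comult K A B \<Delta>\<^sub>A \<Delta>\<^sub>B \<tau> =
    middle_map K A A B B B A (inv_into (carrier (tensor K B A)) \<tau>) \<circ>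
    tensor_map K (tensor K A A) (tensor K B B) \<Delta>\<^sub>A \<Delta>\<^sub>B"

definition twisted_counit ::
    "('k, 'r) ring_scheme \<Rightarrow> ('a \<Rightarrow> 'k) \<Rightarrow> ('b \<Rightarrow> 'k) \<Rightarrow> ('a \<times> 'b \<Rightarrow> 'k) set \<Rightarrow> 'k"
  where "twisted_counit K \<epsilon>\<^sub>A \<epsilon>\<^sub>B =
    left_unitor K (ground_module K) \<circ>
    tensor_map K (ground_module K) (ground_module K) \<epsilon>\<^sub>A \<epsilon>\<^sub>B"


section \<open>The universal property\<close>

text \<open>The remaining facts justify the constructions above.\<close>

lemma linear_mapsI:
  assumes "\<And>x. x \<in> carrier M \<Longrightarrow> f x \<in> carrier N"
    and "\<And>x y. \<lbrakk>x \<in> carrier M; y \<in> carrier M\<rbrakk> \<Longrightarrow> f (x \<oplus>\<^bsub>M\<^esub> y) = f x \<oplus>\<^bsub>N\<^esub> f y"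
    and "\<And>c x. \<lbrakk>c \<in> carrier K; x \<in> carrier M\<rbrakk> \<Longrightarrow> f (c \<odot>\<^bsub>M\<^esub> x) = c \<odot>\<^bsub>N\<^esub> f x"
  shows "f \<in> linear_maps K M N"
  using assms unfolding linear_maps_def by auto

lemma linear_mapsD:
  assumes "f \<in> linear_maps K M N"
  shows "x \<in> carrier M \<Longrightarrow> f x \<in> carrier N"
    and "\<lbrakk>x \<in> carrier M; y \<in> carrier M\<rbrakk> \<Longrightarrow> f (x \<oplus>\<^bsub>M\<^esub> y) = f x \<oplus>\<^bsub>N\<^esub> f y"
    and "\<lbrakk>c \<in> carrier K; x \<in> carrier M\<rbrakk> \<Longrightarrow> f (c \<odot>\<^bsub>M\<^esub> x) = c \<odot>\<^bsub>N\<^esub> f x"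
  using assms unfolding linear_maps_def by auto

lemma module_ground:
  assumes "cring K" shows "module K (ground_module K)"
proof -
  interpret cring K by fact
  have "abelian_group (ground_module K)"
    by (rule abelian_groupI)
      (auto simp: ground_module_def a_ac intro: l_neg exI[of _ "\<ominus>\<^bsub>K\<^esub> _"] bexI[of _ "\<ominus>\<^bsub>K\<^esub> _"])
  then show ?thesis
    by (intro moduleI) (auto simp: ground_module_def assms l_distr r_distr m_assoc)
qed

lemma module_free:
  assumes "cring K" shows "module K (free_module K S)"
proof -
  interpret cring K by fact
  have sup: "finite {x. c x \<oplus>\<^bsub>K\<^esub> d x \<noteq> \<zero>\<^bsub>K\<^esub>}"
    if "finite {x. c x \<noteq> \<zero>\<^bsub>K\<^esub>}" "finite {x. d x \<noteq> \<zero>\<^bsub>K\<^esub>}" for c d :: "'c \<Rightarrow> 'a"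
    by (rule finite_subset[OF _ finite_UnI[OF that]]) auto
  have ms: "finite {x. a \<otimes>\<^bsub>K\<^esub> c x \<noteq> \<zero>\<^bsub>K\<^esub>}"
    if "finite {x. c x \<noteq> \<zero>\<^bsub>K\<^esub>}" "a \<in> carrier K" for c :: "'c \<Rightarrow> 'a" and a
    by (rule finite_subset[OF _ that(1)]) (use that(2) in auto)
  have ag: "abelian_group (free_module K S)"
  proof (rule abelian_groupI)
    fix c assume c: "c \<in> carrier (free_module K S)"
    let ?d = "\<lambda>x. \<ominus>\<^bsub>K\<^esub> c x"
    have f: "finite {x. ?d x \<noteq> \<zero>\<^bsub>K\<^esub>}"
      by (rule finite_subset[of _ "{x. c x \<noteq> \<zero>\<^bsub>K\<^esub>}"]) (use c in \<open>auto simp: free_module_def\<close>)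
    have "?d \<in> carrier (free_module K S)"
      using c f by (auto simp: free_module_def)
    moreover have "?d \<oplus>\<^bsub>free_module K S\<^esub> c = \<zero>\<^bsub>free_module K S\<^esub>"
      using c by (auto simp: free_module_def l_neg)
    ultimately show "\<exists>y\<in>carrier (free_module K S). y \<oplus>\<^bsub>free_module K S\<^esub> c = \<zero>\<^bsub>free_module K S\<^esub>"
      by blast
  qed (auto simp: free_module_def sup a_ac)
  show ?thesis
    by (rule moduleI[OF assms ag])
      (auto simp: free_module_def ms l_distr r_distr m_assoc)
qed

lemma free_gen_in_carrier:
  assumes "cring K" "x \<in> S"
  shows "free_gen K x \<in> carrier (free_module K S)"
proof -
  interpret cring K by fact
  have "finite {y. free_gen K x y \<noteq> \<zero>\<^bsub>K\<^esub>}"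
    by (rule finite_subset[of _ "{x}"]) (auto simp: free_gen_def)
  then show ?thesis using assms(2) by (auto simp: free_module_def free_gen_def)
qed

lemma submodule_submodule_span:
  assumes "module K M" "S \<subseteq> carrier M"
  shows "submodule (submodule_span K M S) K M"
proof -
  interpret module K M by fact
  have ne: "{H. submodule H K M \<and> S \<subseteq> H} \<noteq> {}"
    using carrier_is_submodule assms(2) by blast
  show ?thesis
    unfolding submodule_span_def
  proof (rule submoduleI)
    show "\<Inter> {H. submodule H K M \<and> S \<subseteq> H} \<subseteq> carrier M"
      using carrier_is_submodule assms(2) by blast
    show "\<zero>\<^bsub>M\<^esub> \<in> \<Inter> {H. submodule H K M \<and> S \<subseteq> H}"
      using subgroup.one_closed[OF submodule.axioms(1)] by fastforce
  next
    fix a assume a: "a \<in> \<Inter> {H. submodule H K M \<and> S \<subseteq> H}"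
    then show "\<ominus>\<^bsub>M\<^esub> a \<in> \<Inter> {H. submodule H K M \<and> S \<subseteq> H}"
      using submoduleE(3) by simp
    show "a \<oplus>\<^bsub>M\<^esub> b \<in> \<Inter> {H. submodule H K M \<and> S \<subseteq> H}"
      if "b \<in> \<Inter> {H. submodule H K M \<and> S \<subseteq> H}" for b
      using a that submoduleE(5) by simp
    show "c \<odot>\<^bsub>M\<^esub> a \<in> \<Inter> {H. submodule H K M \<and> S \<subseteq> H}" if "c \<in> carrier K" for c
      using a that submoduleE(4) by simp
  qed
qed

lemma submodule_span_subset:
  assumes "submodule H K M" "S \<subseteq> H" shows "submodule_span K M S \<subseteq> H"
  using assms unfolding submodule_span_def by blast

lemma submodule_span_superset: "S \<subseteq> submodule_span K M S"
  unfolding submodule_span_def by blast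

lemma quotient_module_facts:
  assumes "module K M" "submodule H K M"
  shows quotient_smult: "\<lbrakk>a \<in> carrier K; x \<in> carrier M\<rbrakk> \<Longrightarrow>
      a \<odot>\<^bsub>quotient_module M H\<^esub> (H +>\<^bsub>M\<^esub> x) = H +>\<^bsub>M\<^esub> (a \<odot>\<^bsub>M\<^esub> x)"
    and quotient_add: "\<lbrakk>x \<in> carrier M; y \<in> carrier M\<rbrakk> \<Longrightarrow>
      (H +>\<^bsub>M\<^esub> x) \<oplus>\<^bsub>quotient_module M H\<^esub> (H +>\<^bsub>M\<^esub> y) = H +>\<^bsub>M\<^esub> (x \<oplus>\<^bsub>M\<^esub> y)"
    and module_quotient: "module K (quotient_module M H)"
proof -
  interpret module K M by fact
  interpret H: submodule H K M by fact
  have sg: "additive_subgroup H M"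
    using H.subgroup_axioms by (simp add: additive_subgroup_def)
  interpret H': abelian_subgroup H M
    by (rule abelian_subgroupI3[OF sg]) (rule M.abelian_group_axioms)
  have sm: "a \<odot>\<^bsub>quotient_module M H\<^esub> (H +>\<^bsub>M\<^esub> x) = H +>\<^bsub>M\<^esub> (a \<odot>\<^bsub>M\<^esub> x)"
    if a: "a \<in> carrier K" and x: "x \<in> carrier M" for a x
  proof -
    have const: "H +>\<^bsub>M\<^esub> (a \<odot>\<^bsub>M\<^esub> y) = H +>\<^bsub>M\<^esub> (a \<odot>\<^bsub>M\<^esub> x)" if y: "y \<in> H +>\<^bsub>M\<^esub> x" for y
    proof -
      obtain h where h: "h \<in> H" "y = h \<oplus>\<^bsub>M\<^esub> x" using y by (auto simp: a_r_coset_def')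
      have "a \<odot>\<^bsub>M\<^esub> y = (a \<odot>\<^bsub>M\<^esub> h) \<oplus>\<^bsub>M\<^esub> (a \<odot>\<^bsub>M\<^esub> x)"
        using h a x H'.a_subset by (auto simp: smult_r_distr)
      moreover have "a \<odot>\<^bsub>M\<^esub> h \<in> H" using h a by blast
      ultimately have "a \<odot>\<^bsub>M\<^esub> y \<in> H +>\<^bsub>M\<^esub> (a \<odot>\<^bsub>M\<^esub> x)" by (auto simp: a_r_coset_def')
      then show ?thesis
        by (rule H'.a_repr_independence'[symmetric]) (rule smult_closed[OF a x])
    qed
    have "H +>\<^bsub>M\<^esub> x \<noteq> {}" using x H'.a_rcos_self by blast
    then have "(\<Union>y\<in>H +>\<^bsub>M\<^esub> x. H +>\<^bsub>M\<^esub> (a \<odot>\<^bsub>M\<^esub> y)) = H +>\<^bsub>M\<^esub> (a \<odot>\<^bsub>M\<^esub> x)"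
      by (rule SUP_eq_const) (rule const)
    then show ?thesis by (simp add: quotient_module_def)
  qed
  have ad: "(H +>\<^bsub>M\<^esub> x) \<oplus>\<^bsub>quotient_module M H\<^esub> (H +>\<^bsub>M\<^esub> y) = H +>\<^bsub>M\<^esub> (x \<oplus>\<^bsub>M\<^esub> y)"
    if "x \<in> carrier M" "y \<in> carrier M" for x y
    using that H'.a_rcos_sum by (simp add: quotient_module_def)
  show "\<lbrakk>a \<in> carrier K; x \<in> carrier M\<rbrakk> \<Longrightarrow>
      a \<odot>\<^bsub>quotient_module M H\<^esub> (H +>\<^bsub>M\<^esub> x) = H +>\<^bsub>M\<^esub> (a \<odot>\<^bsub>M\<^esub> x)" by (rule sm)
  show "\<lbrakk>x \<in> carrier M; y \<in> carrier M\<rbrakk> \<Longrightarrow>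
      (H +>\<^bsub>M\<^esub> x) \<oplus>\<^bsub>quotient_module M H\<^esub> (H +>\<^bsub>M\<^esub> y) = H +>\<^bsub>M\<^esub> (x \<oplus>\<^bsub>M\<^esub> y)" by (rule ad)
  have car: "X \<in> carrier (quotient_module M H) \<Longrightarrow> \<exists>x\<in>carrier M. X = H +>\<^bsub>M\<^esub> x" for X
    by (auto simp: quotient_module_def A_RCOSETS_def')
  have car': "x \<in> carrier M \<Longrightarrow> H +>\<^bsub>M\<^esub> x \<in> carrier (quotient_module M H)" for x
    by (auto simp: quotient_module_def A_RCOSETS_def')
  have z: "\<zero>\<^bsub>quotient_module M H\<^esub> = H +>\<^bsub>M\<^esub> \<zero>\<^bsub>M\<^esub>"
    using M.a_coset_add_zero[OF H'.a_subset] by (simp add: quotient_module_def)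
  have ag: "abelian_group (quotient_module M H)"
  proof (rule abelian_groupI)
    fix X assume "X \<in> carrier (quotient_module M H)"
    then obtain x where x: "x \<in> carrier M" "X = H +>\<^bsub>M\<^esub> x" using car by blast
    then show "\<exists>Y\<in>carrier (quotient_module M H).
        Y \<oplus>\<^bsub>quotient_module M H\<^esub> X = \<zero>\<^bsub>quotient_module M H\<^esub>"
      by (intro bexI[of _ "H +>\<^bsub>M\<^esub> (\<ominus>\<^bsub>M\<^esub> x)"]) (simp_all add: ad car' z M.l_neg)
  qed (auto dest!: car simp: ad car' z M.a_ac)
  show "module K (quotient_module M H)"
    by (rule moduleI[OF R.is_cring ag])
      (auto dest!: car simp: sm ad car' smult_l_distr smult_r_distr smult_assoc1)
qed

lemma quotient_carrierE:
  assumes "X \<in> carrier (quotient_module M H)"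
  obtains x where "x \<in> carrier M" "X = H +>\<^bsub>M\<^esub> x"
  using assms by (auto simp: quotient_module_def A_RCOSETS_def')

lemma quotient_carrierI: "x \<in> carrier M \<Longrightarrow> H +>\<^bsub>M\<^esub> x \<in> carrier (quotient_module M H)"
  by (auto simp: quotient_module_def A_RCOSETS_def')

lemma tensor_relators_carrier:
  assumes "module K A" "module K B"
  shows "tensor_relators K A B \<subseteq> carrier (free_module K (carrier A \<times> carrier B))"
proof -
  interpret A: module K A by fact
  interpret B: module K B by fact
  interpret F: module K "free_module K (carrier A \<times> carrier B)"
    by (rule module_free) (rule A.R.is_cring)
  note g = free_gen_in_carrier[OF A.R.is_cring, where S = "carrier A \<times> carrier B"]
  show ?thesis
    unfolding tensor_relators_def Let_def
    by (auto intro!: F.M.minus_closed F.M.add.m_closed F.smult_closed g)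
qed

lemma submodule_tensor_kernel:
  assumes "module K A" "module K B"
  shows "submodule (tensor_kernel K A B) K (free_module K (carrier A \<times> carrier B))"
  unfolding tensor_kernel_def
  by (intro submodule_submodule_span tensor_relators_carrier module_free assms)
     (use assms module.axioms in blast)

lemma module_tensor:
  assumes "module K A" "module K B"
  shows "module K (tensor K A B)"
  unfolding tensor_def
  by (intro module_quotient submodule_tensor_kernel module_free assms)
     (use assms module.axioms in blast)

lemma pure_tensor_bilinear:
  assumes "module K A" "module K B"
  shows "pure_tensor K A B \<in> bilinear_maps K A B (tensor K A B)"
proof -
  interpret A: module K A by fact
  interpret B: module K B by fact
  let ?F = "free_module K (carrier A \<times> carrier B)"
  let ?H = "tensor_kernel K A B"
  interpret F: module K ?F by (rule module_free) (rule A.R.is_cring)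
  note sub = submodule_tensor_kernel[OF assms]
  interpret H: submodule ?H K ?F by (rule sub)
  have sg: "additive_subgroup ?H ?F"
    using H.subgroup_axioms by (simp add: additive_subgroup_def)
  interpret H': abelian_subgroup ?H ?F
    by (rule abelian_subgroupI3[OF sg]) (rule F.M.abelian_group_axioms)
  note g = free_gen_in_carrier[OF A.R.is_cring, where S = "carrier A \<times> carrier B"]
  have eq: "?H +>\<^bsub>?F\<^esub> u = ?H +>\<^bsub>?F\<^esub> v"
    if "u \<in> carrier ?F" "v \<in> carrier ?F" "u \<ominus>\<^bsub>?F\<^esub> v \<in> tensor_relators K A B" for u v
  proof -
    have "u \<ominus>\<^bsub>?F\<^esub> v \<in> ?H"
      unfolding tensor_kernel_def by (rule subsetD[OF submodule_span_superset that(3)])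
    moreover have "u = (u \<ominus>\<^bsub>?F\<^esub> v) \<oplus>\<^bsub>?F\<^esub> v"
      using that by (simp add: a_minus_def F.M.a_assoc F.M.l_neg)
    ultimately have "u \<in> ?H +>\<^bsub>?F\<^esub> v" unfolding a_r_coset_def' by auto
    then show ?thesis
      by (rule H'.a_repr_independence'[symmetric]) (rule that(2))
  qed
  note q = quotient_add[OF F.module_axioms sub] quotient_smult[OF F.module_axioms sub]
  show ?thesis
    unfolding bilinear_maps_def tensor_def pure_tensor_def
  proof (intro CollectI conjI ballI linear_mapsI quotient_carrierI)
    fix a b b' assume *: "a \<in> carrier A" "b \<in> carrier B" "b' \<in> carrier B"
    have "free_gen K (a, b \<oplus>\<^bsub>B\<^esub> b') \<ominus>\<^bsub>?F\<^esub> (free_gen K (a, b) \<oplus>\<^bsub>?F\<^esub> free_gen K (a, b')) \<in> tensor_relators K A B"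
      unfolding tensor_relators_def Let_def using * by blast
    then have "?H +>\<^bsub>?F\<^esub> free_gen K (a, b \<oplus>\<^bsub>B\<^esub> b') = ?H +>\<^bsub>?F\<^esub> (free_gen K (a, b) \<oplus>\<^bsub>?F\<^esub> free_gen K (a, b'))"
      by (rule eq[rotated 2]) (use * g in auto)
    then show "?H +>\<^bsub>?F\<^esub> free_gen K (a, b \<oplus>\<^bsub>B\<^esub> b') = (?H +>\<^bsub>?F\<^esub> free_gen K (a, b)) \<oplus>\<^bsub>quotient_module ?F ?H\<^esub> (?H +>\<^bsub>?F\<^esub> free_gen K (a, b'))"
      using * g by (simp add: q)
  next
    fix a c b assume *: "a \<in> carrier A" "c \<in> carrier K" "b \<in> carrier B"
    have "free_gen K (a, c \<odot>\<^bsub>B\<^esub> b) \<ominus>\<^bsub>?F\<^esub> (c \<odot>\<^bsub>?F\<^esub> free_gen K (a, b)) \<in> tensor_relators K A B"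
      unfolding tensor_relators_def Let_def using * by blast
    then have "?H +>\<^bsub>?F\<^esub> free_gen K (a, c \<odot>\<^bsub>B\<^esub> b) = ?H +>\<^bsub>?F\<^esub> (c \<odot>\<^bsub>?F\<^esub> free_gen K (a, b))"
      by (rule eq[rotated 2]) (use * g in auto)
    then show "?H +>\<^bsub>?F\<^esub> free_gen K (a, c \<odot>\<^bsub>B\<^esub> b) = c \<odot>\<^bsub>quotient_module ?F ?H\<^esub> (?H +>\<^bsub>?F\<^esub> free_gen K (a, b))"
      using * g by (simp add: q)
  next
    fix b a a' assume *: "b \<in> carrier B" "a \<in> carrier A" "a' \<in> carrier A"
    have "free_gen K (a \<oplus>\<^bsub>A\<^esub> a', b) \<ominus>\<^bsub>?F\<^esub> (free_gen K (a, b) \<oplus>\<^bsub>?F\<^esub> free_gen K (a', b)) \<in> tensor_relators K A B"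
      unfolding tensor_relators_def Let_def using * by blast
    then have "?H +>\<^bsub>?F\<^esub> free_gen K (a \<oplus>\<^bsub>A\<^esub> a', b) = ?H +>\<^bsub>?F\<^esub> (free_gen K (a, b) \<oplus>\<^bsub>?F\<^esub> free_gen K (a', b))"
      by (rule eq[rotated 2]) (use * g in auto)
    then show "?H +>\<^bsub>?F\<^esub> free_gen K (a \<oplus>\<^bsub>A\<^esub> a', b) = (?H +>\<^bsub>?F\<^esub> free_gen K (a, b)) \<oplus>\<^bsub>quotient_module ?F ?H\<^esub> (?H +>\<^bsub>?F\<^esub> free_gen K (a', b))"
      using * g by (simp add: q)
  next
    fix b c a assume *: "b \<in> carrier B" "c \<in> carrier K" "a \<in> carrier A"
    have "free_gen K (c \<odot>\<^bsub>A\<^esub> a, b) \<ominus>\<^bsub>?F\<^esub> (c \<odot>\<^bsub>?F\<^esub> free_gen K (a, b)) \<in> tensor_relators K A B"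
      unfolding tensor_relators_def Let_def using * by blast
    then have "?H +>\<^bsub>?F\<^esub> free_gen K (c \<odot>\<^bsub>A\<^esub> a, b) = ?H +>\<^bsub>?F\<^esub> (c \<odot>\<^bsub>?F\<^esub> free_gen K (a, b))"
      by (rule eq[rotated 2]) (use * g in auto)
    then show "?H +>\<^bsub>?F\<^esub> free_gen K (c \<odot>\<^bsub>A\<^esub> a, b) = c \<odot>\<^bsub>quotient_module ?F ?H\<^esub> (?H +>\<^bsub>?F\<^esub> free_gen K (a, b))"
      using * g by (simp add: q)
  qed (auto intro: g)
qed

lemma free_eval_cong_support:
  assumes "module K W" "c \<in> carrier (free_module K S)" "f \<in> S \<rightarrow> carrier W"
    "finite T" "{x. c x \<noteq> \<zero>\<^bsub>K\<^esub>} \<subseteq> T" "T \<subseteq> S"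
  shows "free_eval K W f c = (\<Oplus>\<^bsub>W\<^esub>x\<in>T. c x \<odot>\<^bsub>W\<^esub> f x)"
proof -
  interpret W: module K W by fact
  show ?thesis
    unfolding free_eval_def
    by (rule W.M.add.finprod_mono_neutral_cong_left[symmetric, THEN sym])
      (use assms in \<open>auto simp: free_module_def Pi_def\<close>)
qed

lemma free_eval_linear:
  assumes "module K W" "f \<in> S \<rightarrow> carrier W"
  shows "free_eval K W f \<in> linear_maps K (free_module K S) W"
proof -
  interpret W: module K W by fact
  interpret F: module K "free_module K S" by (rule module_free) (rule W.R.is_cring)
  let ?s = "\<lambda>c. {x. c x \<noteq> \<zero>\<^bsub>K\<^esub>}"
  have fin: "finite (?s c)" "?s c \<subseteq> S" "\<And>x. c x \<in> carrier K"
    if "c \<in> carrier (free_module K S)" for c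
    using that by (auto simp: free_module_def)
  note ev = free_eval_cong_support[OF assms(1) _ assms(2)]
  show ?thesis
  proof (rule linear_mapsI)
    fix c assume c: "c \<in> carrier (free_module K S)"
    show "free_eval K W f c \<in> carrier W"
      unfolding free_eval_def
      by (rule W.M.finsum_closed) (use fin[OF c] assms(2) in auto)
  next
    fix c d assume c: "c \<in> carrier (free_module K S)" and d: "d \<in> carrier (free_module K S)"
    let ?T = "?s c \<union> ?s d"
    have T: "finite ?T" "?T \<subseteq> S" using fin[OF c] fin[OF d] by auto
    have cd: "c \<oplus>\<^bsub>free_module K S\<^esub> d = (\<lambda>x. c x \<oplus>\<^bsub>K\<^esub> d x)" by (simp add: free_module_def)
    have cl: "c x \<odot>\<^bsub>W\<^esub> f x \<in> carrier W" "d x \<odot>\<^bsub>W\<^esub> f x \<in> carrier W" if "x \<in> ?T" for x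
    proof -
      have "f x \<in> carrier W" using that T(2) assms(2) by blast
      then show "c x \<odot>\<^bsub>W\<^esub> f x \<in> carrier W" "d x \<odot>\<^bsub>W\<^esub> f x \<in> carrier W"
        using fin(3)[OF c] fin(3)[OF d] by (blast intro: W.smult_closed)+
    qed
    have s: "?s (\<lambda>x. c x \<oplus>\<^bsub>K\<^esub> d x) \<subseteq> ?T" by auto
    have "free_eval K W f (c \<oplus>\<^bsub>free_module K S\<^esub> d) = (\<Oplus>\<^bsub>W\<^esub>x\<in>?T. (c x \<oplus>\<^bsub>K\<^esub> d x) \<odot>\<^bsub>W\<^esub> f x)"
      using ev[OF F.M.add.m_closed[OF c d] T(1) _ T(2)] s by (simp add: cd)
    also have "\<dots> = (\<Oplus>\<^bsub>W\<^esub>x\<in>?T. (c x \<odot>\<^bsub>W\<^esub> f x) \<oplus>\<^bsub>W\<^esub> (d x \<odot>\<^bsub>W\<^esub> f x))"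
    proof (rule W.M.finsum_cong'[OF refl])
      show "(\<lambda>x. (c x \<odot>\<^bsub>W\<^esub> f x) \<oplus>\<^bsub>W\<^esub> (d x \<odot>\<^bsub>W\<^esub> f x)) \<in> ?T \<rightarrow> carrier W"
        using cl by blast
      fix x assume "x \<in> ?T"
      then have "f x \<in> carrier W" using T(2) assms(2) by blast
      then show "(c x \<oplus>\<^bsub>K\<^esub> d x) \<odot>\<^bsub>W\<^esub> f x = (c x \<odot>\<^bsub>W\<^esub> f x) \<oplus>\<^bsub>W\<^esub> (d x \<odot>\<^bsub>W\<^esub> f x)"
        by (rule W.smult_l_distr[OF fin(3)[OF c] fin(3)[OF d]])
    qed
    also have "\<dots> = (\<Oplus>\<^bsub>W\<^esub>x\<in>?T. c x \<odot>\<^bsub>W\<^esub> f x) \<oplus>\<^bsub>W\<^esub> (\<Oplus>\<^bsub>W\<^esub>x\<in>?T. d x \<odot>\<^bsub>W\<^esub> f x)"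
      by (rule W.M.finsum_addf) (use cl in blast)+
    finally show "free_eval K W f (c \<oplus>\<^bsub>free_module K S\<^esub> d) = free_eval K W f c \<oplus>\<^bsub>W\<^esub> free_eval K W f d"
      using ev[OF c T(1) _ T(2)] ev[OF d T(1) _ T(2)] by simp
  next
    fix a c assume a: "a \<in> carrier K" and c: "c \<in> carrier (free_module K S)"
    have ac: "a \<odot>\<^bsub>free_module K S\<^esub> c = (\<lambda>x. a \<otimes>\<^bsub>K\<^esub> c x)" by (simp add: free_module_def)
    have s: "?s (\<lambda>x. a \<otimes>\<^bsub>K\<^esub> c x) \<subseteq> ?s c" using a by auto
    have "free_eval K W f (a \<odot>\<^bsub>free_module K S\<^esub> c) = (\<Oplus>\<^bsub>W\<^esub>x\<in>?s c. (a \<otimes>\<^bsub>K\<^esub> c x) \<odot>\<^bsub>W\<^esub> f x)"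
      using ev[OF F.smult_closed[OF a c] fin(1)[OF c] _ fin(2)[OF c]] s by (simp add: ac)
    also have "\<dots> = (\<Oplus>\<^bsub>W\<^esub>x\<in>?s c. a \<odot>\<^bsub>W\<^esub> (c x \<odot>\<^bsub>W\<^esub> f x))"
    proof (rule W.M.finsum_cong'[OF refl])
      have fW: "f x \<in> carrier W" if "x \<in> ?s c" for x using that fin(2)[OF c] assms(2) by blast
      show "(\<lambda>x. a \<odot>\<^bsub>W\<^esub> (c x \<odot>\<^bsub>W\<^esub> f x)) \<in> ?s c \<rightarrow> carrier W"
        by (intro Pi_I W.smult_closed a fin(3)[OF c] fW)
      fix x assume "x \<in> ?s c"
      then show "(a \<otimes>\<^bsub>K\<^esub> c x) \<odot>\<^bsub>W\<^esub> f x = a \<odot>\<^bsub>W\<^esub> (c x \<odot>\<^bsub>W\<^esub> f x)"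
        by (intro W.smult_assoc1 a fin(3)[OF c] fW)
    qed
    also have "\<dots> = a \<odot>\<^bsub>W\<^esub> free_eval K W f c"
      unfolding free_eval_def
      by (rule W.finsum_smult_ldistr[symmetric]) (use a fin[OF c] assms(2) in auto)
    finally show "free_eval K W f (a \<odot>\<^bsub>free_module K S\<^esub> c) = a \<odot>\<^bsub>W\<^esub> free_eval K W f c" .
  qed
qed

lemma free_eval_gen:
  assumes "module K W" "f \<in> S \<rightarrow> carrier W" "x \<in> S"
  shows "free_eval K W f (free_gen K x) = f x"
proof -
  interpret W: module K W by fact
  have "free_eval K W f (free_gen K x) = (\<Oplus>\<^bsub>W\<^esub>y\<in>{x}. free_gen K x y \<odot>\<^bsub>W\<^esub> f y)"
    by (rule free_eval_cong_support[OF assms(1) free_gen_in_carrier[OF W.R.is_cring] assms(2)])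
      (use assms(3) in \<open>auto simp: free_gen_def\<close>)
  also have "\<dots> = f x"
    using assms(2,3) by (simp add: free_gen_def Pi_def)
  finally show ?thesis .
qed

lemma linear_maps_minus:
  assumes "module K M" "module K N" "f \<in> linear_maps K M N" "x \<in> carrier M" "y \<in> carrier M"
  shows "f (x \<ominus>\<^bsub>M\<^esub> y) = f x \<ominus>\<^bsub>N\<^esub> f y" "f \<zero>\<^bsub>M\<^esub> = \<zero>\<^bsub>N\<^esub>"
proof -
  interpret M: module K M by fact
  interpret N: module K N by fact
  note f = linear_mapsD[OF assms(3)]
  show "f \<zero>\<^bsub>M\<^esub> = \<zero>\<^bsub>N\<^esub>"
    using f(3)[of "\<zero>\<^bsub>K\<^esub>" x] assms(4) f(1) by simp
  have y: "\<ominus>\<^bsub>M\<^esub> y = (\<ominus>\<^bsub>K\<^esub> \<one>\<^bsub>K\<^esub>) \<odot>\<^bsub>M\<^esub> y" using assms(5) by (simp add: M.smult_l_minus)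
  have fy: "\<ominus>\<^bsub>N\<^esub> f y = (\<ominus>\<^bsub>K\<^esub> \<one>\<^bsub>K\<^esub>) \<odot>\<^bsub>N\<^esub> f y" using assms(5) f(1) by (simp add: N.smult_l_minus)
  have "f (\<ominus>\<^bsub>M\<^esub> y) = \<ominus>\<^bsub>N\<^esub> f y" unfolding y fy using f(3) assms(5) by simp
  then show "f (x \<ominus>\<^bsub>M\<^esub> y) = f x \<ominus>\<^bsub>N\<^esub> f y"
    using f(2)[of x "\<ominus>\<^bsub>M\<^esub> y"] assms(4,5) by (simp add: a_minus_def)
qed

lemma submodule_linear_kernel:
  assumes "module K M" "module K N" "f \<in> linear_maps K M N"
  shows "submodule {x \<in> carrier M. f x = \<zero>\<^bsub>N\<^esub>} K M"
proof -
  interpret M: module K M by fact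
  interpret N: module K N by fact
  note f = linear_mapsD[OF assms(3)] and z = linear_maps_minus[OF assms]
  show ?thesis
  proof (rule M.submoduleI)
    fix x assume "x \<in> {x \<in> carrier M. f x = \<zero>\<^bsub>N\<^esub>}"
    then show "\<ominus>\<^bsub>M\<^esub> x \<in> {x \<in> carrier M. f x = \<zero>\<^bsub>N\<^esub>}"
      using z(1)[of "\<zero>\<^bsub>M\<^esub>" x] z(2)[of x x] by (simp add: a_minus_def)
  qed (use f z(2)[of "\<zero>\<^bsub>M\<^esub>" "\<zero>\<^bsub>M\<^esub>"] in auto)
qed

lemma bilinear_mapsD:
  assumes "f \<in> bilinear_maps K A B W"
  shows "a \<in> carrier A \<Longrightarrow> f a \<in> linear_maps K B W"
    and "b \<in> carrier B \<Longrightarrow> (\<lambda>a. f a b) \<in> linear_maps K A W"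
  using assms unfolding bilinear_maps_def by auto

lemma tensor_lift_coset:
  assumes "module K A" "module K B" "module K W" "f \<in> bilinear_maps K A B W"
    and c: "c \<in> carrier (free_module K (carrier A \<times> carrier B))"
  shows "tensor_lift K W f (tensor_kernel K A B +>\<^bsub>free_module K (carrier A \<times> carrier B)\<^esub> c) =
    free_eval K W (\<lambda>(a, b). f a b) c"
proof -
  interpret A: module K A by fact
  interpret B: module K B by fact
  interpret W: module K W by fact
  let ?F = "free_module K (carrier A \<times> carrier B)"
  let ?H = "tensor_kernel K A B"
  let ?e = "free_eval K W (\<lambda>(a, b). f a b)"
  interpret F: module K ?F by (rule module_free) (rule A.R.is_cring)
  interpret H: submodule ?H K ?F by (rule submodule_tensor_kernel) fact+
  note g = free_gen_in_carrier[OF A.R.is_cring, where S = "carrier A \<times> carrier B"]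
  note f1 = linear_mapsD[OF bilinear_mapsD(1)[OF assms(4)]]
  note f2 = linear_mapsD[OF bilinear_mapsD(2)[OF assms(4)]]
  have fS: "(\<lambda>(a, b). f a b) \<in> carrier A \<times> carrier B \<rightarrow> carrier W" using f1(1) by auto
  note e = free_eval_linear[OF assms(3) fS]
  note eD = linear_mapsD[OF e]
  note eg = free_eval_gen[OF assms(3) fS]
  note em = linear_maps_minus(1)[OF F.module_axioms assms(3) e]
  have rr: "w \<ominus>\<^bsub>W\<^esub> w = \<zero>\<^bsub>W\<^esub>" if "w \<in> carrier W" for w
    using that by (simp add: a_minus_def W.M.r_neg)
  have "?H \<subseteq> {x \<in> carrier ?F. ?e x = \<zero>\<^bsub>W\<^esub>}"
    unfolding tensor_kernel_def
  proof (rule submodule_span_subset[OF submodule_linear_kernel[OF F.module_axioms assms(3) e]])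
    have "?e u = \<zero>\<^bsub>W\<^esub>" if "u \<in> tensor_relators K A B" for u
      using that unfolding tensor_relators_def Let_def
      by (auto simp: em eD eg g f1 f2 rr)
    then show "tensor_relators K A B \<subseteq> {x \<in> carrier ?F. ?e x = \<zero>\<^bsub>W\<^esub>}"
      using tensor_relators_carrier[OF assms(1,2)] by auto
  qed
  then have const: "?e d = ?e c" if "d \<in> ?H +>\<^bsub>?F\<^esub> c" for d
    using that c eD by (auto simp: a_r_coset_def')
  have "c \<in> ?H +>\<^bsub>?F\<^esub> c"
    using H.one_closed c F.M.l_zero[OF c] unfolding a_r_coset_def' by force
  then have "(SOME d. d \<in> ?H +>\<^bsub>?F\<^esub> c) \<in> ?H +>\<^bsub>?F\<^esub> c"
    by (rule someI[where P = "\<lambda>d. d \<in> ?H +>\<^bsub>?F\<^esub> c"])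
  then show ?thesis unfolding tensor_lift_def by (rule const)
qed

theorem tensor_lift_linear:
  assumes "module K A" "module K B" "module K W" "f \<in> bilinear_maps K A B W"
  shows "tensor_lift K W f \<in> linear_maps K (tensor K A B) W"
proof -
  interpret A: module K A by fact
  let ?F = "free_module K (carrier A \<times> carrier B)"
  interpret F: module K ?F by (rule module_free) (rule A.R.is_cring)
  note sub = submodule_tensor_kernel[OF assms(1,2)]
  note q = quotient_add[OF F.module_axioms sub] quotient_smult[OF F.module_axioms sub]
  note f1 = linear_mapsD[OF bilinear_mapsD(1)[OF assms(4)]]
  have fS: "(\<lambda>(a, b). f a b) \<in> carrier A \<times> carrier B \<rightarrow> carrier W" using f1(1) by auto
  note e = linear_mapsD[OF free_eval_linear[OF assms(3) fS]]
  show ?thesis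
    unfolding tensor_def
    by (rule linear_mapsI)
      (auto elim!: quotient_carrierE simp: q tensor_lift_coset[OF assms] e)
qed

theorem tensor_lift_pure:
  assumes "module K A" "module K B" "module K W" "f \<in> bilinear_maps K A B W"
    and "a \<in> carrier A" "b \<in> carrier B"
  shows "tensor_lift K W f (pure_tensor K A B a b) = f a b"
proof -
  interpret A: module K A by fact
  have fS: "(\<lambda>(a, b). f a b) \<in> carrier A \<times> carrier B \<rightarrow> carrier W"
    using linear_mapsD(1)[OF bilinear_mapsD(1)[OF assms(4)]] by auto
  show ?thesis
    unfolding pure_tensor_def
    using tensor_lift_coset[OF assms(1-4) free_gen_in_carrier[OF A.R.is_cring]]
      free_eval_gen[OF assms(3) fS] assms(5,6) by simp
qed

lemma free_module_induct:
  assumes K: "cring K" and H: "submodule H K (free_module K S)"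
    and g: "\<And>x. x \<in> S \<Longrightarrow> free_gen K x \<in> H"
  shows "carrier (free_module K S) \<subseteq> H"
proof
  interpret cring K by fact
  interpret F: module K "free_module K S" by (rule module_free) fact
  interpret H: submodule H K "free_module K S" by fact
  fix c assume c: "c \<in> carrier (free_module K S)"
  have "finite T \<Longrightarrow> \<forall>c\<in>carrier (free_module K S). {x. c x \<noteq> \<zero>\<^bsub>K\<^esub>} \<subseteq> T \<longrightarrow> c \<in> H" for T
  proof (induction T rule: finite_induct)
    case empty
    show ?case using H.one_closed by (auto simp: free_module_def intro!: back_subst[of "\<lambda>c. c \<in> H"])
  next
    case (insert t T)
    show ?case
    proof (intro ballI impI)
      fix c assume c: "c \<in> carrier (free_module K S)" and s: "{x. c x \<noteq> \<zero>\<^bsub>K\<^esub>} \<subseteq> insert t T"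
      show "c \<in> H"
      proof (cases "t \<in> S")
        case False
        then have "c t = \<zero>\<^bsub>K\<^esub>" using c by (auto simp: free_module_def)
        then have "{x. c x \<noteq> \<zero>\<^bsub>K\<^esub>} \<subseteq> T" using s by auto
        then show ?thesis using insert.IH c by blast
      next
        case True
        let ?d = "\<lambda>x. if x = t then \<zero>\<^bsub>K\<^esub> else c x"
        have ck: "c x \<in> carrier K" for x using c by (auto simp: free_module_def)
        have "finite {x. ?d x \<noteq> \<zero>\<^bsub>K\<^esub>}"
          by (rule finite_subset[of _ "{x. c x \<noteq> \<zero>\<^bsub>K\<^esub>}"]) (use c in \<open>auto simp: free_module_def\<close>)
        then have "?d \<in> carrier (free_module K S)" using c by (auto simp: free_module_def)
        moreover have "{x. ?d x \<noteq> \<zero>\<^bsub>K\<^esub>} \<subseteq> T" using s by auto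
        ultimately have "?d \<in> H" by (rule insert.IH[rule_format])
        moreover have "c t \<odot>\<^bsub>free_module K S\<^esub> free_gen K t \<in> H" using g[OF True] ck by blast
        moreover have "c = ?d \<oplus>\<^bsub>free_module K S\<^esub> (c t \<odot>\<^bsub>free_module K S\<^esub> free_gen K t)"
          using ck by (auto simp: free_module_def free_gen_def)
        ultimately show ?thesis using H.m_closed by (metis F.submoduleE(5)[OF H])
      qed
    qed
  qed
  then show "c \<in> H" using c by (auto simp: free_module_def)
qed

theorem tensor_ext:
  assumes "module K A" "module K B" "module K W"
    and f: "f \<in> linear_maps K (tensor K A B) W" and g: "g \<in> linear_maps K (tensor K A B) W"
    and eq: "\<And>a b. \<lbrakk>a \<in> carrier A; b \<in> carrier B\<rbrakk> \<Longrightarrow>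
      f (pure_tensor K A B a b) = g (pure_tensor K A B a b)"
    and x: "x \<in> carrier (tensor K A B)"
  shows "f x = g x"
proof -
  interpret A: module K A by fact
  interpret W: module K W by fact
  let ?F = "free_module K (carrier A \<times> carrier B)"
  let ?H = "tensor_kernel K A B"
  interpret F: module K ?F by (rule module_free) (rule A.R.is_cring)
  note sub = submodule_tensor_kernel[OF assms(1,2)]
  note q = quotient_add[OF F.module_axioms sub, symmetric]
    quotient_smult[OF F.module_axioms sub, symmetric]
  note fD = linear_mapsD[OF f, unfolded tensor_def]
  note gD = linear_mapsD[OF g, unfolded tensor_def]
  have fl: "(\<lambda>c. f (?H +>\<^bsub>?F\<^esub> c)) \<in> linear_maps K ?F W"
    by (rule linear_mapsI) (auto simp: q fD quotient_carrierI)
  have gl: "(\<lambda>c. g (?H +>\<^bsub>?F\<^esub> c)) \<in> linear_maps K ?F W"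
    by (rule linear_mapsI) (auto simp: q gD quotient_carrierI)
  note flD = linear_mapsD[OF fl] and glD = linear_mapsD[OF gl]
    and fm = linear_maps_minus[OF F.module_axioms assms(3) fl]
    and gm = linear_maps_minus[OF F.module_axioms assms(3) gl]
  have "submodule {c \<in> carrier ?F. f (?H +>\<^bsub>?F\<^esub> c) = g (?H +>\<^bsub>?F\<^esub> c)} K ?F"
  proof (rule F.submoduleI)
    fix x assume "x \<in> {c \<in> carrier ?F. f (?H +>\<^bsub>?F\<^esub> c) = g (?H +>\<^bsub>?F\<^esub> c)}"
    then show "\<ominus>\<^bsub>?F\<^esub> x \<in> {c \<in> carrier ?F. f (?H +>\<^bsub>?F\<^esub> c) = g (?H +>\<^bsub>?F\<^esub> c)}"
      using fm(1)[of "\<zero>\<^bsub>?F\<^esub>" x] gm(1)[of "\<zero>\<^bsub>?F\<^esub>" x] fm(2)[of x x] gm(2)[of x x]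
      by (simp add: a_minus_def)
  qed (use flD glD fm(2)[of "\<zero>\<^bsub>?F\<^esub>" "\<zero>\<^bsub>?F\<^esub>"] gm(2)[of "\<zero>\<^bsub>?F\<^esub>" "\<zero>\<^bsub>?F\<^esub>"] in auto)
  then have "carrier ?F \<subseteq> {c \<in> carrier ?F. f (?H +>\<^bsub>?F\<^esub> c) = g (?H +>\<^bsub>?F\<^esub> c)}"
    by (rule free_module_induct[OF A.R.is_cring])
      (use eq in \<open>auto simp: pure_tensor_def intro!: free_gen_in_carrier A.R.is_cring\<close>)
  moreover obtain c where "c \<in> carrier ?F" "x = ?H +>\<^bsub>?F\<^esub> c"
    using x unfolding tensor_def by (rule quotient_carrierE)
  ultimately show ?thesis by blast
qed

lemma pure_tensor_simps:
  assumes "module K A" "module K B" "a \<in> carrier A" "b \<in> carrier B"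
  shows "pure_tensor K A B a b \<in> carrier (tensor K A B)"
    and "a' \<in> carrier A \<Longrightarrow> pure_tensor K A B (a \<oplus>\<^bsub>A\<^esub> a') b =
      pure_tensor K A B a b \<oplus>\<^bsub>tensor K A B\<^esub> pure_tensor K A B a' b"
    and "b' \<in> carrier B \<Longrightarrow> pure_tensor K A B a (b \<oplus>\<^bsub>B\<^esub> b') =
      pure_tensor K A B a b \<oplus>\<^bsub>tensor K A B\<^esub> pure_tensor K A B a b'"
    and "c \<in> carrier K \<Longrightarrow> pure_tensor K A B (c \<odot>\<^bsub>A\<^esub> a) b =
      c \<odot>\<^bsub>tensor K A B\<^esub> pure_tensor K A B a b"
    and "c \<in> carrier K \<Longrightarrow> pure_tensor K A B a (c \<odot>\<^bsub>B\<^esub> b) =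
      c \<odot>\<^bsub>tensor K A B\<^esub> pure_tensor K A B a b"
  using linear_mapsD[OF bilinear_mapsD(1)[OF pure_tensor_bilinear[OF assms(1,2)]]]
    linear_mapsD[OF bilinear_mapsD(2)[OF pure_tensor_bilinear[OF assms(1,2)]]] assms(3,4)
  by auto

lemma tensor_map_bilinear:
  assumes "module K A'" "module K B'" "f \<in> linear_maps K A A'" "g \<in> linear_maps K B B'"
  shows "(\<lambda>a b. pure_tensor K A' B' (f a) (g b)) \<in> bilinear_maps K A B (tensor K A' B')"
  unfolding bilinear_maps_def
  by (auto intro!: linear_mapsI
      simp: pure_tensor_simps[OF assms(1,2)] linear_mapsD[OF assms(3)] linear_mapsD[OF assms(4)])

lemma tensor_map_linear:
  assumes "module K A" "module K B" "module K A'" "module K B'"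
    and "f \<in> linear_maps K A A'" "g \<in> linear_maps K B B'"
  shows "tensor_map K A' B' f g \<in> linear_maps K (tensor K A B) (tensor K A' B')"
  unfolding tensor_map_def
  by (intro tensor_lift_linear tensor_map_bilinear module_tensor assms)

lemma tensor_map_pure:
  assumes "module K A" "module K B" "module K A'" "module K B'"
    and "f \<in> linear_maps K A A'" "g \<in> linear_maps K B B'" "a \<in> carrier A" "b \<in> carrier B"
  shows "tensor_map K A' B' f g (pure_tensor K A B a b) = pure_tensor K A' B' (f a) (g b)"
  unfolding tensor_map_def
  by (intro tensor_lift_pure tensor_map_bilinear module_tensor assms)

text \<open>A family of linear maps on \<open>A \<otimes> B\<close> that depends linearly on \<open>c \<in> C\<close> on pure tensors does
  so everywhere.\<close>

lemma tensor_family_linear: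
  assumes "module K A" "module K B" "module K C" "module K W"
    and l: "\<And>c. c \<in> carrier C \<Longrightarrow> h c \<in> linear_maps K (tensor K A B) W"
    and p: "\<And>a b. \<lbrakk>a \<in> carrier A; b \<in> carrier B\<rbrakk> \<Longrightarrow>
      (\<lambda>c. h c (pure_tensor K A B a b)) \<in> linear_maps K C W"
    and t: "t \<in> carrier (tensor K A B)"
  shows "(\<lambda>c. h c t) \<in> linear_maps K C W"
proof -
  interpret C: module K C by fact
  interpret W: module K W by fact
  interpret T: module K "tensor K A B" by (rule module_tensor) fact+
  note lD = linear_mapsD[OF l] and pD = linear_mapsD[OF p]
  show ?thesis
  proof (rule linear_mapsI)
    fix c assume "c \<in> carrier C"
    then show "h c t \<in> carrier W" using lD(1) t by blast
  next
    fix c d assume cd: "c \<in> carrier C" "d \<in> carrier C"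
    have "(\<lambda>t. h c t \<oplus>\<^bsub>W\<^esub> h d t) \<in> linear_maps K (tensor K A B) W"
      by (rule linear_mapsI) (use cd in \<open>auto simp: lD W.smult_r_distr W.M.a_ac\<close>)
    then show "h (c \<oplus>\<^bsub>C\<^esub> d) t = h c t \<oplus>\<^bsub>W\<^esub> h d t"
      using tensor_ext[OF assms(1,2,4) l[of "c \<oplus>\<^bsub>C\<^esub> d"] _ _ t] cd pD(2) by simp
  next
    fix k c assume kc: "k \<in> carrier K" "c \<in> carrier C"
    have "(\<lambda>t. k \<odot>\<^bsub>W\<^esub> h c t) \<in> linear_maps K (tensor K A B) W"
      by (rule linear_mapsI)
        (use kc in \<open>auto simp: lD W.smult_r_distr W.smult_assoc1[symmetric] C.R.m_comm\<close>)
    then show "h (k \<odot>\<^bsub>C\<^esub> c) t = k \<odot>\<^bsub>W\<^esub> h c t"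
      using tensor_ext[OF assms(1,2,4) l[of "k \<odot>\<^bsub>C\<^esub> c"] _ _ t] kc pD(3) by simp
  qed
qed

lemma
  assumes "module K X" "module K Y" "module K Z"
  shows tensor_assoc_linear: "tensor_assoc K X Y Z \<in>
      linear_maps K (tensor K (tensor K X Y) Z) (tensor K X (tensor K Y Z))"
    and tensor_assoc_pure: "\<lbrakk>x \<in> carrier X; y \<in> carrier Y; z \<in> carrier Z\<rbrakk> \<Longrightarrow>
      tensor_assoc K X Y Z (pure_tensor K (tensor K X Y) Z (pure_tensor K X Y x y) z) =
      pure_tensor K X (tensor K Y Z) x (pure_tensor K Y Z y z)"
proof -
  let ?W = "tensor K X (tensor K Y Z)"
  note m = assms module_tensor[OF assms(1,2)] module_tensor[OF assms(2,3)]
    module_tensor[OF assms(1) module_tensor[OF assms(2,3)]]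
  let ?f = "\<lambda>z x y. pure_tensor K X (tensor K Y Z) x (pure_tensor K Y Z y z)"
  note s = pure_tensor_simps[OF assms(1) m(5)] pure_tensor_simps[OF assms(2,3)]
  have f: "?f z \<in> bilinear_maps K X Y ?W" if "z \<in> carrier Z" for z
    unfolding bilinear_maps_def by (use that in \<open>auto intro!: linear_mapsI simp: s\<close>)
  note ll = tensor_lift_linear[OF assms(1,2) m(6) f] and lp = tensor_lift_pure[OF assms(1,2) m(6) f]
  have p: "(\<lambda>z. tensor_lift K ?W (?f z) (pure_tensor K X Y x y)) \<in> linear_maps K Z ?W"
    if "x \<in> carrier X" "y \<in> carrier Y" for x y
    by (rule linear_mapsI)
      (use that module.smult_closed[OF assms(3)] assms(3)[unfolded module_def]
       in \<open>auto simp: lp s abelian_group.axioms abelian_monoid.a_closed\<close>)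
  have "(\<lambda>z. tensor_lift K ?W (?f z) t) \<in> linear_maps K Z ?W"
    if "t \<in> carrier (tensor K X Y)" for t
    by (rule tensor_family_linear[where h = "\<lambda>z. tensor_lift K ?W (?f z)", OF assms m(6) ll p that])
  then have b: "(\<lambda>t z. tensor_lift K ?W (?f z) t) \<in> bilinear_maps K (tensor K X Y) Z ?W"
    unfolding bilinear_maps_def using ll by simp
  show "tensor_assoc K X Y Z \<in> linear_maps K (tensor K (tensor K X Y) Z) ?W"
    unfolding tensor_assoc_def by (rule tensor_lift_linear[OF m(4,3,6) b])
  show "tensor_assoc K X Y Z (pure_tensor K (tensor K X Y) Z (pure_tensor K X Y x y) z) =
      pure_tensor K X (tensor K Y Z) x (pure_tensor K Y Z y z)"
    if "x \<in> carrier X" "y \<in> carrier Y" "z \<in> carrier Z"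
    unfolding tensor_assoc_def
    using tensor_lift_pure[OF m(4,3,6) b] lp that pure_tensor_simps(1)[OF assms(1,2)] by simp
qed

lemma
  assumes "module K X" "module K Y" "module K Z"
  shows tensor_assoc_inv_linear: "tensor_assoc_inv K X Y Z \<in>
      linear_maps K (tensor K X (tensor K Y Z)) (tensor K (tensor K X Y) Z)"
    and tensor_assoc_inv_pure: "\<lbrakk>x \<in> carrier X; y \<in> carrier Y; z \<in> carrier Z\<rbrakk> \<Longrightarrow>
      tensor_assoc_inv K X Y Z (pure_tensor K X (tensor K Y Z) x (pure_tensor K Y Z y z)) =
      pure_tensor K (tensor K X Y) Z (pure_tensor K X Y x y) z"
proof -
  let ?W = "tensor K (tensor K X Y) Z"
  note m = assms module_tensor[OF assms(1,2)] module_tensor[OF assms(2,3)]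
    module_tensor[OF module_tensor[OF assms(1,2)] assms(3)]
  let ?f = "\<lambda>x y z. pure_tensor K (tensor K X Y) Z (pure_tensor K X Y x y) z"
  note s = pure_tensor_simps[OF m(4) assms(3)] pure_tensor_simps[OF assms(1,2)]
  have f: "?f x \<in> bilinear_maps K Y Z ?W" if "x \<in> carrier X" for x
    unfolding bilinear_maps_def by (use that in \<open>auto intro!: linear_mapsI simp: s\<close>)
  note ll = tensor_lift_linear[OF assms(2,3) m(6) f] and lp = tensor_lift_pure[OF assms(2,3) m(6) f]
  have p: "(\<lambda>x. tensor_lift K ?W (?f x) (pure_tensor K Y Z y z)) \<in> linear_maps K X ?W"
    if "y \<in> carrier Y" "z \<in> carrier Z" for y z
    by (rule linear_mapsI)
      (use that module.smult_closed[OF assms(1)] assms(1)[unfolded module_def]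
       in \<open>auto simp: lp s abelian_group.axioms abelian_monoid.a_closed\<close>)
  have "(\<lambda>x. tensor_lift K ?W (?f x) t) \<in> linear_maps K X ?W"
    if "t \<in> carrier (tensor K Y Z)" for t
    by (rule tensor_family_linear[where h = "\<lambda>x. tensor_lift K ?W (?f x)",
          OF assms(2,3,1) m(6) ll p that])
  then have b: "(\<lambda>x. tensor_lift K ?W (?f x)) \<in> bilinear_maps K X (tensor K Y Z) ?W"
    unfolding bilinear_maps_def using ll by simp
  show "tensor_assoc_inv K X Y Z \<in> linear_maps K (tensor K X (tensor K Y Z)) ?W"
    unfolding tensor_assoc_inv_def by (rule tensor_lift_linear[OF m(1,5,6) b])
  show "tensor_assoc_inv K X Y Z (pure_tensor K X (tensor K Y Z) x (pure_tensor K Y Z y z)) =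
      pure_tensor K (tensor K X Y) Z (pure_tensor K X Y x y) z"
    if "x \<in> carrier X" "y \<in> carrier Y" "z \<in> carrier Z"
    unfolding tensor_assoc_inv_def
    using tensor_lift_pure[OF m(1,5,6) b] lp that pure_tensor_simps(1)[OF assms(2,3)] by simp
qed

lemma
  assumes "module K X"
  shows left_unitor_linear: "left_unitor K X \<in> linear_maps K (tensor K (ground_module K) X) X"
    and left_unitor_pure: "\<lbrakk>c \<in> carrier K; x \<in> carrier X\<rbrakk> \<Longrightarrow>
      left_unitor K X (pure_tensor K (ground_module K) X c x) = c \<odot>\<^bsub>X\<^esub> x"
    and right_unitor_linear: "right_unitor K X \<in> linear_maps K (tensor K X (ground_module K)) X"
    and right_unitor_pure: "\<lbrakk>c \<in> carrier K; x \<in> carrier X\<rbrakk> \<Longrightarrow>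
      right_unitor K X (pure_tensor K X (ground_module K) x c) = c \<odot>\<^bsub>X\<^esub> x"
proof -
  interpret X: module K X by fact
  note G = module_ground[OF X.R.is_cring]
  note simps = ground_module_def X.smult_l_distr X.smult_r_distr X.smult_assoc1[symmetric] X.R.m_comm
  have l: "(\<lambda>c x. c \<odot>\<^bsub>X\<^esub> x) \<in> bilinear_maps K (ground_module K) X X"
    unfolding bilinear_maps_def by (auto intro!: linear_mapsI simp: simps)
  have r: "(\<lambda>x c. c \<odot>\<^bsub>X\<^esub> x) \<in> bilinear_maps K X (ground_module K) X"
    unfolding bilinear_maps_def by (auto intro!: linear_mapsI simp: simps)
  show "left_unitor K X \<in> linear_maps K (tensor K (ground_module K) X) X"
    and "right_unitor K X \<in> linear_maps K (tensor K X (ground_module K)) X"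
    unfolding left_unitor_def right_unitor_def
    by (intro tensor_lift_linear assms G l r)+
  show "left_unitor K X (pure_tensor K (ground_module K) X c x) = c \<odot>\<^bsub>X\<^esub> x"
    and "right_unitor K X (pure_tensor K X (ground_module K) x c) = c \<odot>\<^bsub>X\<^esub> x"
    if "c \<in> carrier K" "x \<in> carrier X"
    using tensor_lift_pure[OF G assms assms l] tensor_lift_pure[OF assms G assms r] that
    by (auto simp: left_unitor_def right_unitor_def ground_module_def)
qed

end

theory Submission
  imports Defs
begin

text \<open>
  Write \<open>\<sigma>\<close> for the inverse of \<open>\<tau>\<close>. The two counit axioms of \<open>A \<otimes>\<^sub>\<tau> B\<close> are equivalent to the two
  identities relating \<open>\<tau>\<close> and the counits. Given these, the third identity, read as
  \<open>(\<Delta>\<^sub>B \<otimes> \<Delta>\<^sub>A) \<sigma> = (1 \<otimes> \<sigma> \<otimes> 1) (\<sigma> \<otimes> \<sigma>) (1 \<otimes> \<sigma> \<otimes> 1) (\<Delta>\<^sub>A \<otimes> \<Delta>\<^sub>B)\<close>, splits into two pentagons, one for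
  \<open>\<Delta>\<^sub>B\<close> and one for \<open>\<Delta>\<^sub>A\<close>: each pentagon is the identity with a counit applied to one of the four
  factors, and conversely the identity follows by applying the first pentagon once and the second one
  twice. Coassociativity of \<open>A \<otimes>\<^sub>\<tau> B\<close> is equivalent to the same two pentagons: they follow from it by
  applying counits to three of the six factors, and conversely both sides of coassociativity are brought
  to a common form by one pentagon each and coassociativity of \<open>A\<close> and \<open>B\<close>.

  All of this is computed in Sweedler notation, by evaluating multilinear maps with values in an
  arbitrary module \<open>W\<close>, so that no associativity isomorphisms occur.
\<close>

section \<open>Sweedler notation\<close>

text \<open>The choice stays inside the free module even when \<open>t\<close> is not a tensor.
  Finite support and coefficients in \<open>K\<close> therefore hold for every \<open>t\<close>, and
  most rules for sums below carry no hypothesis on \<open>t\<close>.\<close>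

definition tensor_rep ::
    "('k, 'r) ring_scheme \<Rightarrow> ('k, 'a, 'm) module_scheme \<Rightarrow> ('k, 'b, 'n) module_scheme \<Rightarrow>
     ('a \<times> 'b \<Rightarrow> 'k) set \<Rightarrow> 'a \<times> 'b \<Rightarrow> 'k"
  where "tensor_rep K A B t =
    (SOME c. c \<in> carrier (free_module K (carrier A \<times> carrier B)) \<and> (t \<in> carrier (tensor K A B) \<longrightarrow> c \<in> t))"

text \<open>\<open>sweedler K A B W F t\<close> is \<open>\<Sum> F a b\<close> over a chosen representative \<open>\<Sum> a \<otimes> b\<close> of \<open>t\<close>. It agrees
  with \<open>tensor_lift\<close> for bilinear \<open>F\<close>, but since the representative is fixed and \<open>F\<close> is cut off outside
  the carriers, the congruence rule holds without side conditions, and interchange of sums and pushing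
  a linear map inside need no linearity of \<open>F\<close>.\<close>

definition sweedler ::
    "('k, 'r) ring_scheme \<Rightarrow> ('k, 'a, 'm) module_scheme \<Rightarrow> ('k, 'b, 'n) module_scheme \<Rightarrow>
     ('k, 'w, 'o) module_scheme \<Rightarrow> ('a \<Rightarrow> 'b \<Rightarrow> 'w) \<Rightarrow> ('a \<times> 'b \<Rightarrow> 'k) set \<Rightarrow> 'w"
  where "sweedler K A B W F t =
    free_eval K W (\<lambda>(a, b). if a \<in> carrier A \<and> b \<in> carrier B then F a b else \<zero>\<^bsub>W\<^esub>)
      (tensor_rep K A B t)"

section \<open>Chosen representatives of tensors\<close>

lemma tensor_coset:
  assumes "module K A" "module K B" "t \<in> carrier (tensor K A B)"
    and c: "c \<in> t"
  shows "c \<in> carrier (free_module K (carrier A \<times> carrier B)) \<and>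
    t = tensor_kernel K A B +>\<^bsub>free_module K (carrier A \<times> carrier B)\<^esub> c"
proof -
  interpret A: module K A by fact
  let ?F = "free_module K (carrier A \<times> carrier B)"
  let ?H = "tensor_kernel K A B"
  interpret F: module K ?F by (rule module_free) (rule A.R.is_cring)
  interpret H: submodule ?H K ?F by (rule submodule_tensor_kernel) fact+
  have sg: "additive_subgroup ?H ?F"
    using H.subgroup_axioms by (simp add: additive_subgroup_def)
  interpret H': abelian_subgroup ?H ?F
    by (rule abelian_subgroupI3[OF sg]) (rule F.M.abelian_group_axioms)
  obtain d where d: "d \<in> carrier ?F" "t = ?H +>\<^bsub>?F\<^esub> d"
    using assms(3) unfolding tensor_def by (rule quotient_carrierE)
  show ?thesis
    using H'.a_repr_independence'[of c d] H'.a_elemrcos_carrier[of d c] c d by auto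
qed

lemma tensor_rep:
  assumes "module K A" "module K B"
  shows "tensor_rep K A B t \<in> carrier (free_module K (carrier A \<times> carrier B))"
    and "t \<in> carrier (tensor K A B) \<Longrightarrow>
      tensor_kernel K A B +>\<^bsub>free_module K (carrier A \<times> carrier B)\<^esub> tensor_rep K A B t = t"
proof -
  interpret A: module K A by fact
  let ?F = "free_module K (carrier A \<times> carrier B)"
  let ?H = "tensor_kernel K A B"
  interpret F: module K ?F by (rule module_free) (rule A.R.is_cring)
  interpret H: submodule ?H K ?F by (rule submodule_tensor_kernel) fact+
  have "\<exists>c. c \<in> carrier ?F \<and> (t \<in> carrier (tensor K A B) \<longrightarrow> c \<in> t)"
  proof (cases "t \<in> carrier (tensor K A B)")
    case True
    obtain d where d: "d \<in> carrier ?F" "t = ?H +>\<^bsub>?F\<^esub> d"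
      using True unfolding tensor_def by (rule quotient_carrierE)
    then have "d \<in> t"
      using H.one_closed F.M.l_zero[OF d(1)] unfolding a_r_coset_def' by force
    with d show ?thesis by blast
  qed auto
  from someI_ex[OF this]
  have r: "tensor_rep K A B t \<in> carrier ?F" "t \<in> carrier (tensor K A B) \<Longrightarrow> tensor_rep K A B t \<in> t"
    unfolding tensor_rep_def by auto
  show "tensor_rep K A B t \<in> carrier ?F" by (rule r)
  show "?H +>\<^bsub>?F\<^esub> tensor_rep K A B t = t" if "t \<in> carrier (tensor K A B)"
    using tensor_coset[OF assms that r(2)[OF that]] by simp
qed

lemma tensor_rep_support:
  assumes "module K A" "module K B"
  shows "finite {p. tensor_rep K A B t p \<noteq> \<zero>\<^bsub>K\<^esub>}"
    and "tensor_rep K A B t p \<in> carrier K"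
    and "tensor_rep K A B t p \<noteq> \<zero>\<^bsub>K\<^esub> \<Longrightarrow> fst p \<in> carrier A \<and> snd p \<in> carrier B"
proof -
  have c: "tensor_rep K A B t \<in> carrier (free_module K (carrier A \<times> carrier B))"
    by (rule tensor_rep(1)) fact+
  then show "finite {p. tensor_rep K A B t p \<noteq> \<zero>\<^bsub>K\<^esub>}" "tensor_rep K A B t p \<in> carrier K"
    by (cases p; simp add: free_module_def)+
  have "\<forall>x. x \<notin> carrier A \<times> carrier B \<longrightarrow> tensor_rep K A B t x = \<zero>\<^bsub>K\<^esub>"
    using c by (simp add: free_module_def)
  then have "p \<in> carrier A \<times> carrier B" if "tensor_rep K A B t p \<noteq> \<zero>\<^bsub>K\<^esub>"
    using that by blast
  then show "tensor_rep K A B t p \<noteq> \<zero>\<^bsub>K\<^esub> \<Longrightarrow> fst p \<in> carrier A \<and> snd p \<in> carrier B"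
    by (simp add: mem_Times_iff)
qed

text \<open>As a congruence rule it lets the simplifier assume, below a sum, that the bound
  variables lie in the carriers. The closure and linearity conditions of later rules are discharged
  from these assumptions.\<close>

lemma sweedler_cong [cong]:
  assumes "K = K'" "A = A'" "B = B'" "W = W'" "t = t'"
    and "\<And>a b. \<lbrakk>a \<in> carrier A'; b \<in> carrier B'\<rbrakk> \<Longrightarrow> F a b = F' a b"
  shows "sweedler K A B W F t = sweedler K' A' B' W' F' t'"
proof -
  have "(\<lambda>(a, b). if a \<in> carrier A' \<and> b \<in> carrier B' then F a b else \<zero>\<^bsub>W'\<^esub>) =
      (\<lambda>(a, b). if a \<in> carrier A' \<and> b \<in> carrier B' then F' a b else \<zero>\<^bsub>W'\<^esub>)"
    using assms(6) by auto
  then show ?thesis unfolding sweedler_def assms(1-5) by simp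
qed

text \<open>The two sides may pick different representatives of the coset, and only
  \<open>sweedler\<close> cuts off. Bilinearity settles the first difference through
  \<open>tensor_lift_coset\<close>, and \<open>tensor_ext\<close> settles the second.\<close>

lemma sweedler_eq_tensor_lift:
  assumes "module K A" "module K B" "module K W" "F \<in> bilinear_maps K A B W"
    and t: "t \<in> carrier (tensor K A B)"
  shows "sweedler K A B W F t = tensor_lift K W F t"
proof -
  let ?G = "\<lambda>a b. if a \<in> carrier A \<and> b \<in> carrier B then F a b else \<zero>\<^bsub>W\<^esub>"
  interpret A: module K A by fact
  interpret B: module K B by fact
  interpret W: module K W by fact
  note f1 = linear_mapsD[OF bilinear_mapsD(1)[OF assms(4)]]
  note f2 = linear_mapsD[OF bilinear_mapsD(2)[OF assms(4)]]
  \<comment> \<open>Bilinearity is only tested on the carriers, where the cut-off function agrees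
    with \<open>F\<close>.\<close>
  have G: "?G \<in> bilinear_maps K A B W"
    unfolding bilinear_maps_def by (auto intro!: linear_mapsI simp: f1 f2)
  have "sweedler K A B W F t = tensor_lift K W ?G t"
    unfolding sweedler_def
    using tensor_lift_coset[OF assms(1-3) G tensor_rep(1)[OF assms(1,2)], of t]
      tensor_rep(2)[OF assms(1,2) t] by simp
  also have "\<dots> = tensor_lift K W F t"
    by (rule tensor_ext[OF assms(1-3) _ _ _ t])
      (simp_all add: tensor_lift_linear tensor_lift_pure assms(1-4) G)
  finally show ?thesis .
qed

section \<open>Evaluation and linearity of Sweedler sums\<close>

context
  fixes K :: "('k, 'r) ring_scheme" and A :: "('k, 'a, 'm) module_scheme"
    and B :: "('k, 'b, 'n) module_scheme" and W :: "('k, 'w, 'o) module_scheme"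
  assumes A: "module K A" and B: "module K B" and W: "module K W"
begin

interpretation A: module K A by (rule A)
interpretation B: module K B by (rule B)
interpretation W: module K W by (rule W)

lemma sweedler_finsum:
  assumes "\<And>a b. \<lbrakk>a \<in> carrier A; b \<in> carrier B\<rbrakk> \<Longrightarrow> F a b \<in> carrier W"
  shows "sweedler K A B W F t =
    (\<Oplus>\<^bsub>W\<^esub>p\<in>{p. tensor_rep K A B t p \<noteq> \<zero>\<^bsub>K\<^esub>}. tensor_rep K A B t p \<odot>\<^bsub>W\<^esub> F (fst p) (snd p))"
  unfolding sweedler_def free_eval_def
proof (rule W.M.finsum_cong')
  show "(\<lambda>p. tensor_rep K A B t p \<odot>\<^bsub>W\<^esub> F (fst p) (snd p)) \<in> {p. tensor_rep K A B t p \<noteq> \<zero>\<^bsub>K\<^esub>} \<rightarrow> carrier W"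
    using tensor_rep_support[OF A B] assms by auto
  fix p assume "p \<in> {p. tensor_rep K A B t p \<noteq> \<zero>\<^bsub>K\<^esub>}"
  then show "tensor_rep K A B t p \<odot>\<^bsub>W\<^esub>
      (case p of (a, b) \<Rightarrow> if a \<in> carrier A \<and> b \<in> carrier B then F a b else \<zero>\<^bsub>W\<^esub>) =
      tensor_rep K A B t p \<odot>\<^bsub>W\<^esub> F (fst p) (snd p)"
    using tensor_rep_support(3)[OF A B, of t p] by (simp add: case_prod_unfold)
qed simp

lemma sweedler_closed [simp]:
  assumes "\<And>a b. \<lbrakk>a \<in> carrier A; b \<in> carrier B\<rbrakk> \<Longrightarrow> F a b \<in> carrier W"
  shows "sweedler K A B W F t \<in> carrier W"
proof -
  have "sweedler K A B W F t = (\<Oplus>\<^bsub>W\<^esub>p\<in>{p. tensor_rep K A B t p \<noteq> \<zero>\<^bsub>K\<^esub>}.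
      tensor_rep K A B t p \<odot>\<^bsub>W\<^esub> F (fst p) (snd p))"
    by (rule sweedler_finsum) (rule assms)
  also have "\<dots> \<in> carrier W"
    by (rule W.M.finsum_closed) (use tensor_rep_support[OF A B] in \<open>auto intro!: assms\<close>)
  finally show ?thesis .
qed

text \<open>Linearity is required one variable at a time instead of through
  \<open>bilinear_maps\<close>, so that simplification can discharge it for the nested summands that
  occur later.\<close>

lemma sweedler_pure [simp]:
  assumes "a \<in> carrier A" "b \<in> carrier B"
    and "\<And>a. a \<in> carrier A \<Longrightarrow> (\<lambda>b. F a b) \<in> linear_maps K B W"
    and "\<And>b. b \<in> carrier B \<Longrightarrow> (\<lambda>a. F a b) \<in> linear_maps K A W"
  shows "sweedler K A B W F (pure_tensor K A B a b) = F a b"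
proof -
  have F: "F \<in> bilinear_maps K A B W" using assms(3,4) by (simp add: bilinear_maps_def)
  show ?thesis
    using sweedler_eq_tensor_lift[OF A B W F] tensor_lift_pure[OF A B W F] assms(1,2)
      pure_tensor_simps(1)[OF A B] by simp
qed

lemma sweedler_linear_arg [simp]:
  assumes "module K M" "f \<in> linear_maps K M (tensor K A B)"
    and "\<And>a. a \<in> carrier A \<Longrightarrow> (\<lambda>b. F a b) \<in> linear_maps K B W"
    and "\<And>b. b \<in> carrier B \<Longrightarrow> (\<lambda>a. F a b) \<in> linear_maps K A W"
  shows "(\<lambda>x. sweedler K A B W F (f x)) \<in> linear_maps K M W"
proof -
  have F: "F \<in> bilinear_maps K A B W" using assms(3,4) by (simp add: bilinear_maps_def)
  interpret M: module K M by fact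
  note l = linear_mapsD[OF tensor_lift_linear[OF A B W F]] and f = linear_mapsD[OF assms(2)]
  have e: "sweedler K A B W F (f x) = tensor_lift K W F (f x)" if "x \<in> carrier M" for x
    using sweedler_eq_tensor_lift[OF A B W F] f(1) that by simp
  show ?thesis
  proof (rule linear_mapsI)
    fix x y assume "x \<in> carrier M" "y \<in> carrier M"
    then show "sweedler K A B W F (f (x \<oplus>\<^bsub>M\<^esub> y)) = sweedler K A B W F (f x) \<oplus>\<^bsub>W\<^esub> sweedler K A B W F (f y)"
      using e[of "x \<oplus>\<^bsub>M\<^esub> y"] by (simp add: e l f del: sweedler_closed)
  next
    fix k x assume "k \<in> carrier K" "x \<in> carrier M"
    then show "sweedler K A B W F (f (k \<odot>\<^bsub>M\<^esub> x)) = k \<odot>\<^bsub>W\<^esub> sweedler K A B W F (f x)"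
      using e[of "k \<odot>\<^bsub>M\<^esub> x"] by (simp add: e l f del: sweedler_closed)
  qed (simp add: e l f del: sweedler_closed)
qed

text \<open>This is the tool by which unitors, associators, middle maps and evaluation maps are
  pushed through a sum.\<close>

lemma sweedler_hom:
  assumes "module K W'" "g \<in> linear_maps K W W'"
    and F: "\<And>a b. \<lbrakk>a \<in> carrier A; b \<in> carrier B\<rbrakk> \<Longrightarrow> F a b \<in> carrier W"
  shows "g (sweedler K A B W F t) = sweedler K A B W' (\<lambda>a b. g (F a b)) t"
proof -
  interpret W': module K W' by fact
  note g = linear_mapsD[OF assms(2)]
  have sum: "g (\<Oplus>\<^bsub>W\<^esub>p\<in>S. h p) = (\<Oplus>\<^bsub>W'\<^esub>p\<in>S. g (h p))"
    if "finite S" "h \<in> S \<rightarrow> carrier W" for S and h :: "'a \<times> 'b \<Rightarrow> 'w"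
    using that
  proof (induction S rule: finite_induct)
    case empty
    then show ?case using linear_maps_minus(2)[OF W assms(1,2) W.M.zero_closed W.M.zero_closed] by simp
  next
    case (insert x S)
    then have "h x \<in> carrier W" "h \<in> S \<rightarrow> carrier W" by auto
    moreover from this have "(\<lambda>p. g (h p)) \<in> S \<rightarrow> carrier W'" using g(1) by auto
    ultimately show ?case using insert by (simp add: g)
  qed
  let ?c = "tensor_rep K A B t" and ?S = "{p. tensor_rep K A B t p \<noteq> \<zero>\<^bsub>K\<^esub>}"
  have "g (sweedler K A B W F t) = (\<Oplus>\<^bsub>W'\<^esub>p\<in>?S. g (?c p \<odot>\<^bsub>W\<^esub> F (fst p) (snd p)))"
    by (subst sweedler_finsum) (use tensor_rep_support[OF A B] in \<open>auto simp: F intro!: sum\<close>)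
  also have "\<dots> = (\<Oplus>\<^bsub>W'\<^esub>p\<in>?S. ?c p \<odot>\<^bsub>W'\<^esub> g (F (fst p) (snd p)))"
    by (rule W'.M.finsum_cong') (use tensor_rep_support[OF A B] in \<open>auto simp: F g\<close>)
  also have "\<dots> = sweedler K A B W' (\<lambda>a b. g (F a b)) t"
    unfolding sweedler_def free_eval_def
    by (rule W'.M.finsum_cong')
      (use tensor_rep_support[OF A B] in \<open>fastforce simp: F g intro!: W'.smult_closed\<close>)+
  finally show ?thesis .
qed

lemma sweedler_add:
  assumes F: "\<And>a b. \<lbrakk>a \<in> carrier A; b \<in> carrier B\<rbrakk> \<Longrightarrow> F a b \<in> carrier W"
    and G: "\<And>a b. \<lbrakk>a \<in> carrier A; b \<in> carrier B\<rbrakk> \<Longrightarrow> G a b \<in> carrier W"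
  shows "sweedler K A B W (\<lambda>a b. F a b \<oplus>\<^bsub>W\<^esub> G a b) t =
    sweedler K A B W F t \<oplus>\<^bsub>W\<^esub> sweedler K A B W G t"
proof -
  let ?c = "tensor_rep K A B t" and ?S = "{p. tensor_rep K A B t p \<noteq> \<zero>\<^bsub>K\<^esub>}"
  have "sweedler K A B W (\<lambda>a b. F a b \<oplus>\<^bsub>W\<^esub> G a b) t =
      (\<Oplus>\<^bsub>W\<^esub>p\<in>?S. ?c p \<odot>\<^bsub>W\<^esub> (F (fst p) (snd p) \<oplus>\<^bsub>W\<^esub> G (fst p) (snd p)))"
    by (rule sweedler_finsum) (simp add: F G)
  also have "\<dots> = (\<Oplus>\<^bsub>W\<^esub>p\<in>?S. ?c p \<odot>\<^bsub>W\<^esub> F (fst p) (snd p) \<oplus>\<^bsub>W\<^esub> ?c p \<odot>\<^bsub>W\<^esub> G (fst p) (snd p))"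
    by (rule W.M.finsum_cong') (use tensor_rep_support[OF A B] in \<open>auto simp: F G W.smult_r_distr\<close>)
  also have "\<dots> = sweedler K A B W F t \<oplus>\<^bsub>W\<^esub> sweedler K A B W G t"
    by (simp add: sweedler_finsum F G, rule W.M.finsum_addf)
      (use tensor_rep_support[OF A B] in \<open>auto simp: F G\<close>)
  finally show ?thesis .
qed

lemma smult_linear: "k \<in> carrier K \<Longrightarrow> (\<lambda>w. k \<odot>\<^bsub>W\<^esub> w) \<in> linear_maps K W W"
  by (rule linear_mapsI) (auto simp: W.smult_r_distr W.smult_assoc1[symmetric] A.R.m_comm)

lemma sweedler_linear_param [simp]:
  assumes "module K M"
    and "\<And>a b. \<lbrakk>a \<in> carrier A; b \<in> carrier B\<rbrakk> \<Longrightarrow> (\<lambda>x. F a b x) \<in> linear_maps K M W"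
  shows "(\<lambda>x. sweedler K A B W (\<lambda>a b. F a b x) t) \<in> linear_maps K M W"
proof -
  interpret M: module K M by fact
  note F = linear_mapsD[OF assms(2)]
  show ?thesis
  proof (rule linear_mapsI)
    fix k x assume "k \<in> carrier K" "x \<in> carrier M"
    then show "sweedler K A B W (\<lambda>a b. F a b (k \<odot>\<^bsub>M\<^esub> x)) t =
        k \<odot>\<^bsub>W\<^esub> sweedler K A B W (\<lambda>a b. F a b x) t"
      using sweedler_hom[OF W smult_linear, of k "\<lambda>a b. F a b x"] by (simp add: F)
  qed (simp_all add: F sweedler_add)
qed

end

text \<open>With both representatives fixed this is the interchange of two finite sums. The support
  of the representative of \<open>t\<close> is built up point by point, and each new term is split
  off from the sum over \<open>s\<close>.\<close>

lemma sweedler_swap: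
  assumes "module K A" "module K B" "module K C" "module K D" "module K W"
    and F: "\<And>a b c d. \<lbrakk>a \<in> carrier A; b \<in> carrier B; c \<in> carrier C; d \<in> carrier D\<rbrakk> \<Longrightarrow>
      F a b c d \<in> carrier W"
  shows "sweedler K A B W (\<lambda>a b. sweedler K C D W (\<lambda>c d. F a b c d) s) t =
    sweedler K C D W (\<lambda>c d. sweedler K A B W (\<lambda>a b. F a b c d) t) s"
proof -
  interpret W: module K W by fact
  let ?c = "tensor_rep K A B t" and ?S = "{p. tensor_rep K A B t p \<noteq> \<zero>\<^bsub>K\<^esub>}"
  have "sweedler K C D W (\<lambda>c d. \<Oplus>\<^bsub>W\<^esub>p\<in>T. ?c p \<odot>\<^bsub>W\<^esub> F (fst p) (snd p) c d) s =
      (\<Oplus>\<^bsub>W\<^esub>p\<in>T. ?c p \<odot>\<^bsub>W\<^esub> sweedler K C D W (\<lambda>c d. F (fst p) (snd p) c d) s)"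
    if "finite T" "T \<subseteq> ?S" for T
    using that
  proof (induction T rule: finite_induct)
    case empty
    show ?case
      using sweedler_finsum[OF assms(3-5), of "\<lambda>_ _. \<zero>\<^bsub>W\<^esub>" s]
      W.M.add.finprod_one_eqI[of "{p. tensor_rep K C D s p \<noteq> \<zero>\<^bsub>K\<^esub>}"
          "\<lambda>p. tensor_rep K C D s p \<odot>\<^bsub>W\<^esub> \<zero>\<^bsub>W\<^esub>"]
      by (simp add: tensor_rep_support[OF assms(3,4)])
  next
    case (insert p T)
    have p: "?c p \<in> carrier K" "fst p \<in> carrier A" "snd p \<in> carrier B"
      using insert.prems tensor_rep_support(2,3)[OF assms(1,2), of t p] by auto
    have q: "?c q \<in> carrier K" "fst q \<in> carrier A" "snd q \<in> carrier B" if "q \<in> T" for q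
      using that insert.prems tensor_rep_support(2,3)[OF assms(1,2), of t q] by auto
    have "sweedler K C D W (\<lambda>c d. \<Oplus>\<^bsub>W\<^esub>p\<in>insert p T. ?c p \<odot>\<^bsub>W\<^esub> F (fst p) (snd p) c d) s =
        sweedler K C D W (\<lambda>c d. ?c p \<odot>\<^bsub>W\<^esub> F (fst p) (snd p) c d \<oplus>\<^bsub>W\<^esub>
          (\<Oplus>\<^bsub>W\<^esub>p\<in>T. ?c p \<odot>\<^bsub>W\<^esub> F (fst p) (snd p) c d)) s"
      by (intro sweedler_cong refl W.M.finsum_insert) (use insert.hyps p q F in auto)
    also have "\<dots> = sweedler K C D W (\<lambda>c d. ?c p \<odot>\<^bsub>W\<^esub> F (fst p) (snd p) c d) s \<oplus>\<^bsub>W\<^esub>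
        sweedler K C D W (\<lambda>c d. \<Oplus>\<^bsub>W\<^esub>p\<in>T. ?c p \<odot>\<^bsub>W\<^esub> F (fst p) (snd p) c d) s"
      by (rule sweedler_add[OF assms(3-5)]) (use p q F in \<open>auto intro!: W.M.finsum_closed\<close>)
    also have "sweedler K C D W (\<lambda>c d. ?c p \<odot>\<^bsub>W\<^esub> F (fst p) (snd p) c d) s =
        ?c p \<odot>\<^bsub>W\<^esub> sweedler K C D W (F (fst p) (snd p)) s"
      by (rule sweedler_hom[OF assms(3-5) assms(5) smult_linear[OF assms(3-5) p(1)], symmetric])
        (use p F in auto)
    also have "sweedler K C D W (\<lambda>c d. \<Oplus>\<^bsub>W\<^esub>p\<in>T. ?c p \<odot>\<^bsub>W\<^esub> F (fst p) (snd p) c d) s =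
        (\<Oplus>\<^bsub>W\<^esub>p\<in>T. ?c p \<odot>\<^bsub>W\<^esub> sweedler K C D W (F (fst p) (snd p)) s)"
      using insert by simp
    also have "?c p \<odot>\<^bsub>W\<^esub> sweedler K C D W (F (fst p) (snd p)) s \<oplus>\<^bsub>W\<^esub> \<dots> =
        (\<Oplus>\<^bsub>W\<^esub>p\<in>insert p T. ?c p \<odot>\<^bsub>W\<^esub> sweedler K C D W (F (fst p) (snd p)) s)"
      by (rule W.M.finsum_insert[symmetric])
        (use insert.hyps p q F in \<open>auto intro!: W.smult_closed sweedler_closed assms(3-5)\<close>)
    finally show ?case .
  qed
  note sum = this[OF tensor_rep_support(1)[OF assms(1,2)] order_refl]
  have "sweedler K A B W (\<lambda>a b. sweedler K C D W (\<lambda>c d. F a b c d) s) t =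
      (\<Oplus>\<^bsub>W\<^esub>p\<in>?S. ?c p \<odot>\<^bsub>W\<^esub> sweedler K C D W (\<lambda>c d. F (fst p) (snd p) c d) s)"
    by (rule sweedler_finsum[OF assms(1,2,5)]) (simp add: F assms(3-5))
  also have "\<dots> = sweedler K C D W (\<lambda>c d. sweedler K A B W (\<lambda>a b. F a b c d) t) s"
    unfolding sum[symmetric]
    by (intro sweedler_cong refl sweedler_finsum[OF assms(1,2,5), symmetric] F)
  finally show ?thesis .
qed

section \<open>Simplification rules for nested sums\<close>

declare module_tensor [simp] pure_tensor_simps(1) [simp]

lemma linear_id [simp]: "(\<lambda>x. x) \<in> linear_maps K M M"
  by (rule linear_mapsI) auto

lemma id_linear: "id \<in> linear_maps K M M"
  by (simp add: id_def)

lemma linear_comp: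
  assumes "g \<in> linear_maps K N P" "f \<in> linear_maps K M N"
  shows "(\<lambda>x. g (f x)) \<in> linear_maps K M P"
  by (rule linear_mapsI) (simp_all add: linear_mapsD[OF assms(1)] linear_mapsD[OF assms(2)])

text \<open>The inner maps \<open>f\<close> and \<open>g\<close> are arbitrary, so that such rules
  chain: a nested term is shown to be linear in a variable by following that variable
  inward.\<close>

lemma pure_tensor_linear [simp]:
  assumes "module K A" "module K B"
  shows "\<lbrakk>f \<in> linear_maps K M A; b \<in> carrier B\<rbrakk> \<Longrightarrow>
      (\<lambda>x. pure_tensor K A B (f x) b) \<in> linear_maps K M (tensor K A B)"
    and "\<lbrakk>g \<in> linear_maps K N B; a \<in> carrier A\<rbrakk> \<Longrightarrow>
      (\<lambda>x. pure_tensor K A B a (g x)) \<in> linear_maps K N (tensor K A B)"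
  using linear_comp[OF bilinear_mapsD(1)[OF pure_tensor_bilinear[OF assms]]]
    linear_comp[OF bilinear_mapsD(2)[OF pure_tensor_bilinear[OF assms]]]
  by auto

lemma smult_linear_arg [simp]:
  assumes "module K W"
  shows "\<lbrakk>f \<in> linear_maps K M W; k \<in> carrier K\<rbrakk> \<Longrightarrow> (\<lambda>x. k \<odot>\<^bsub>W\<^esub> f x) \<in> linear_maps K M W"
    and "\<lbrakk>e \<in> linear_maps K N (ground_module K); w \<in> carrier W\<rbrakk> \<Longrightarrow>
      (\<lambda>x. e x \<odot>\<^bsub>W\<^esub> w) \<in> linear_maps K N W"
proof -
  interpret W: module K W by fact
  assume "f \<in> linear_maps K M W" "k \<in> carrier K"
  then show "(\<lambda>x. k \<odot>\<^bsub>W\<^esub> f x) \<in> linear_maps K M W"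
    using linear_comp[OF smult_linear[OF assms assms assms]] by blast
next
  interpret W: module K W by fact
  assume e: "e \<in> linear_maps K N (ground_module K)" and w: "w \<in> carrier W"
  show "(\<lambda>x. e x \<odot>\<^bsub>W\<^esub> w) \<in> linear_maps K N W"
    using linear_mapsD[OF e] w
    by (intro linear_mapsI) (auto simp: ground_module_def W.smult_l_distr W.smult_assoc1)
qed

text \<open>The outer sum is linear in its tensor, hence passes through the inner one. Iterated
  comultiplications become nested sums in this way.\<close>

lemma sweedler_sweedler [simp]:
  assumes "module K A" "module K B" "module K A'" "module K B'" "module K W"
    and "\<And>a b. \<lbrakk>a \<in> carrier A; b \<in> carrier B\<rbrakk> \<Longrightarrow> G a b \<in> carrier (tensor K A' B')"
    and "\<And>a. a \<in> carrier A' \<Longrightarrow> (\<lambda>b. F a b) \<in> linear_maps K B' W"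
    and "\<And>b. b \<in> carrier B' \<Longrightarrow> (\<lambda>a. F a b) \<in> linear_maps K A' W"
  shows "sweedler K A' B' W F (sweedler K A B (tensor K A' B') G t) =
    sweedler K A B W (\<lambda>a b. sweedler K A' B' W F (G a b)) t"
  by (rule sweedler_hom[where g = "\<lambda>t. sweedler K A' B' W F t"]) (use assms in simp_all)

lemma pure_tensor_sweedler [simp]:
  assumes "module K A" "module K B" "module K X" "module K Y"
  shows "\<lbrakk>y \<in> carrier Y; \<And>a b. \<lbrakk>a \<in> carrier A; b \<in> carrier B\<rbrakk> \<Longrightarrow> G a b \<in> carrier X\<rbrakk> \<Longrightarrow>
      pure_tensor K X Y (sweedler K A B X G t) y =
      sweedler K A B (tensor K X Y) (\<lambda>a b. pure_tensor K X Y (G a b) y) t"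
    and "\<lbrakk>x \<in> carrier X; \<And>a b. \<lbrakk>a \<in> carrier A; b \<in> carrier B\<rbrakk> \<Longrightarrow> H a b \<in> carrier Y\<rbrakk> \<Longrightarrow>
      pure_tensor K X Y x (sweedler K A B Y H t) =
      sweedler K A B (tensor K X Y) (\<lambda>a b. pure_tensor K X Y x (H a b)) t"
  subgoal by (rule sweedler_hom[where g = "\<lambda>t. pure_tensor K X Y t y"]) (use assms in simp_all)
  subgoal by (rule sweedler_hom[where g = "\<lambda>t. pure_tensor K X Y x t"]) (use assms in simp_all)
  done

lemma sweedler_smult:
  assumes "module K A" "module K B" "module K W" "k \<in> carrier K"
    and "\<And>a b. \<lbrakk>a \<in> carrier A; b \<in> carrier B\<rbrakk> \<Longrightarrow> G a b \<in> carrier W"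
  shows "sweedler K A B W (\<lambda>a b. k \<odot>\<^bsub>W\<^esub> G a b) t = k \<odot>\<^bsub>W\<^esub> sweedler K A B W G t"
  by (rule sweedler_hom[where g = "\<lambda>t. k \<odot>\<^bsub>W\<^esub> t", symmetric]) (use assms in simp_all)

lemma sweedler_pure_id:
  assumes "module K A" "module K B" "t \<in> carrier (tensor K A B)"
  shows "sweedler K A B (tensor K A B) (\<lambda>a b. pure_tensor K A B a b) t = t"
  using tensor_ext[of K A B "tensor K A B"
      "\<lambda>t. sweedler K A B (tensor K A B) (\<lambda>a b. pure_tensor K A B a b) t" "\<lambda>t. t"] assms
  by simp

text \<open>The reason is \<open>sweedler_pure_id\<close> under the linear map \<open>g\<close>. It
  serves to collapse a sum again, in \<open>middle_map_inverse\<close>.\<close>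

lemma sweedler_apply_pure:
  assumes "module K A" "module K B"
    and "g \<in> linear_maps K (tensor K A B) W" "module K W" "t \<in> carrier (tensor K A B)"
  shows "sweedler K A B W (\<lambda>a b. g (pure_tensor K A B a b)) t = g t"
  using sweedler_hom[of K A B "tensor K A B" W g "\<lambda>a b. pure_tensor K A B a b" t]
  by (simp add: assms sweedler_pure_id)

section \<open>Canonical maps on sums\<close>

lemma tensor_map_sweedler:
  assumes "module K A" "module K B" "module K A'" "module K B'"
    and "f \<in> linear_maps K A A'" "g \<in> linear_maps K B B'" "t \<in> carrier (tensor K A B)"
  shows "tensor_map K A' B' f g t = sweedler K A B (tensor K A' B') (\<lambda>a b. pure_tensor K A' B' (f a) (g b)) t"
  unfolding tensor_map_def
  by (rule sweedler_eq_tensor_lift[symmetric]) (use assms in \<open>simp_all add: tensor_map_bilinear\<close>)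

text \<open>The left factor need not be pure: in the uses below it is a value of a comultiplication
  or of the map in the middle of \<open>middle_map\<close>.\<close>

lemma tensor_assoc_pure_left:
  assumes "module K X" "module K Y" "module K Z" "s \<in> carrier (tensor K X Y)" "z \<in> carrier Z"
  shows "tensor_assoc K X Y Z (pure_tensor K (tensor K X Y) Z s z) =
    sweedler K X Y (tensor K X (tensor K Y Z))
      (\<lambda>x y. pure_tensor K X (tensor K Y Z) x (pure_tensor K Y Z y z)) s"
  by (rule tensor_ext[of K X Y "tensor K X (tensor K Y Z)"
        "\<lambda>s. tensor_assoc K X Y Z (pure_tensor K (tensor K X Y) Z s z)"])
    (use assms in \<open>simp_all add: linear_comp[OF tensor_assoc_linear] tensor_assoc_pure\<close>)

lemma tensor_assoc_sweedler:
  assumes "module K A" "module K B" "module K X" "module K Y" "module K Z"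
    and "\<And>a b. \<lbrakk>a \<in> carrier A; b \<in> carrier B\<rbrakk> \<Longrightarrow> G a b \<in> carrier (tensor K (tensor K X Y) Z)"
  shows "tensor_assoc K X Y Z (sweedler K A B (tensor K (tensor K X Y) Z) G t) =
    sweedler K A B (tensor K X (tensor K Y Z)) (\<lambda>a b. tensor_assoc K X Y Z (G a b)) t"
  by (rule sweedler_hom) (use assms in \<open>simp_all add: tensor_assoc_linear\<close>)

lemma left_unitor_sweedler:
  assumes "module K A" "module K B" "module K X"
    and "\<And>a b. \<lbrakk>a \<in> carrier A; b \<in> carrier B\<rbrakk> \<Longrightarrow> e a b \<in> carrier K"
    and "\<And>a b. \<lbrakk>a \<in> carrier A; b \<in> carrier B\<rbrakk> \<Longrightarrow> f a b \<in> carrier X"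
  shows "left_unitor K X (sweedler K A B (tensor K (ground_module K) X)
      (\<lambda>a b. pure_tensor K (ground_module K) X (e a b) (f a b)) t) =
    sweedler K A B X (\<lambda>a b. e a b \<odot>\<^bsub>X\<^esub> f a b) t"
proof -
  interpret X: module K X by fact
  have G: "module K (ground_module K)" by (rule module_ground) (rule X.R.is_cring)
  have c: "carrier (ground_module K) = carrier K" by (simp add: ground_module_def)
  show ?thesis
    by (subst sweedler_hom[where g = "left_unitor K X"])
      (use assms in \<open>simp_all add: G c left_unitor_linear left_unitor_pure\<close>)
qed

lemma right_unitor_sweedler:
  assumes "module K A" "module K B" "module K X"
    and "\<And>a b. \<lbrakk>a \<in> carrier A; b \<in> carrier B\<rbrakk> \<Longrightarrow> e a b \<in> carrier K"
    and "\<And>a b. \<lbrakk>a \<in> carrier A; b \<in> carrier B\<rbrakk> \<Longrightarrow> f a b \<in> carrier X"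
  shows "right_unitor K X (sweedler K A B (tensor K X (ground_module K))
      (\<lambda>a b. pure_tensor K X (ground_module K) (f a b) (e a b)) t) =
    sweedler K A B X (\<lambda>a b. e a b \<odot>\<^bsub>X\<^esub> f a b) t"
proof -
  interpret X: module K X by fact
  have G: "module K (ground_module K)" by (rule module_ground) (rule X.R.is_cring)
  have c: "carrier (ground_module K) = carrier K" by (simp add: ground_module_def)
  show ?thesis
    by (subst sweedler_hom[where g = "right_unitor K X"])
      (use assms in \<open>simp_all add: G c right_unitor_linear right_unitor_pure\<close>)
qed

lemma
  assumes "module K X" "module K Y" "module K Z" "module K W" "module K Y'" "module K Z'"
    and f: "f \<in> linear_maps K (tensor K Y Z) (tensor K Y' Z')"
  shows middle_map_linear: "middle_map K X Y Z W Y' Z' f \<in>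
      linear_maps K (tensor K (tensor K X Y) (tensor K Z W)) (tensor K (tensor K X Y') (tensor K Z' W))"
    and middle_map_pure: "\<lbrakk>x \<in> carrier X; y \<in> carrier Y; z \<in> carrier Z; w \<in> carrier W\<rbrakk> \<Longrightarrow>
      middle_map K X Y Z W Y' Z' f (pure_tensor K (tensor K X Y) (tensor K Z W)
        (pure_tensor K X Y x y) (pure_tensor K Z W z w)) =
      sweedler K Y' Z' (tensor K (tensor K X Y') (tensor K Z' W))
       (\<lambda>u v. pure_tensor K (tensor K X Y') (tensor K Z' W) (pure_tensor K X Y' x u)
         (pure_tensor K Z' W v w)) (f (pure_tensor K Y Z y z))"
proof -
  show "middle_map K X Y Z W Y' Z' f \<in>
      linear_maps K (tensor K (tensor K X Y) (tensor K Z W)) (tensor K (tensor K X Y') (tensor K Z' W))"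
    unfolding middle_map_def comp_def
    by (rule linear_comp[OF tensor_assoc_inv_linear] linear_comp[OF tensor_map_linear]
        tensor_assoc_linear tensor_map_linear tensor_assoc_inv_linear module_tensor assms
        id_linear)+
  assume xw: "x \<in> carrier X" "y \<in> carrier Y" "z \<in> carrier Z" "w \<in> carrier W"
  note fc = linear_mapsD(1)[OF f]
  \<comment> \<open>The other maps of the composite act on pure tensors. The value of
    \<open>f\<close> is not pure, so the second associator and the last map have to wait until it is
    expanded.\<close>
  have "middle_map K X Y Z W Y' Z' f (pure_tensor K (tensor K X Y) (tensor K Z W)
        (pure_tensor K X Y x y) (pure_tensor K Z W z w)) =
    tensor_assoc_inv K X Y' (tensor K Z' W)
     (pure_tensor K X (tensor K Y' (tensor K Z' W)) x
       (tensor_assoc K Y' Z' W (pure_tensor K (tensor K Y' Z') W (f (pure_tensor K Y Z y z)) w)))"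
    unfolding middle_map_def comp_def
    using xw assms fc
    by (simp add: tensor_assoc_pure tensor_assoc_inv_pure
        tensor_map_pure[where A = X] tensor_map_pure[where A = "tensor K Y Z"] id_linear
       tensor_map_linear tensor_assoc_linear tensor_assoc_inv_linear)
  also have "\<dots> = sweedler K Y' Z' (tensor K (tensor K X Y') (tensor K Z' W))
       (\<lambda>u v. pure_tensor K (tensor K X Y') (tensor K Z' W) (pure_tensor K X Y' x u)
         (pure_tensor K Z' W v w)) (f (pure_tensor K Y Z y z))"
    using xw assms fc
    by (simp add: tensor_assoc_pure_left, subst sweedler_hom[where g = "tensor_assoc_inv K X Y' (tensor K Z' W)"])
      (simp_all add: tensor_assoc_inv_linear tensor_assoc_inv_pure)
  finally show "middle_map K X Y Z W Y' Z' f (pure_tensor K (tensor K X Y) (tensor K Z W)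
        (pure_tensor K X Y x y) (pure_tensor K Z W z w)) =
      sweedler K Y' Z' (tensor K (tensor K X Y') (tensor K Z' W))
       (\<lambda>u v. pure_tensor K (tensor K X Y') (tensor K Z' W) (pure_tensor K X Y' x u)
         (pure_tensor K Z' W v w)) (f (pure_tensor K Y Z y z))" .
qed

section \<open>The coalgebra axioms in Sweedler notation\<close>

lemma (in coalgebra) sweedler_coassoc:
  assumes W: "module K W" and a: "a \<in> carrier C"
    and F: "\<And>y z. \<lbrakk>y \<in> carrier C; z \<in> carrier C\<rbrakk> \<Longrightarrow> (\<lambda>x. F x y z) \<in> linear_maps K C W"
      "\<And>x z. \<lbrakk>x \<in> carrier C; z \<in> carrier C\<rbrakk> \<Longrightarrow> (\<lambda>y. F x y z) \<in> linear_maps K C W"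
      "\<And>x y. \<lbrakk>x \<in> carrier C; y \<in> carrier C\<rbrakk> \<Longrightarrow> (\<lambda>z. F x y z) \<in> linear_maps K C W"
  shows "sweedler K C C W (\<lambda>x z. sweedler K C C W (\<lambda>u v. F u v z) (\<Delta> x)) (\<Delta> a) =
    sweedler K C C W (\<lambda>x y. sweedler K C C W (\<lambda>u v. F x u v) (\<Delta> y)) (\<Delta> a)"
proof -
  \<comment> \<open>\<open>?L\<close> is the linear map on
    \<open>C \<otimes> (C \<otimes> C)\<close> induced by the trilinear \<open>F\<close>. Applied to
    both sides of coassociativity it absorbs the associator.\<close>
  let ?L = "\<lambda>t. sweedler K C (tensor K C C) W (\<lambda>x s. sweedler K C C W (\<lambda>y z. F x y z) s) t"
  have C: "module K C" by (rule module_axioms)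
  note D = comult_linear linear_mapsD(1)[OF comult_linear]
  have "?L (tensor_assoc K C C C (tensor_map K (tensor K C C) C \<Delta> id (\<Delta> a))) =
     sweedler K C C W (\<lambda>x z. sweedler K C C W (\<lambda>u v. F u v z) (\<Delta> x)) (\<Delta> a)"
    using a by (simp add: C W F D tensor_map_sweedler[where A=C and B=C] id_linear tensor_assoc_sweedler
       tensor_assoc_pure_left)
  moreover have "?L (tensor_map K C (tensor K C C) id \<Delta> (\<Delta> a)) =
     sweedler K C C W (\<lambda>x y. sweedler K C C W (\<lambda>u v. F x u v) (\<Delta> y)) (\<Delta> a)"
    using a by (simp add: C W F D tensor_map_sweedler[where A=C and B=C] id_linear)
  ultimately show ?thesis using coassoc[OF a] by simp
qed

text \<open>Apply the linear \<open>g\<close> to the counit axiom. The general target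
  \<open>W\<close> makes the rule usable inside nested sums, where \<open>g\<close> is whatever
  remains of the summand.\<close>

lemma (in coalgebra) sweedler_left_counit:
  assumes W: "module K W" and a: "a \<in> carrier C" and g: "(\<lambda>x. g x) \<in> linear_maps K C W"
  shows "sweedler K C C W (\<lambda>x y. \<epsilon> x \<odot>\<^bsub>W\<^esub> g y) (\<Delta> a) = g a"
proof -
  have C: "module K C" by (rule module_axioms)
  have G: "module K (ground_module K)" by (rule module_ground) (rule R.is_cring)
  note D = comult_linear linear_mapsD(1)[OF comult_linear] counit_linear
  have e: "\<epsilon> x \<in> carrier K" if "x \<in> carrier C" for x
    using linear_mapsD(1)[OF counit_linear that] by (simp add: ground_module_def)
  have "g (left_unitor K C (tensor_map K (ground_module K) C \<epsilon> id (\<Delta> a))) =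
      g (sweedler K C C C (\<lambda>x y. \<epsilon> x \<odot>\<^bsub>C\<^esub> y) (\<Delta> a))"
    using a by (simp add: C G D e tensor_map_sweedler[where A=C and B=C] id_linear
        left_unitor_sweedler)
  also have "\<dots> = sweedler K C C W (\<lambda>x y. \<epsilon> x \<odot>\<^bsub>W\<^esub> g y) (\<Delta> a)"
    by (subst sweedler_hom[OF C C C W g]) (simp_all add: C e linear_mapsD[OF g])
  finally show ?thesis using left_counit[OF a] by simp
qed

lemma (in coalgebra) sweedler_right_counit:
  assumes W: "module K W" and a: "a \<in> carrier C" and g: "(\<lambda>x. g x) \<in> linear_maps K C W"
  shows "sweedler K C C W (\<lambda>x y. \<epsilon> y \<odot>\<^bsub>W\<^esub> g x) (\<Delta> a) = g a"
proof -
  have C: "module K C" by (rule module_axioms)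
  have G: "module K (ground_module K)" by (rule module_ground) (rule R.is_cring)
  note D = comult_linear linear_mapsD(1)[OF comult_linear] counit_linear
  have e: "\<epsilon> x \<in> carrier K" if "x \<in> carrier C" for x
    using linear_mapsD(1)[OF counit_linear that] by (simp add: ground_module_def)
  have "g (right_unitor K C (tensor_map K C (ground_module K) id \<epsilon> (\<Delta> a))) =
      g (sweedler K C C C (\<lambda>x y. \<epsilon> y \<odot>\<^bsub>C\<^esub> x) (\<Delta> a))"
    using a by (simp add: C G D e tensor_map_sweedler[where A=C and B=C] id_linear
        right_unitor_sweedler)
  also have "\<dots> = sweedler K C C W (\<lambda>x y. \<epsilon> y \<odot>\<^bsub>W\<^esub> g x) (\<Delta> a)"
    by (subst sweedler_hom[OF C C C W g]) (simp_all add: C e linear_mapsD[OF g])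
  finally show ?thesis using right_counit[OF a] by simp
qed

section \<open>Multilinear maps, used as test functions\<close>

definition trilinear_maps where
  "trilinear_maps K X Y Z W = {F.
    (\<forall>y\<in>carrier Y. \<forall>z\<in>carrier Z. (\<lambda>x. F x y z) \<in> linear_maps K X W) \<and>
    (\<forall>x\<in>carrier X. \<forall>z\<in>carrier Z. (\<lambda>y. F x y z) \<in> linear_maps K Y W) \<and>
    (\<forall>x\<in>carrier X. \<forall>y\<in>carrier Y. (\<lambda>z. F x y z) \<in> linear_maps K Z W)}"

definition quadrilinear_maps where
  "quadrilinear_maps K X Y Z U W = {F.
    (\<forall>u\<in>carrier U. (\<lambda>x y z. F x y z u) \<in> trilinear_maps K X Y Z W) \<and>
    (\<forall>x\<in>carrier X. \<forall>y\<in>carrier Y. \<forall>z\<in>carrier Z. (\<lambda>u. F x y z u) \<in> linear_maps K U W)}"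

definition hexalinear_maps where
  "hexalinear_maps K X Y Z U V T W = {F.
    (\<forall>u\<in>carrier U. \<forall>v\<in>carrier V. \<forall>t\<in>carrier T. (\<lambda>x y z. F x y z u v t) \<in> trilinear_maps K X Y Z W) \<and>
    (\<forall>x\<in>carrier X. \<forall>y\<in>carrier Y. \<forall>z\<in>carrier Z. (\<lambda>u v t. F x y z u v t) \<in> trilinear_maps K U V T W)}"

lemma trilinear_mapsD:
  assumes "F \<in> trilinear_maps K X Y Z W"
  shows "\<lbrakk>x \<in> carrier X; y \<in> carrier Y; z \<in> carrier Z\<rbrakk> \<Longrightarrow> F x y z \<in> carrier W"
    and "\<lbrakk>y \<in> carrier Y; z \<in> carrier Z\<rbrakk> \<Longrightarrow> (\<lambda>x. F x y z) \<in> linear_maps K X W"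
    and "\<lbrakk>x \<in> carrier X; z \<in> carrier Z\<rbrakk> \<Longrightarrow> (\<lambda>y. F x y z) \<in> linear_maps K Y W"
    and "\<lbrakk>x \<in> carrier X; y \<in> carrier Y\<rbrakk> \<Longrightarrow> (\<lambda>z. F x y z) \<in> linear_maps K Z W"
  using assms unfolding trilinear_maps_def by (blast dest: linear_mapsD(1))+

lemma quadrilinear_mapsD:
  assumes "F \<in> quadrilinear_maps K X Y Z U W"
  shows "\<lbrakk>x \<in> carrier X; y \<in> carrier Y; z \<in> carrier Z; u \<in> carrier U\<rbrakk> \<Longrightarrow> F x y z u \<in> carrier W"
    and "\<lbrakk>y \<in> carrier Y; z \<in> carrier Z; u \<in> carrier U\<rbrakk> \<Longrightarrow> (\<lambda>x. F x y z u) \<in> linear_maps K X W"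
    and "\<lbrakk>x \<in> carrier X; z \<in> carrier Z; u \<in> carrier U\<rbrakk> \<Longrightarrow> (\<lambda>y. F x y z u) \<in> linear_maps K Y W"
    and "\<lbrakk>x \<in> carrier X; y \<in> carrier Y; u \<in> carrier U\<rbrakk> \<Longrightarrow> (\<lambda>z. F x y z u) \<in> linear_maps K Z W"
    and "\<lbrakk>x \<in> carrier X; y \<in> carrier Y; z \<in> carrier Z\<rbrakk> \<Longrightarrow> (\<lambda>u. F x y z u) \<in> linear_maps K U W"
proof -
  have "(\<lambda>x y z. F x y z u) \<in> trilinear_maps K X Y Z W" if "u \<in> carrier U" for u
    using assms that unfolding quadrilinear_maps_def by blast
  note t = trilinear_mapsD[OF this]
  show "\<lbrakk>x \<in> carrier X; y \<in> carrier Y; z \<in> carrier Z; u \<in> carrier U\<rbrakk> \<Longrightarrow> F x y z u \<in> carrier W"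
    "\<lbrakk>y \<in> carrier Y; z \<in> carrier Z; u \<in> carrier U\<rbrakk> \<Longrightarrow> (\<lambda>x. F x y z u) \<in> linear_maps K X W"
    "\<lbrakk>x \<in> carrier X; z \<in> carrier Z; u \<in> carrier U\<rbrakk> \<Longrightarrow> (\<lambda>y. F x y z u) \<in> linear_maps K Y W"
    "\<lbrakk>x \<in> carrier X; y \<in> carrier Y; u \<in> carrier U\<rbrakk> \<Longrightarrow> (\<lambda>z. F x y z u) \<in> linear_maps K Z W"
    by (simp_all add: t)
  show "\<lbrakk>x \<in> carrier X; y \<in> carrier Y; z \<in> carrier Z\<rbrakk> \<Longrightarrow> (\<lambda>u. F x y z u) \<in> linear_maps K U W"
    using assms unfolding quadrilinear_maps_def by blast
qed

lemma hexalinear_mapsD: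
  assumes "F \<in> hexalinear_maps K X Y Z U V T W"
    and "x \<in> carrier X" "y \<in> carrier Y" "z \<in> carrier Z" "u \<in> carrier U" "v \<in> carrier V" "t \<in> carrier T"
  shows "F x y z u v t \<in> carrier W"
    and "(\<lambda>x. F x y z u v t) \<in> linear_maps K X W"
    and "(\<lambda>y. F x y z u v t) \<in> linear_maps K Y W"
    and "(\<lambda>z. F x y z u v t) \<in> linear_maps K Z W"
    and "(\<lambda>u. F x y z u v t) \<in> linear_maps K U W"
    and "(\<lambda>v. F x y z u v t) \<in> linear_maps K V W"
    and "(\<lambda>t. F x y z u v t) \<in> linear_maps K T W"
proof -
  have "(\<lambda>x y z. F x y z u v t) \<in> trilinear_maps K X Y Z W"
    and "(\<lambda>u v t. F x y z u v t) \<in> trilinear_maps K U V T W"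
    using assms unfolding hexalinear_maps_def by blast+
  note l = trilinear_mapsD[OF this(1)] and r = trilinear_mapsD[OF this(2)]
  show "F x y z u v t \<in> carrier W"
    "(\<lambda>x. F x y z u v t) \<in> linear_maps K X W" "(\<lambda>y. F x y z u v t) \<in> linear_maps K Y W"
    "(\<lambda>z. F x y z u v t) \<in> linear_maps K Z W" "(\<lambda>u. F x y z u v t) \<in> linear_maps K U W"
    "(\<lambda>v. F x y z u v t) \<in> linear_maps K V W" "(\<lambda>t. F x y z u v t) \<in> linear_maps K T W"
    using assms by (simp_all add: l r)
qed

lemmas multilinear_defs = quadrilinear_maps_def hexalinear_maps_def trilinear_maps_def

text \<open>Congruence in the summand alone: each application enters one sum, and a chain of them
  reaches a term below several sums.\<close>

lemmas sweedler_body = sweedler_cong[OF refl refl refl refl refl]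

section \<open>The twisted coalgebra in Sweedler notation\<close>

text \<open>The map \<open>\<sigma> : A \<otimes> B \<rightarrow> B \<otimes> A\<close> plays the role of the inverse of \<open>\<tau> : B \<otimes> A \<rightarrow> A \<otimes> B\<close>.\<close>

locale twist = A: coalgebra K A \<Delta>\<^sub>A \<epsilon>\<^sub>A + B: coalgebra K B \<Delta>\<^sub>B \<epsilon>\<^sub>B
  for K :: "('k, 'r) ring_scheme" and A :: "('k, 'a, 'm) module_scheme"
    and B :: "('k, 'b, 'n) module_scheme" and \<Delta>\<^sub>A \<epsilon>\<^sub>A \<Delta>\<^sub>B \<epsilon>\<^sub>B +
  fixes \<sigma> :: "('a \<times> 'b \<Rightarrow> 'k) set \<Rightarrow> ('b \<times> 'a \<Rightarrow> 'k) set"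
  assumes twist_linear: "\<sigma> \<in> linear_maps K (tensor K A B) (tensor K B A)"
begin

lemma module_A [simp]: "module K A" by (rule A.module_axioms)
lemma module_B [simp]: "module K B" by (rule B.module_axioms)
lemma module_K [simp]: "module K (ground_module K)" by (rule module_ground) (rule A.R.is_cring)

lemmas structure_linear [simp] = A.comult_linear B.comult_linear A.counit_linear B.counit_linear twist_linear

lemmas structure_linear_arg [simp] =
  linear_comp[OF A.comult_linear] linear_comp[OF B.comult_linear]
  linear_comp[OF A.counit_linear] linear_comp[OF B.counit_linear] linear_comp[OF twist_linear]

lemmas structure_closed [simp] =
  linear_mapsD(1)[OF A.comult_linear] linear_mapsD(1)[OF B.comult_linear]
  linear_mapsD(1)[OF twist_linear]

lemma counit_closed [simp]:
  "a \<in> carrier A \<Longrightarrow> \<epsilon>\<^sub>A a \<in> carrier K" "b \<in> carrier B \<Longrightarrow> \<epsilon>\<^sub>B b \<in> carrier K"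
  using linear_mapsD(1)[OF A.counit_linear] linear_mapsD(1)[OF B.counit_linear]
  by (simp_all add: ground_module_def)

section \<open>The identities for \<sigma> as equations between sums\<close>

abbreviation sA where "sA W F a \<equiv> sweedler K A A W F (\<Delta>\<^sub>A a)"
abbreviation sB where "sB W F b \<equiv> sweedler K B B W F (\<Delta>\<^sub>B b)"
abbreviation sT where "sT W F a b \<equiv> sweedler K B A W F (\<sigma> (pure_tensor K A B a b))"

text \<open>This is \<open>(\<Delta>\<^sub>B \<otimes> 1) \<sigma> = (1 \<otimes> \<sigma>)
  (\<sigma> \<otimes> 1) (1 \<otimes> \<Delta>\<^sub>B)\<close>, tested on trilinear maps. The
  target \<open>W\<close> is a parameter because a formula cannot quantify over its type.\<close>

definition pentagon_B where
  "pentagon_B W \<longleftrightarrow> (\<forall>F\<in>trilinear_maps K B B A W. \<forall>a\<in>carrier A. \<forall>b\<in>carrier B.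
    sT W (\<lambda>x y. sB W (\<lambda>x1 x2. F x1 x2 y) x) a b =
    sB W (\<lambda>b1 b2. sT W (\<lambda>x y. sT W (\<lambda>u v. F x u v) y b2) a b1) b)"

text \<open>This is \<open>(1 \<otimes> \<Delta>\<^sub>A) \<sigma> = (\<sigma> \<otimes> 1) (1
  \<otimes> \<sigma>) (\<Delta>\<^sub>A \<otimes> 1)\<close>.\<close>

definition pentagon_A where
  "pentagon_A W \<longleftrightarrow> (\<forall>F\<in>trilinear_maps K B A A W. \<forall>a\<in>carrier A. \<forall>b\<in>carrier B.
    sT W (\<lambda>x y. sA W (\<lambda>y1 y2. F x y1 y2) y) a b =
    sA W (\<lambda>a1 a2. sT W (\<lambda>x y. sT W (\<lambda>u v. F u v y) a1 x) a2 b) a)"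

text \<open>The third identity read for \<sigma>. On the right \<open>x, y\<close> come from the
  first middle \<sigma>, the pairs \<open>x1, y1\<close> and \<open>x2, y2\<close> from
  \<open>\<sigma> \<otimes> \<sigma>\<close>, and \<open>u, v\<close> from the last middle
  \<sigma>.\<close>

definition hexagon where
  "hexagon W \<longleftrightarrow> (\<forall>F\<in>quadrilinear_maps K B B A A W. \<forall>a\<in>carrier A. \<forall>b\<in>carrier B.
    sT W (\<lambda>x y. sB W (\<lambda>x1 x2. sA W (\<lambda>y1 y2. F x1 x2 y1 y2) y) x) a b =
    sA W (\<lambda>a1 a2. sB W (\<lambda>b1 b2. sT W (\<lambda>x y. sT W (\<lambda>x1 y1. sT W (\<lambda>x2 y2.
      sT W (\<lambda>u v. F x1 u v y2) y1 x2) y b2) a1 x) a2 b1) b) a)"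

text \<open>The twisted comultiplication is applied twice, the second time to the left factor on one
  side and to the right factor on the other. The pair \<open>u, v\<close> comes from the \<sigma> of
  the second application.\<close>

definition twisted_coassoc where
  "twisted_coassoc W \<longleftrightarrow> (\<forall>P\<in>hexalinear_maps K A B A B A B W. \<forall>a\<in>carrier A. \<forall>b\<in>carrier B.
    sA W (\<lambda>a1 a2. sB W (\<lambda>b1 b2. sT W (\<lambda>x y.
      sA W (\<lambda>a11 a12. sB W (\<lambda>x1 x2. sT W (\<lambda>u v. P a11 u v x2 y b2) a12 x1) x) a1) a2 b1) b) a =
    sA W (\<lambda>a1 a2. sB W (\<lambda>b1 b2. sT W (\<lambda>x y.
      sA W (\<lambda>y1 y2. sB W (\<lambda>b21 b22. sT W (\<lambda>u v. P a1 x y1 u v b22) y2 b21) b2) y) a2 b1) b) a)"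

text \<open>The first two identities composed with \<sigma>, on pure tensors: \<open>(1 \<otimes>
  \<epsilon>\<^sub>A) \<sigma> = \<epsilon>\<^sub>A \<otimes> 1\<close> and
  \<open>(\<epsilon>\<^sub>B \<otimes> 1) \<sigma> = 1 \<otimes> \<epsilon>\<^sub>B\<close>.\<close>

definition counit_compatible where
  "counit_compatible \<longleftrightarrow> (\<forall>a\<in>carrier A. \<forall>b\<in>carrier B.
    sT B (\<lambda>x y. \<epsilon>\<^sub>A y \<odot>\<^bsub>B\<^esub> x) a b = \<epsilon>\<^sub>A a \<odot>\<^bsub>B\<^esub> b \<and>
    sT A (\<lambda>x y. \<epsilon>\<^sub>B x \<odot>\<^bsub>A\<^esub> y) a b = \<epsilon>\<^sub>B b \<odot>\<^bsub>A\<^esub> a)"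

section \<open>Relations between hexagon, pentagons and coassociativity\<close>

context
  fixes W :: "('k, 'w, 'o) module_scheme"
  assumes W [simp]: "module K W"
begin

lemmas smult_W_closed [simp] = module.smult_closed[OF W]

text \<open>Applying \<open>g\<close> to the identity gives the form in which a counit can be moved
  past \<sigma> inside a nested sum.\<close>

lemma counit_compatible_A:
  assumes "counit_compatible" "a \<in> carrier A" "b \<in> carrier B" "(\<lambda>x. g x) \<in> linear_maps K B W"
  shows "sT W (\<lambda>x y. \<epsilon>\<^sub>A y \<odot>\<^bsub>W\<^esub> g x) a b = \<epsilon>\<^sub>A a \<odot>\<^bsub>W\<^esub> g b"
proof -
  note g = linear_mapsD[OF assms(4)]
  have "g (sT B (\<lambda>x y. \<epsilon>\<^sub>A y \<odot>\<^bsub>B\<^esub> x) a b) = sT W (\<lambda>x y. \<epsilon>\<^sub>A y \<odot>\<^bsub>W\<^esub> g x) a b"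
    by (subst sweedler_hom[OF _ _ _ _ assms(4)]) (simp_all add: g)
  then show ?thesis using assms(1-3) by (simp add: counit_compatible_def g)
qed

lemma counit_compatible_B:
  assumes "counit_compatible" "a \<in> carrier A" "b \<in> carrier B" "(\<lambda>x. g x) \<in> linear_maps K A W"
  shows "sT W (\<lambda>x y. \<epsilon>\<^sub>B x \<odot>\<^bsub>W\<^esub> g y) a b = \<epsilon>\<^sub>B b \<odot>\<^bsub>W\<^esub> g a"
proof -
  note g = linear_mapsD[OF assms(4)]
  have "g (sT A (\<lambda>x y. \<epsilon>\<^sub>B x \<odot>\<^bsub>A\<^esub> y) a b) = sT W (\<lambda>x y. \<epsilon>\<^sub>B x \<odot>\<^bsub>W\<^esub> g y) a b"
    by (subst sweedler_hom[OF _ _ _ _ assms(4)]) (simp_all add: g)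
  then show ?thesis using assms(1-3) by (simp add: counit_compatible_def g)
qed

lemmas counit_simps = A.sweedler_left_counit A.sweedler_right_counit
  B.sweedler_left_counit B.sweedler_right_counit counit_compatible_A counit_compatible_B sweedler_smult

lemma hexagon_imp_pentagons:
  assumes N: "counit_compatible" and H: "hexagon W"
  shows "pentagon_A W" and "pentagon_B W"
proof -
  show "pentagon_B W"
    unfolding pentagon_B_def
  proof (intro ballI)
    fix F a b assume F: "F \<in> trilinear_maps K B B A W" and ab: "a \<in> carrier A" "b \<in> carrier B"
    note [simp] = trilinear_mapsD[OF F]
    \<comment> \<open>A counit on the fourth factor. On the left it cancels
      \<open>\<Delta>\<^sub>A\<close>; on the right it passes through two copies of \<sigma>, from
      \<open>y2\<close> to \<open>y\<close> to \<open>a2\<close>, and then cancels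
      \<open>\<Delta>\<^sub>A\<close>.\<close>
    have "(\<lambda>x1 x2 y1 y2. \<epsilon>\<^sub>A y2 \<odot>\<^bsub>W\<^esub> F x1 x2 y1) \<in> quadrilinear_maps K B B A A W"
      by (simp add: multilinear_defs)
    from H[unfolded hexagon_def, rule_format, OF this ab]
    show "sT W (\<lambda>x y. sB W (\<lambda>x1 x2. F x1 x2 y) x) a b =
      sB W (\<lambda>b1 b2. sT W (\<lambda>x y. sT W (\<lambda>u v. F x u v) y b2) a b1) b"
      using ab by (simp add: counit_simps N)
  qed
  show "pentagon_A W"
    unfolding pentagon_A_def
  proof (intro ballI)
    fix F a b assume F: "F \<in> trilinear_maps K B A A W" and ab: "a \<in> carrier A" "b \<in> carrier B"
    note [simp] = trilinear_mapsD[OF F]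
    \<comment> \<open>A counit on the second factor. On the left it cancels
      \<open>\<Delta>\<^sub>B\<close>; on the right it passes from \<open>u\<close> to
      \<open>x2\<close> to \<open>b2\<close> and then cancels
      \<open>\<Delta>\<^sub>B\<close>.\<close>
    have "(\<lambda>x1 x2 y1 y2. \<epsilon>\<^sub>B x2 \<odot>\<^bsub>W\<^esub> F x1 y1 y2) \<in> quadrilinear_maps K B B A A W"
      by (simp add: multilinear_defs)
    from H[unfolded hexagon_def, rule_format, OF this ab]
    show "sT W (\<lambda>x y. sA W (\<lambda>y1 y2. F x y1 y2) y) a b =
      sA W (\<lambda>a1 a2. sT W (\<lambda>x y. sT W (\<lambda>u v. F u v y) a1 x) a2 b) a"
      using ab by (simp add: counit_simps N)
  qed
qed

lemma twisted_coassoc_imp_pentagons: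
  assumes N: "counit_compatible" and H: "twisted_coassoc W"
  shows "pentagon_A W" and "pentagon_B W"
proof -
  show "pentagon_B W"
    unfolding pentagon_B_def
  proof (intro ballI)
    fix F a b assume F: "F \<in> trilinear_maps K B B A W" and ab: "a \<in> carrier A" "b \<in> carrier B"
    note [simp] = trilinear_mapsD[OF F]
    \<comment> \<open>Counits on the first, third and sixth factors. The left side keeps only
      \<open>\<Delta>\<^sub>B x\<close>; the right side keeps only \<open>\<Delta>\<^sub>B b\<close>
      and two copies of \<sigma>.\<close>
    have "(\<lambda>a1 b1 a2 b2 a3 b3. \<epsilon>\<^sub>A a1 \<odot>\<^bsub>W\<^esub> (\<epsilon>\<^sub>A a2 \<odot>\<^bsub>W\<^esub> (\<epsilon>\<^sub>B b3 \<odot>\<^bsub>W\<^esub> F b1 b2 a3)))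
        \<in> hexalinear_maps K A B A B A B W"
      by (simp add: multilinear_defs)
    from H[unfolded twisted_coassoc_def, rule_format, OF this ab]
    show "sT W (\<lambda>x y. sB W (\<lambda>x1 x2. F x1 x2 y) x) a b =
      sB W (\<lambda>b1 b2. sT W (\<lambda>x y. sT W (\<lambda>u v. F x u v) y b2) a b1) b"
      using ab by (simp add: counit_simps N)
  qed
  show "pentagon_A W"
    unfolding pentagon_A_def
  proof (intro ballI)
    fix F a b assume F: "F \<in> trilinear_maps K B A A W" and ab: "a \<in> carrier A" "b \<in> carrier B"
    note [simp] = trilinear_mapsD[OF F]
    \<comment> \<open>Counits on the first, fourth and sixth factors. Now the two copies of \<sigma>
      survive on the left side of coassociativity, so the equation is used in the reverse
      direction.\<close>
    have "(\<lambda>a1 b1 a2 b2 a3 b3. \<epsilon>\<^sub>A a1 \<odot>\<^bsub>W\<^esub> (\<epsilon>\<^sub>B b2 \<odot>\<^bsub>W\<^esub> (\<epsilon>\<^sub>B b3 \<odot>\<^bsub>W\<^esub> F b1 a2 a3)))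
        \<in> hexalinear_maps K A B A B A B W"
      by (simp add: multilinear_defs)
    from H[unfolded twisted_coassoc_def, rule_format, OF this ab, symmetric]
    show "sT W (\<lambda>x y. sA W (\<lambda>y1 y2. F x y1 y2) y) a b =
      sA W (\<lambda>a1 a2. sT W (\<lambda>x y. sT W (\<lambda>u v. F u v y) a1 x) a2 b) a"
      using ab by (simp add: counit_simps N)
  qed
qed

lemma pentagons_imp_hexagon:
  assumes PA: "pentagon_A W" and PB: "pentagon_B W"
  shows "hexagon W"
  unfolding hexagon_def
proof (intro ballI)
  fix F a b assume F: "F \<in> quadrilinear_maps K B B A A W" and ab: "a \<in> carrier A" "b \<in> carrier B"
  note [simp] = quadrilinear_mapsD[OF F] ab
  note PA = PA[unfolded pentagon_A_def, rule_format] and PB = PB[unfolded pentagon_B_def, rule_format]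
  \<comment> \<open>\<open>\<Delta>\<^sub>B\<close> is moved past \<sigma>, with the
    comultiplication of \<open>y\<close> absorbed into the test function.\<close>
  have "sT W (\<lambda>x y. sB W (\<lambda>x1 x2. sA W (\<lambda>y1 y2. F x1 x2 y1 y2) y) x) a b =
      sB W (\<lambda>b1 b2. sT W (\<lambda>x y. sT W (\<lambda>u v. sA W (\<lambda>y1 y2. F x u y1 y2) v) y b2) a b1) b"
    by (rule PB[where F = "\<lambda>x1 x2 y. sA W (\<lambda>y1 y2. F x1 x2 y1 y2) y"])
      (simp_all add: multilinear_defs)
  \<comment> \<open>\<open>\<Delta>\<^sub>A\<close> is moved past the inner \<sigma>, which pairs
    \<open>y\<close> with \<open>b2\<close>.\<close>
  also have "\<dots> = sB W (\<lambda>b1 b2. sT W (\<lambda>x y. sA W (\<lambda>y1 y2.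
      sT W (\<lambda>x2 y2. sT W (\<lambda>u v. F x u v y2) y1 x2) y2 b2) y) a b1) b"
    by (rule sweedler_body, rule sweedler_body, rule PA) (simp_all add: multilinear_defs)
  \<comment> \<open>\<open>\<Delta>\<^sub>A\<close> is moved past the remaining \<sigma>, which
    pairs \<open>a\<close> with \<open>b1\<close>.\<close>
  also have "\<dots> = sB W (\<lambda>b1 b2. sA W (\<lambda>a1 a2. sT W (\<lambda>x y. sT W (\<lambda>x1 y1. sT W (\<lambda>x2 y2.
      sT W (\<lambda>u v. F x1 u v y2) y1 x2) y b2) a1 x) a2 b1) a) b"
    by (rule sweedler_body,
        rule PA[where F = "\<lambda>x y1 y2. sT W (\<lambda>x2 y2. sT W (\<lambda>u v. F x u v y2) y1 x2) y2 b2" for b2])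
      (simp_all add: multilinear_defs)
  also have "\<dots> = sA W (\<lambda>a1 a2. sB W (\<lambda>b1 b2. sT W (\<lambda>x y. sT W (\<lambda>x1 y1. sT W (\<lambda>x2 y2.
      sT W (\<lambda>u v. F x1 u v y2) y1 x2) y b2) a1 x) a2 b1) b) a"
    by (rule sweedler_swap) simp_all
  finally show "sT W (\<lambda>x y. sB W (\<lambda>x1 x2. sA W (\<lambda>y1 y2. F x1 x2 y1 y2) y) x) a b = \<dots>" .
qed

lemma pentagons_imp_twisted_coassoc:
  assumes PA: "pentagon_A W" and PB: "pentagon_B W"
  shows "twisted_coassoc W"
  unfolding twisted_coassoc_def
proof (intro ballI)
  fix P a b assume P: "P \<in> hexalinear_maps K A B A B A B W" and ab: "a \<in> carrier A" "b \<in> carrier B"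
  note [simp] = hexalinear_mapsD[OF P] ab
  note PA = PA[unfolded pentagon_A_def, rule_format] and PB = PB[unfolded pentagon_B_def, rule_format]
  have "sA W (\<lambda>a1 a2. sB W (\<lambda>b1 b2. sT W (\<lambda>x y.
      sA W (\<lambda>a11 a12. sB W (\<lambda>x1 x2. sT W (\<lambda>u v. P a11 u v x2 y b2) a12 x1) x) a1) a2 b1) b) a =
    sA W (\<lambda>a1 a2. sB W (\<lambda>b1 b2. sA W (\<lambda>a11 a12. sT W (\<lambda>x y.
      sB W (\<lambda>x1 x2. sT W (\<lambda>u v. P a11 u v x2 y b2) a12 x1) x) a2 b1) a1) b) a"
    by (rule sweedler_body, rule sweedler_body, rule sweedler_swap) simp_all
  \<comment> \<open>The comultiplication of \<open>x\<close> is replaced by one of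
    \<open>b1\<close>, at the cost of a second \<sigma>.\<close>
  also have "\<dots> = sA W (\<lambda>a1 a2. sB W (\<lambda>b1 b2. sA W (\<lambda>a11 a12. sB W (\<lambda>b11 b12.
      sT W (\<lambda>x y. sT W (\<lambda>u' v'. sT W (\<lambda>u v. P a11 u v u' v' b2) a12 x) y b12) a2 b11) b1) a1) b) a"
    by (rule sweedler_body, rule sweedler_body, rule sweedler_body,
        rule PB[where F = "\<lambda>x1 x2 y. sT W (\<lambda>u v. P a11 u v x2 y b2) a12 x1" for a11 a12 b2])
      (simp_all add: multilinear_defs)
  also have "\<dots> = sA W (\<lambda>a1 a2. sA W (\<lambda>a11 a12. sB W (\<lambda>b1 b2. sB W (\<lambda>b11 b12.
      sT W (\<lambda>x y. sT W (\<lambda>u' v'. sT W (\<lambda>u v. P a11 u v u' v' b2) a12 x) y b12) a2 b11) b1) b) a1) a"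
    by (rule sweedler_body, rule sweedler_swap) simp_all
  \<comment> \<open>Both comultiplications of \<open>A\<close> now stand in front, and next to them
    both of \<open>B\<close>. Coassociativity of \<open>A\<close> and then of \<open>B\<close> moves
    the second splitting from \<open>a1\<close> to \<open>a2\<close> and from \<open>b1\<close> to
    \<open>b2\<close>, as on the right side of the goal.\<close>
  also have "\<dots> = sA W (\<lambda>a1 a2. sA W (\<lambda>a21 a22. sB W (\<lambda>b1 b2. sB W (\<lambda>b11 b12.
      sT W (\<lambda>x y. sT W (\<lambda>u' v'. sT W (\<lambda>u v. P a1 u v u' v' b2) a21 x) y b12) a22 b11) b1) b) a2) a"
    by (rule A.sweedler_coassoc[where F = "\<lambda>a1 a21 a22. sB W (\<lambda>b1 b2. sB W (\<lambda>b11 b12.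
      sT W (\<lambda>x y. sT W (\<lambda>u' v'. sT W (\<lambda>u v. P a1 u v u' v' b2) a21 x) y b12) a22 b11) b1) b"]) simp_all
  also have "\<dots> = sA W (\<lambda>a1 a2. sA W (\<lambda>a21 a22. sB W (\<lambda>b1 b2. sB W (\<lambda>b21 b22.
      sT W (\<lambda>x y. sT W (\<lambda>u' v'. sT W (\<lambda>u v. P a1 u v u' v' b22) a21 x) y b21) a22 b1) b2) b) a2) a"
    by (rule sweedler_body, rule sweedler_body,
        rule B.sweedler_coassoc[where F = "\<lambda>b1 b21 b22.
      sT W (\<lambda>x y. sT W (\<lambda>u' v'. sT W (\<lambda>u v. P a1 u v u' v' b22) a21 x) y b21) a22 b1" for a1 a21 a22]) simp_all
  also have "\<dots> = sA W (\<lambda>a1 a2. sB W (\<lambda>b1 b2. sA W (\<lambda>a21 a22. sB W (\<lambda>b21 b22.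
      sT W (\<lambda>x y. sT W (\<lambda>u' v'. sT W (\<lambda>u v. P a1 u v u' v' b22) a21 x) y b21) a22 b1) b2) a2) b) a"
    by (rule sweedler_body, rule sweedler_swap) simp_all
  \<comment> \<open>The two inner copies of \<sigma> act on disjoint pairs, \<open>a21, x\<close>
    and \<open>y, b21\<close>, so their sums may be exchanged; the bound variables are renamed at
    the same time.\<close>
  also have "\<dots> = sA W (\<lambda>a1 a2. sB W (\<lambda>b1 b2. sA W (\<lambda>a21 a22. sB W (\<lambda>b21 b22.
      sT W (\<lambda>x y. sT W (\<lambda>x' v'. sT W (\<lambda>u v. P a1 x' v' u v b22) y b21) a21 x) a22 b1) b2) a2) b) a"
    by (rule sweedler_body, rule sweedler_body, rule sweedler_body, rule sweedler_body, rule sweedler_body,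
       rule sweedler_swap) simp_all
  also have "\<dots> = sA W (\<lambda>a1 a2. sB W (\<lambda>b1 b2. sA W (\<lambda>a21 a22. sT W (\<lambda>x y. sB W (\<lambda>b21 b22.
      sT W (\<lambda>x' v'. sT W (\<lambda>u v. P a1 x' v' u v b22) y b21) a21 x) b2) a22 b1) a2) b) a"
    by (rule sweedler_body, rule sweedler_body, rule sweedler_body, rule sweedler_swap) simp_all
  also have "\<dots> = sA W (\<lambda>a1 a2. sB W (\<lambda>b1 b2. sA W (\<lambda>a21 a22. sT W (\<lambda>x y. sT W (\<lambda>x' v'.
      sB W (\<lambda>b21 b22. sT W (\<lambda>u v. P a1 x' v' u v b22) y b21) b2) a21 x) a22 b1) a2) b) a"
    by (rule sweedler_body, rule sweedler_body, rule sweedler_body, rule sweedler_body, rule sweedler_swap) simp_all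
  \<comment> \<open>\<open>pentagon_A\<close> from right to left: the comultiplication of
    \<open>a2\<close> and the two outer copies of \<sigma> become one \<sigma> followed by the
    comultiplication of \<open>y\<close>.\<close>
  also have "\<dots> = sA W (\<lambda>a1 a2. sB W (\<lambda>b1 b2. sT W (\<lambda>x y.
      sA W (\<lambda>y1 y2. sB W (\<lambda>b21 b22. sT W (\<lambda>u v. P a1 x y1 u v b22) y2 b21) b2) y) a2 b1) b) a"
    by (rule sweedler_body, rule sweedler_body,
        rule PA[where F = "\<lambda>x y1 y2. sB W (\<lambda>b21 b22. sT W (\<lambda>u v. P a1 x y1 u v b22) y2 b21) b2" for a1 b2, symmetric])
      (simp_all add: multilinear_defs)
  finally show "sA W (\<lambda>a1 a2. sB W (\<lambda>b1 b2. sT W (\<lambda>x y.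
      sA W (\<lambda>a11 a12. sB W (\<lambda>x1 x2. sT W (\<lambda>u v. P a11 u v x2 y b2) a12 x1) x) a1) a2 b1) b) a = \<dots>" .
qed

end
end

section \<open>Translation to maps between tensor products\<close>

text \<open>Used for \<open>\<Delta>\<^sub>A a \<otimes> \<Delta>\<^sub>B b\<close> and for
  \<open>\<sigma> p \<otimes> \<sigma> q\<close>, whose factors are not pure.\<close>

lemma pure_tensor_expand:
  assumes "module K X" "module K Y" "module K Z" "module K U"
    and "s \<in> carrier (tensor K X Y)" "r \<in> carrier (tensor K Z U)"
  shows "pure_tensor K (tensor K X Y) (tensor K Z U) s r =
    sweedler K X Y (tensor K (tensor K X Y) (tensor K Z U)) (\<lambda>x y.
      sweedler K Z U (tensor K (tensor K X Y) (tensor K Z U)) (\<lambda>z u.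
        pure_tensor K (tensor K X Y) (tensor K Z U) (pure_tensor K X Y x y) (pure_tensor K Z U z u)) r) s"
proof -
  have "pure_tensor K (tensor K X Y) (tensor K Z U) s r =
    pure_tensor K (tensor K X Y) (tensor K Z U) (sweedler K X Y (tensor K X Y) (\<lambda>x y. pure_tensor K X Y x y) s)
      (sweedler K Z U (tensor K Z U) (\<lambda>z u. pure_tensor K Z U z u) r)"
    by (simp only: sweedler_pure_id assms)
  also have "\<dots> = sweedler K X Y (tensor K (tensor K X Y) (tensor K Z U)) (\<lambda>x y.
      sweedler K Z U (tensor K (tensor K X Y) (tensor K Z U)) (\<lambda>z u.
        pure_tensor K (tensor K X Y) (tensor K Z U) (pure_tensor K X Y x y) (pure_tensor K Z U z u)) r) s"
    by (subst pure_tensor_sweedler(1)) (simp_all add: assms)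
  finally show ?thesis .
qed

text \<open>By \<open>pure_tensor_expand\<close> the pure tensors of pure tensors span the fourfold
  product.\<close>

lemma tensor_ext4:
  assumes "module K X" "module K Y" "module K Z" "module K U" "module K W"
    and f: "f \<in> linear_maps K (tensor K (tensor K X Y) (tensor K Z U)) W"
    and g: "g \<in> linear_maps K (tensor K (tensor K X Y) (tensor K Z U)) W"
    and eq: "\<And>x y z u. \<lbrakk>x \<in> carrier X; y \<in> carrier Y; z \<in> carrier Z; u \<in> carrier U\<rbrakk> \<Longrightarrow>
      f (pure_tensor K (tensor K X Y) (tensor K Z U) (pure_tensor K X Y x y) (pure_tensor K Z U z u)) =
      g (pure_tensor K (tensor K X Y) (tensor K Z U) (pure_tensor K X Y x y) (pure_tensor K Z U z u))"
    and t: "t \<in> carrier (tensor K (tensor K X Y) (tensor K Z U))"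
  shows "f t = g t"
proof (rule tensor_ext[OF _ _ assms(5) f g _ t])
  fix s r assume "s \<in> carrier (tensor K X Y)" "r \<in> carrier (tensor K Z U)"
  then show "f (pure_tensor K (tensor K X Y) (tensor K Z U) s r) =
      g (pure_tensor K (tensor K X Y) (tensor K Z U) s r)"
    by (simp add: pure_tensor_expand[where s = s and r = r] assms(1-5)
        sweedler_hom[OF _ _ _ _ f] sweedler_hom[OF _ _ _ _ g] eq)
qed (simp_all add: assms(1-4))

lemma middle_map_inverse:
  assumes "module K X" "module K Y" "module K Z" "module K U" "module K Y'" "module K Z'"
    and f: "f \<in> linear_maps K (tensor K Y Z) (tensor K Y' Z')"
    and g: "g \<in> linear_maps K (tensor K Y' Z') (tensor K Y Z)"
    and gf: "\<And>t. t \<in> carrier (tensor K Y Z) \<Longrightarrow> g (f t) = t"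
    and t: "t \<in> carrier (tensor K (tensor K X Y) (tensor K Z U))"
  shows "middle_map K X Y' Z' U Y Z g (middle_map K X Y Z U Y' Z' f t) = t"
proof (rule tensor_ext4[OF assms(1-4) _ linear_comp[OF middle_map_linear middle_map_linear] linear_id _ t])
  fix x y z u assume e: "x \<in> carrier X" "y \<in> carrier Y" "z \<in> carrier Z" "u \<in> carrier U"
  let ?T = "tensor K (tensor K X Y) (tensor K Z U)"
  \<comment> \<open>On a pure tensor of \<open>Y' \<otimes> Z'\<close> this is the outer middle map
    with \<open>x\<close> and \<open>u\<close> fixed. It is linear, so the sum over the value of
    \<open>f\<close> collapses, and \<open>g\<close> meets \<open>f\<close> directly.\<close>
  let ?h = "\<lambda>t. sweedler K Y Z ?T (\<lambda>y z. pure_tensor K (tensor K X Y) (tensor K Z U)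
    (pure_tensor K X Y x y) (pure_tensor K Z U z u)) (g t)"
  have "middle_map K X Y' Z' U Y Z g (middle_map K X Y Z U Y' Z' f
      (pure_tensor K (tensor K X Y) (tensor K Z U) (pure_tensor K X Y x y) (pure_tensor K Z U z u))) =
    sweedler K Y' Z' ?T (\<lambda>y z. ?h (pure_tensor K Y' Z' y z)) (f (pure_tensor K Y Z y z))"
    by (simp add: middle_map_pure e assms(1-6) f, subst sweedler_hom[where g = "middle_map K X Y' Z' U Y Z g"])
      (simp_all add: middle_map_linear middle_map_pure e assms(1-6) f g)
  also have "\<dots> = ?h (f (pure_tensor K Y Z y z))"
    by (rule sweedler_apply_pure) (simp_all add: e assms(1-6) g linear_mapsD(1)[OF f])
  also have "\<dots> = pure_tensor K (tensor K X Y) (tensor K Z U) (pure_tensor K X Y x y) (pure_tensor K Z U z u)"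
    by (simp add: gf e assms(1-6))
  finally show "middle_map K X Y' Z' U Y Z g (middle_map K X Y Z U Y' Z' f
      (pure_tensor K (tensor K X Y) (tensor K Z U) (pure_tensor K X Y x y) (pure_tensor K Z U z u))) =
    pure_tensor K (tensor K X Y) (tensor K Z U) (pure_tensor K X Y x y) (pure_tensor K Z U z u)" .
qed (simp_all add: assms(1-6) f g)

lemma tensor_map_inverse:
  assumes "module K X" "module K Y" "module K X'" "module K Y'"
    and f: "f \<in> linear_maps K X X'" "g \<in> linear_maps K Y Y'"
    and f': "f' \<in> linear_maps K X' X" "g' \<in> linear_maps K Y' Y"
    and inv: "\<And>x. x \<in> carrier X \<Longrightarrow> f' (f x) = x" "\<And>y. y \<in> carrier Y \<Longrightarrow> g' (g y) = y"
    and t: "t \<in> carrier (tensor K X Y)"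
  shows "tensor_map K X Y f' g' (tensor_map K X' Y' f g t) = t"
  by (rule tensor_ext[OF assms(1,2) _ linear_comp[OF tensor_map_linear tensor_map_linear] linear_id _ t])
    (simp_all add: assms(1-4) f f' inv tensor_map_pure[OF assms(1-4) f] tensor_map_pure[OF assms(3,4,1,2) f']
       linear_mapsD(1)[OF f(1)] linear_mapsD(1)[OF f(2)])

section \<open>Twisted comultiplication and coassociativity as maps\<close>

context twist
begin

abbreviation "AB \<equiv> tensor K A B"
abbreviation "AB2 \<equiv> tensor K AB AB"
abbreviation "AB3 \<equiv> tensor K AB AB2"

text \<open>This is \<open>twisted_comult\<close> for a general \<sigma>; the two agree once
  \<sigma> is the inverse of \<tau>.\<close>

definition "comult = middle_map K A A B B B A \<sigma> \<circ> tensor_map K (tensor K A A) (tensor K B B) \<Delta>\<^sub>A \<Delta>\<^sub>B"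

lemma comult_linear [simp]: "comult \<in> linear_maps K AB AB2"
  unfolding comult_def comp_def
  by (rule linear_comp[OF middle_map_linear tensor_map_linear]) simp_all

lemmas comult_linear_arg [simp] = linear_comp[OF comult_linear]
lemmas comult_closed [simp] = linear_mapsD(1)[OF comult_linear]

lemma comult_pure [simp]:
  assumes "a \<in> carrier A" "b \<in> carrier B"
  shows "comult (pure_tensor K A B a b) = sA AB2 (\<lambda>a1 a2. sB AB2 (\<lambda>b1 b2. sT AB2 (\<lambda>x y.
    pure_tensor K AB AB (pure_tensor K A B a1 x) (pure_tensor K A B y b2)) a2 b1) b) a"
  unfolding comult_def comp_def
  using assms
  by (simp add: tensor_map_pure[of K A B "tensor K A A" "tensor K B B"]
      pure_tensor_expand[where s = "\<Delta>\<^sub>A a" and r = "\<Delta>\<^sub>B b"]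
      sweedler_hom[where g = "middle_map K A A B B B A \<sigma>" and W = "tensor K (tensor K A A) (tensor K B B)" and W' = AB2]
      middle_map_linear middle_map_pure)

text \<open>The result has exactly the shape of the left side of \<open>twisted_coassoc\<close>,
  with \<open>P\<close> the formation of pure tensors. The next lemma does the same for the right
  side.\<close>

lemma tensor_map_comult_left:
  assumes "a \<in> carrier A" "b \<in> carrier B"
  shows "tensor_assoc K AB AB AB (tensor_map K AB2 AB comult id (comult (pure_tensor K A B a b))) =
    sA AB3 (\<lambda>a1 a2. sB AB3 (\<lambda>b1 b2. sT AB3 (\<lambda>x y.
      sA AB3 (\<lambda>a11 a12. sB AB3 (\<lambda>x1 x2. sT AB3 (\<lambda>u v. pure_tensor K AB AB2 (pure_tensor K A B a11 u)
        (pure_tensor K AB AB (pure_tensor K A B v x2) (pure_tensor K A B y b2))) a12 x1) x) a1) a2 b1) b) a"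
  using assms
  by (simp add: tensor_map_sweedler[where A = AB and B = AB] id_linear tensor_assoc_sweedler
      tensor_assoc_pure)

lemma tensor_map_comult_right:
  assumes "a \<in> carrier A" "b \<in> carrier B"
  shows "tensor_map K AB AB2 id comult (comult (pure_tensor K A B a b)) =
    sA AB3 (\<lambda>a1 a2. sB AB3 (\<lambda>b1 b2. sT AB3 (\<lambda>x y.
      sA AB3 (\<lambda>y1 y2. sB AB3 (\<lambda>b21 b22. sT AB3 (\<lambda>u v. pure_tensor K AB AB2 (pure_tensor K A B a1 x)
        (pure_tensor K AB AB (pure_tensor K A B y1 u) (pure_tensor K A B v b22))) y2 b21) b2) y) a2 b1) b) a"
  using assms
  by (simp add: tensor_map_sweedler[where A = AB and B = AB] id_linear)

lemma coassoc_imp_twisted_coassoc: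
  assumes W [simp]: "module K W"
    and co: "\<And>t. t \<in> carrier AB \<Longrightarrow>
      tensor_assoc K AB AB AB (tensor_map K AB2 AB comult id (comult t)) = tensor_map K AB AB2 id comult (comult t)"
  shows "twisted_coassoc W"
  unfolding twisted_coassoc_def
proof (intro ballI)
  fix P a b assume P: "P \<in> hexalinear_maps K A B A B A B W" and ab: "a \<in> carrier A" "b \<in> carrier B"
  note [simp] = hexalinear_mapsD[OF P] ab
  \<comment> \<open>The linear map on the target of coassociativity that is induced by
    \<open>P\<close>.\<close>
  let ?L = "\<lambda>t. sweedler K AB AB2 W (\<lambda>s r. sweedler K AB AB W (\<lambda>s' s''.
    sweedler K A B W (\<lambda>a1 b1. sweedler K A B W (\<lambda>a2 b2. sweedler K A B W (\<lambda>a3 b3. P a1 b1 a2 b2 a3 b3) s'') s') s) r) t"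
  from co[of "pure_tensor K A B a b"]
  have "?L (tensor_assoc K AB AB AB (tensor_map K AB2 AB comult id (comult (pure_tensor K A B a b)))) =
      ?L (tensor_map K AB AB2 id comult (comult (pure_tensor K A B a b)))"
    by (simp del: comult_pure)
  then show "sA W (\<lambda>a1 a2. sB W (\<lambda>b1 b2. sT W (\<lambda>x y.
      sA W (\<lambda>a11 a12. sB W (\<lambda>x1 x2. sT W (\<lambda>u v. P a11 u v x2 y b2) a12 x1) x) a1) a2 b1) b) a =
    sA W (\<lambda>a1 a2. sB W (\<lambda>b1 b2. sT W (\<lambda>x y.
      sA W (\<lambda>y1 y2. sB W (\<lambda>b21 b22. sT W (\<lambda>u v. P a1 x y1 u v b22) y2 b21) b2) y) a2 b1) b) a"
    unfolding tensor_map_comult_left[OF ab] tensor_map_comult_right[OF ab] by simp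
qed

lemma twisted_coassoc_imp_coassoc:
  assumes co: "twisted_coassoc AB3" and t: "t \<in> carrier AB"
  shows "tensor_assoc K AB AB AB (tensor_map K AB2 AB comult id (comult t)) = tensor_map K AB AB2 id comult (comult t)"
proof (rule tensor_ext[where W = AB3, OF _ _ _ _ _ _ t])
  show "(\<lambda>t. tensor_assoc K AB AB AB (tensor_map K AB2 AB comult id (comult t))) \<in> linear_maps K AB AB3"
    by (rule linear_comp[OF tensor_assoc_linear linear_comp[OF tensor_map_linear comult_linear]])
      (simp_all add: id_linear)
  show "(\<lambda>t. tensor_map K AB AB2 id comult (comult t)) \<in> linear_maps K AB AB3"
    by (rule linear_comp[OF tensor_map_linear comult_linear]) (simp_all add: id_linear)
next
  fix a b assume ab: "a \<in> carrier A" "b \<in> carrier B"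
  \<comment> \<open>The universal test function: with it, the Sweedler identity is coassociativity
    itself.\<close>
  have "(\<lambda>a1 b1 a2 b2 a3 b3. pure_tensor K AB AB2 (pure_tensor K A B a1 b1)
      (pure_tensor K AB AB (pure_tensor K A B a2 b2) (pure_tensor K A B a3 b3)))
      \<in> hexalinear_maps K A B A B A B AB3"
    by (simp add: multilinear_defs)
  from co[unfolded twisted_coassoc_def, rule_format, OF this ab]
  show "tensor_assoc K AB AB AB (tensor_map K AB2 AB comult id (comult (pure_tensor K A B a b))) =
      tensor_map K AB AB2 id comult (comult (pure_tensor K A B a b))"
    unfolding tensor_map_comult_left[OF ab] tensor_map_comult_right[OF ab] .
qed simp_all

section \<open>The third identity as an equation of maps\<close>

lemma hexagon_left_pure:
  assumes "a \<in> carrier A" "b \<in> carrier B"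
  defines "W4 \<equiv> tensor K (tensor K B B) (tensor K A A)"
  shows "tensor_map K (tensor K B B) (tensor K A A) \<Delta>\<^sub>B \<Delta>\<^sub>A (\<sigma> (pure_tensor K A B a b)) =
    sT W4 (\<lambda>x y. sB W4 (\<lambda>x1 x2. sA W4 (\<lambda>y1 y2. pure_tensor K (tensor K B B) (tensor K A A)
      (pure_tensor K B B x1 x2) (pure_tensor K A A y1 y2)) y) x) a b"
  unfolding W4_def using assms(1,2)
  by (simp add: tensor_map_sweedler[where A = B and B = A]
      pure_tensor_expand[where s = "\<Delta>\<^sub>B x" and r = "\<Delta>\<^sub>A y" for x y])

definition "hexagon_map = middle_map K B A B A B A \<sigma> \<circ> tensor_map K (tensor K B A) (tensor K B A) \<sigma> \<sigma> \<circ>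
    middle_map K A A B B B A \<sigma> \<circ> tensor_map K (tensor K A A) (tensor K B B) \<Delta>\<^sub>A \<Delta>\<^sub>B"

lemma hexagon_map_linear:
  "hexagon_map \<in> linear_maps K AB (tensor K (tensor K B B) (tensor K A A))"
  unfolding hexagon_map_def comp_def
  by (rule linear_comp[OF middle_map_linear linear_comp[OF tensor_map_linear linear_comp[OF middle_map_linear tensor_map_linear]]])
   simp_all

lemma hexagon_right_pure:
  assumes "a \<in> carrier A" "b \<in> carrier B"
  defines "W4 \<equiv> tensor K (tensor K B B) (tensor K A A)"
  shows "hexagon_map (pure_tensor K A B a b) =
    sA W4 (\<lambda>a1 a2. sB W4 (\<lambda>b1 b2. sT W4 (\<lambda>x y. sT W4 (\<lambda>x1 y1. sT W4 (\<lambda>x2 y2.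
      sT W4 (\<lambda>u v. pure_tensor K (tensor K B B) (tensor K A A)
      (pure_tensor K B B x1 u) (pure_tensor K A A v y2)) y1 x2) y b2) a1 x) a2 b1) b) a"
proof -
  let ?BA = "tensor K B A" and ?BA2 = "tensor K (tensor K B A) (tensor K B A)"
  \<comment> \<open>The two maps that \<open>hexagon_map\<close> applies first compose to
    \<open>comult\<close>, so the formula for \<open>comult\<close> on pure tensors applies.\<close>
  have h: "hexagon_map (pure_tensor K A B a b) =
      middle_map K B A B A B A \<sigma> (tensor_map K ?BA ?BA \<sigma> \<sigma> (comult (pure_tensor K A B a b)))"
    by (simp add: hexagon_map_def comult_def)
  have "tensor_map K ?BA ?BA \<sigma> \<sigma> (comult (pure_tensor K A B a b)) =
      sA ?BA2 (\<lambda>a1 a2. sB ?BA2 (\<lambda>b1 b2. sT ?BA2 (\<lambda>x y.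
        sT ?BA2 (\<lambda>x1 y1. sT ?BA2 (\<lambda>x2 y2.
          pure_tensor K ?BA ?BA (pure_tensor K B A x1 y1) (pure_tensor K B A x2 y2))
      y b2) a1 x) a2 b1) b) a"
    using assms(1,2)
    by (simp add: tensor_map_sweedler[where A = AB and B = AB]
      pure_tensor_expand[where s = "\<sigma> p" and r = "\<sigma> q" for p q])
  then show ?thesis
    unfolding h W4_def using assms(1,2)
    by (simp del: comult_pure add:
      sweedler_hom[where g = "middle_map K B A B A B A \<sigma>" and W = ?BA2
        and W' = "tensor K (tensor K B B) (tensor K A A)"]
      middle_map_linear middle_map_pure)
qed

lemma hexagon_maps_imp_hexagon:
  assumes W [simp]: "module K W"
    and eq: "\<And>t. t \<in> carrier AB \<Longrightarrow>
      tensor_map K (tensor K B B) (tensor K A A) \<Delta>\<^sub>B \<Delta>\<^sub>A (\<sigma> t) = hexagon_map t"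
  shows "hexagon W"
  unfolding hexagon_def
proof (intro ballI)
  fix F a b assume F: "F \<in> quadrilinear_maps K B B A A W" and ab: "a \<in> carrier A" "b \<in> carrier B"
  note [simp] = quadrilinear_mapsD[OF F] ab
  let ?L = "\<lambda>t. sweedler K (tensor K B B) (tensor K A A) W (\<lambda>s r. sweedler K B B W (\<lambda>x1 x2.
    sweedler K A A W (\<lambda>y1 y2. F x1 x2 y1 y2) r) s) t"
  from eq[of "pure_tensor K A B a b"]
  have "?L (tensor_map K (tensor K B B) (tensor K A A) \<Delta>\<^sub>B \<Delta>\<^sub>A (\<sigma> (pure_tensor K A B a b))) =
      ?L (hexagon_map (pure_tensor K A B a b))"
    by simp
  then show "sT W (\<lambda>x y. sB W (\<lambda>x1 x2. sA W (\<lambda>y1 y2. F x1 x2 y1 y2) y) x) a b =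
    sA W (\<lambda>a1 a2. sB W (\<lambda>b1 b2. sT W (\<lambda>x y. sT W (\<lambda>x1 y1. sT W (\<lambda>x2 y2.
      sT W (\<lambda>u v. F x1 u v y2) y1 x2) y b2) a1 x) a2 b1) b) a"
    unfolding hexagon_left_pure[OF ab] hexagon_right_pure[OF ab] by simp
qed

lemma hexagon_imp_hexagon_maps:
  assumes H: "hexagon (tensor K (tensor K B B) (tensor K A A))" and t: "t \<in> carrier AB"
  shows "tensor_map K (tensor K B B) (tensor K A A) \<Delta>\<^sub>B \<Delta>\<^sub>A (\<sigma> t) = hexagon_map t"
proof (rule tensor_ext[OF _ _ _ _ hexagon_map_linear _ t])
  show "(\<lambda>t. tensor_map K (tensor K B B) (tensor K A A) \<Delta>\<^sub>B \<Delta>\<^sub>A (\<sigma> t)) \<in>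
      linear_maps K AB (tensor K (tensor K B B) (tensor K A A))"
    by (rule linear_comp[OF tensor_map_linear twist_linear]) simp_all
next
  fix a b assume ab: "a \<in> carrier A" "b \<in> carrier B"
  \<comment> \<open>Again the universal test function, here in four variables.\<close>
  have "(\<lambda>x1 x2 y1 y2. pure_tensor K (tensor K B B) (tensor K A A)
      (pure_tensor K B B x1 x2) (pure_tensor K A A y1 y2))
      \<in> quadrilinear_maps K B B A A (tensor K (tensor K B B) (tensor K A A))"
    by (simp add: multilinear_defs)
  from H[unfolded hexagon_def, rule_format, OF this ab]
  show "tensor_map K (tensor K B B) (tensor K A A) \<Delta>\<^sub>B \<Delta>\<^sub>A (\<sigma> (pure_tensor K A B a b)) =
      hexagon_map (pure_tensor K A B a b)"
    unfolding hexagon_left_pure[OF ab] hexagon_right_pure[OF ab] .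
qed simp_all

section \<open>The counit axioms\<close>

definition "counit = left_unitor K (ground_module K) \<circ>
    tensor_map K (ground_module K) (ground_module K) \<epsilon>\<^sub>A \<epsilon>\<^sub>B"

lemma counit_linear [simp]: "counit \<in> linear_maps K AB (ground_module K)"
  unfolding counit_def comp_def
  by (rule linear_comp[OF left_unitor_linear tensor_map_linear]) simp_all

lemma counit_tensor_closed [simp]: "t \<in> carrier AB \<Longrightarrow> counit t \<in> carrier K"
  using linear_mapsD(1)[OF counit_linear] by (simp add: ground_module_def)

lemma counit_pure:
  assumes "a \<in> carrier A" "b \<in> carrier B"
  shows "counit (pure_tensor K A B a b) = \<epsilon>\<^sub>A a \<otimes>\<^bsub>K\<^esub> \<epsilon>\<^sub>B b"
proof -
  have "counit (pure_tensor K A B a b) = \<epsilon>\<^sub>A a \<odot>\<^bsub>ground_module K\<^esub> \<epsilon>\<^sub>B b"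
    using assms linear_mapsD(1)[OF B.counit_linear]
    by (simp add: counit_def tensor_map_pure[of K A B] left_unitor_pure)
  then show ?thesis by (simp add: ground_module_def)
qed

lemmas smult_AB_closed [simp] = module.smult_closed[OF module_tensor[OF module_A module_B]]

text \<open>Both orders are needed: the scalar that cancels a comultiplication has to stand outside,
  and it is the counit of \<open>A\<close> in the left axiom and that of \<open>B\<close> in the
  right one.\<close>

lemma counit_pure_smult:
  assumes "a \<in> carrier A" "b \<in> carrier B" "w \<in> carrier AB"
  shows "counit (pure_tensor K A B a b) \<odot>\<^bsub>AB\<^esub> w = \<epsilon>\<^sub>A a \<odot>\<^bsub>AB\<^esub> (\<epsilon>\<^sub>B b \<odot>\<^bsub>AB\<^esub> w)"
    and "counit (pure_tensor K A B a b) \<odot>\<^bsub>AB\<^esub> w = \<epsilon>\<^sub>B b \<odot>\<^bsub>AB\<^esub> (\<epsilon>\<^sub>A a \<odot>\<^bsub>AB\<^esub> w)"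
  using assms module.smult_assoc1[OF module_tensor[OF module_A module_B]]
  by (simp_all add: counit_pure A.R.m_comm[of "\<epsilon>\<^sub>A a"] flip: module.smult_assoc1[OF module_tensor[OF module_A module_B]])

text \<open>The scalar \<open>\<epsilon>\<^sub>A a1\<close> leaves the inner sums and cancels
  \<open>\<Delta>\<^sub>A\<close>, so only \<open>\<epsilon>\<^sub>B\<close>, \<sigma> and
  \<open>\<Delta>\<^sub>B\<close> remain in the axiom.\<close>

lemma left_counit_pure:
  assumes "a \<in> carrier A" "b \<in> carrier B"
  shows "left_unitor K AB (tensor_map K (ground_module K) AB counit id (comult (pure_tensor K A B a b))) =
    sB AB (\<lambda>b1 b2. sT AB (\<lambda>x y. \<epsilon>\<^sub>B x \<odot>\<^bsub>AB\<^esub> pure_tensor K A B y b2) a b1) b"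
proof -
  have "left_unitor K AB (tensor_map K (ground_module K) AB counit id (comult (pure_tensor K A B a b))) =
      sweedler K AB AB AB (\<lambda>s t. counit s \<odot>\<^bsub>AB\<^esub> t) (comult (pure_tensor K A B a b))"
    using assms by (simp del: comult_pure add: tensor_map_sweedler[where A = AB and B = AB]
        id_linear left_unitor_sweedler)
  also have "\<dots> = sA AB (\<lambda>a1 a2. sB AB (\<lambda>b1 b2. sT AB (\<lambda>x y.
      \<epsilon>\<^sub>A a1 \<odot>\<^bsub>AB\<^esub> (\<epsilon>\<^sub>B x \<odot>\<^bsub>AB\<^esub> pure_tensor K A B y b2)) a2 b1) b) a"
    using assms by (simp add: counit_pure_smult(1))
  also have "\<dots> = sB AB (\<lambda>b1 b2. sT AB (\<lambda>x y. \<epsilon>\<^sub>B x \<odot>\<^bsub>AB\<^esub> pure_tensor K A B y b2) a b1) b"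
    using assms by (simp add: sweedler_smult A.sweedler_left_counit)
  finally show ?thesis .
qed

lemma right_counit_pure:
  assumes "a \<in> carrier A" "b \<in> carrier B"
  shows "right_unitor K AB (tensor_map K AB (ground_module K) id counit (comult (pure_tensor K A B a b))) =
    sA AB (\<lambda>a1 a2. sT AB (\<lambda>x y. \<epsilon>\<^sub>A y \<odot>\<^bsub>AB\<^esub> pure_tensor K A B a1 x) a2 b) a"
proof -
  have "right_unitor K AB (tensor_map K AB (ground_module K) id counit (comult (pure_tensor K A B a b))) =
      sweedler K AB AB AB (\<lambda>s t. counit t \<odot>\<^bsub>AB\<^esub> s) (comult (pure_tensor K A B a b))"
    using assms by (simp del: comult_pure add: tensor_map_sweedler[where A = AB and B = AB]
        id_linear right_unitor_sweedler)
  also have "\<dots> = sA AB (\<lambda>a1 a2. sB AB (\<lambda>b1 b2. sT AB (\<lambda>x y.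
      \<epsilon>\<^sub>B b2 \<odot>\<^bsub>AB\<^esub> (\<epsilon>\<^sub>A y \<odot>\<^bsub>AB\<^esub> pure_tensor K A B a1 x)) a2 b1) b) a"
    using assms by (simp add: counit_pure_smult(2))
  also have "\<dots> = sA AB (\<lambda>a1 a2. sT AB (\<lambda>x y. \<epsilon>\<^sub>A y \<odot>\<^bsub>AB\<^esub> pure_tensor K A B a1 x) a2 b) a"
    using assms by (simp add: sweedler_smult B.sweedler_right_counit)
  finally show ?thesis .
qed

text \<open>In the left axiom the remaining counit moves past \<sigma> onto \<open>b1\<close> and
  cancels \<open>\<Delta>\<^sub>B\<close>; in the right one it moves onto \<open>a2\<close> and
  cancels \<open>\<Delta>\<^sub>A\<close>.\<close>

lemma counit_compatible_imp_counits:
  assumes N: counit_compatible and t: "t \<in> carrier AB"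
  shows "left_unitor K AB (tensor_map K (ground_module K) AB counit id (comult t)) = t"
    and "right_unitor K AB (tensor_map K AB (ground_module K) id counit (comult t)) = t"
proof -
  have l: "(\<lambda>t. left_unitor K AB (tensor_map K (ground_module K) AB counit id (comult t))) \<in> linear_maps K AB AB"
    by (rule linear_comp[OF left_unitor_linear linear_comp[OF tensor_map_linear comult_linear]])
      (simp_all add: id_linear)
  have r: "(\<lambda>t. right_unitor K AB (tensor_map K AB (ground_module K) id counit (comult t))) \<in> linear_maps K AB AB"
    by (rule linear_comp[OF right_unitor_linear linear_comp[OF tensor_map_linear comult_linear]])
      (simp_all add: id_linear)
  show "left_unitor K AB (tensor_map K (ground_module K) AB counit id (comult t)) = t"
    by (rule tensor_ext[OF _ _ _ l linear_id _ t])
      (simp_all add: left_counit_pure counit_compatible_B[OF _ N] B.sweedler_left_counit del: comult_pure)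
  show "right_unitor K AB (tensor_map K AB (ground_module K) id counit (comult t)) = t"
    by (rule tensor_ext[OF _ _ _ r linear_id _ t])
      (simp_all add: right_counit_pure counit_compatible_A[OF _ N] A.sweedler_right_counit del: comult_pure)
qed

lemma counits_imp_counit_compatible:
  assumes l: "\<And>t. t \<in> carrier AB \<Longrightarrow> left_unitor K AB (tensor_map K (ground_module K) AB counit id (comult t)) = t"
    and r: "\<And>t. t \<in> carrier AB \<Longrightarrow> right_unitor K AB (tensor_map K AB (ground_module K) id counit (comult t)) = t"
  shows counit_compatible
  unfolding counit_compatible_def
proof (intro ballI conjI)
  fix a b assume ab [simp]: "a \<in> carrier A" "b \<in> carrier B"
  \<comment> \<open>\<open>?f\<close> is \<open>\<epsilon>\<^sub>A \<otimes> 1\<close>. It is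
    applied to the right counit axiom, where its counit cancels the remaining
    \<open>\<Delta>\<^sub>A\<close>.\<close>
  let ?f = "\<lambda>t. sweedler K A B B (\<lambda>a b. \<epsilon>\<^sub>A a \<odot>\<^bsub>B\<^esub> b) t"
  have f: "?f \<in> linear_maps K AB B" by simp
  have f_smult: "?f (k \<odot>\<^bsub>AB\<^esub> t) = k \<odot>\<^bsub>B\<^esub> ?f t" if "k \<in> carrier K" "t \<in> carrier AB" for k t
    using linear_mapsD(3)[OF f] that by simp
  have "\<epsilon>\<^sub>A a \<odot>\<^bsub>B\<^esub> b = ?f (pure_tensor K A B a b)" by simp
  also have "\<dots> = ?f (sA AB (\<lambda>a1 a2. sT AB (\<lambda>x y. \<epsilon>\<^sub>A y \<odot>\<^bsub>AB\<^esub> pure_tensor K A B a1 x) a2 b) a)"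
    using r[of "pure_tensor K A B a b"] right_counit_pure[OF ab] by simp
  also have "\<dots> = sA B (\<lambda>a1 a2. sT B (\<lambda>x y. \<epsilon>\<^sub>A y \<odot>\<^bsub>B\<^esub> (\<epsilon>\<^sub>A a1 \<odot>\<^bsub>B\<^esub> x)) a2 b) a"
    by (simp add: sweedler_hom[OF _ _ _ _ f] f_smult)
  \<comment> \<open>The scalars are exchanged so that \<open>\<epsilon>\<^sub>A a1\<close>, which is
    constant in the inner sum, can be pulled out.\<close>
  also have "\<dots> = sA B (\<lambda>a1 a2. sT B (\<lambda>x y. \<epsilon>\<^sub>A a1 \<odot>\<^bsub>B\<^esub> (\<epsilon>\<^sub>A y \<odot>\<^bsub>B\<^esub> x)) a2 b) a"
    by (rule sweedler_body, rule sweedler_body) (simp add: A.R.m_comm flip: B.smult_assoc1)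
  also have "\<dots> = sT B (\<lambda>x y. \<epsilon>\<^sub>A y \<odot>\<^bsub>B\<^esub> x) a b"
    by (simp add: sweedler_smult A.sweedler_left_counit)
  finally show "sT B (\<lambda>x y. \<epsilon>\<^sub>A y \<odot>\<^bsub>B\<^esub> x) a b = \<epsilon>\<^sub>A a \<odot>\<^bsub>B\<^esub> b" ..
next
  fix a b assume ab [simp]: "a \<in> carrier A" "b \<in> carrier B"
  \<comment> \<open>\<open>?f\<close> is \<open>1 \<otimes> \<epsilon>\<^sub>B\<close>, applied to
    the left counit axiom.\<close>
  let ?f = "\<lambda>t. sweedler K A B A (\<lambda>a b. \<epsilon>\<^sub>B b \<odot>\<^bsub>A\<^esub> a) t"
  have f: "?f \<in> linear_maps K AB A" by simp
  have f_smult: "?f (k \<odot>\<^bsub>AB\<^esub> t) = k \<odot>\<^bsub>A\<^esub> ?f t" if "k \<in> carrier K" "t \<in> carrier AB" for k t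
    using linear_mapsD(3)[OF f] that by simp
  have "\<epsilon>\<^sub>B b \<odot>\<^bsub>A\<^esub> a = ?f (pure_tensor K A B a b)" by simp
  also have "\<dots> = ?f (sB AB (\<lambda>b1 b2. sT AB (\<lambda>x y. \<epsilon>\<^sub>B x \<odot>\<^bsub>AB\<^esub> pure_tensor K A B y b2) a b1) b)"
    using l[of "pure_tensor K A B a b"] left_counit_pure[OF ab] by simp
  also have "\<dots> = sB A (\<lambda>b1 b2. sT A (\<lambda>x y. \<epsilon>\<^sub>B x \<odot>\<^bsub>A\<^esub> (\<epsilon>\<^sub>B b2 \<odot>\<^bsub>A\<^esub> y)) a b1) b"
    by (simp add: sweedler_hom[OF _ _ _ _ f] f_smult)
  also have "\<dots> = sB A (\<lambda>b1 b2. sT A (\<lambda>x y. \<epsilon>\<^sub>B b2 \<odot>\<^bsub>A\<^esub> (\<epsilon>\<^sub>B x \<odot>\<^bsub>A\<^esub> y)) a b1) b"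
    by (rule sweedler_body, rule sweedler_body) (simp add: A.R.m_comm flip: A.smult_assoc1)
  also have "\<dots> = sT A (\<lambda>x y. \<epsilon>\<^sub>B x \<odot>\<^bsub>A\<^esub> y) a b"
    by (simp add: sweedler_smult B.sweedler_right_counit)
  finally show "sT A (\<lambda>x y. \<epsilon>\<^sub>B x \<odot>\<^bsub>A\<^esub> y) a b = \<epsilon>\<^sub>B b \<odot>\<^bsub>A\<^esub> a" ..
qed

text \<open>Each direction runs through the pentagons with values in the module where its final
  identity lives: \<open>(B \<otimes> B) \<otimes> (A \<otimes> A)\<close> for the third identity,
  \<open>AB3\<close> for coassociativity.\<close>

theorem coalgebra_iff:
  "coalgebra K AB comult counit \<longleftrightarrow> counit_compatible \<and>
    (\<forall>t\<in>carrier AB. tensor_map K (tensor K B B) (tensor K A A) \<Delta>\<^sub>B \<Delta>\<^sub>A (\<sigma> t) = hexagon_map t)"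
proof
  assume "coalgebra K AB comult counit"
  then interpret C: coalgebra K AB comult counit .
  have N: counit_compatible by (rule counits_imp_counit_compatible) (simp_all only: C.left_counit C.right_counit)
  let ?W = "tensor K (tensor K B B) (tensor K A A)"
  have "twisted_coassoc ?W" by (rule coassoc_imp_twisted_coassoc) (simp_all add: C.coassoc)
  with N have "hexagon ?W"
    by (intro pentagons_imp_hexagon twisted_coassoc_imp_pentagons) simp_all
  with N show "counit_compatible \<and>
    (\<forall>t\<in>carrier AB. tensor_map K (tensor K B B) (tensor K A A) \<Delta>\<^sub>B \<Delta>\<^sub>A (\<sigma> t) = hexagon_map t)"
    by (simp add: hexagon_imp_hexagon_maps)
next
  assume asm: "counit_compatible \<and>
    (\<forall>t\<in>carrier AB. tensor_map K (tensor K B B) (tensor K A A) \<Delta>\<^sub>B \<Delta>\<^sub>A (\<sigma> t) = hexagon_map t)"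
  then have N: counit_compatible ..
  have "hexagon AB3" by (rule hexagon_maps_imp_hexagon) (use asm in simp_all)
  with N have "twisted_coassoc AB3"
    by (intro pentagons_imp_twisted_coassoc hexagon_imp_pentagons) simp_all
  then show "coalgebra K AB comult counit"
    by (intro coalgebra.intro coalgebra_axioms.intro)
      (simp_all only: module_tensor module_A module_B comult_linear counit_linear
        twisted_coassoc_imp_coassoc counit_compatible_imp_counits[OF N])
qed

section \<open>From \<sigma> back to \<tau>\<close>

lemma counit_compatible_iff:
  "counit_compatible \<longleftrightarrow>
    (\<forall>t\<in>carrier AB. left_unitor K B (tensor_map K (ground_module K) B \<epsilon>\<^sub>A id t) =
      right_unitor K B (tensor_map K B (ground_module K) id \<epsilon>\<^sub>A (\<sigma> t))) \<and>
    (\<forall>t\<in>carrier AB. right_unitor K A (tensor_map K A (ground_module K) id \<epsilon>\<^sub>B t) =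
      left_unitor K A (tensor_map K (ground_module K) A \<epsilon>\<^sub>B id (\<sigma> t)))"
    (is "_ \<longleftrightarrow> (\<forall>t\<in>_. ?l1 t = ?r1 t) \<and> (\<forall>t\<in>_. ?l2 t = ?r2 t)")
proof -
  have l1: "?l1 t = sweedler K A B B (\<lambda>a b. \<epsilon>\<^sub>A a \<odot>\<^bsub>B\<^esub> b) t"
    and r1: "?r1 t = sweedler K B A B (\<lambda>b a. \<epsilon>\<^sub>A a \<odot>\<^bsub>B\<^esub> b) (\<sigma> t)"
    and l2: "?l2 t = sweedler K A B A (\<lambda>a b. \<epsilon>\<^sub>B b \<odot>\<^bsub>A\<^esub> a) t"
    and r2: "?r2 t = sweedler K B A A (\<lambda>b a. \<epsilon>\<^sub>B b \<odot>\<^bsub>A\<^esub> a) (\<sigma> t)" if "t \<in> carrier AB" for t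
    using that by (simp_all add: tensor_map_sweedler[where A = A and B = B] tensor_map_sweedler[where A = B and B = A]
        id_linear left_unitor_sweedler right_unitor_sweedler)
  have "(\<forall>t\<in>carrier AB. ?l1 t = ?r1 t) \<longleftrightarrow>
      (\<forall>a\<in>carrier A. \<forall>b\<in>carrier B. sT B (\<lambda>x y. \<epsilon>\<^sub>A y \<odot>\<^bsub>B\<^esub> x) a b = \<epsilon>\<^sub>A a \<odot>\<^bsub>B\<^esub> b)"
  proof
    assume e: "\<forall>t\<in>carrier AB. ?l1 t = ?r1 t"
    show "\<forall>a\<in>carrier A. \<forall>b\<in>carrier B. sT B (\<lambda>x y. \<epsilon>\<^sub>A y \<odot>\<^bsub>B\<^esub> x) a b = \<epsilon>\<^sub>A a \<odot>\<^bsub>B\<^esub> b"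
    proof (intro ballI)
      fix a b assume ab: "a \<in> carrier A" "b \<in> carrier B"
      then have "pure_tensor K A B a b \<in> carrier AB" by simp
      from l1[OF this] r1[OF this] e[rule_format, OF this] ab
      show "sT B (\<lambda>x y. \<epsilon>\<^sub>A y \<odot>\<^bsub>B\<^esub> x) a b = \<epsilon>\<^sub>A a \<odot>\<^bsub>B\<^esub> b" by simp
    qed
  next
    assume e: "\<forall>a\<in>carrier A. \<forall>b\<in>carrier B. sT B (\<lambda>x y. \<epsilon>\<^sub>A y \<odot>\<^bsub>B\<^esub> x) a b = \<epsilon>\<^sub>A a \<odot>\<^bsub>B\<^esub> b"
    \<comment> \<open>Both sides are linear in \<open>t\<close>, so agreement on pure tensors
      suffices.\<close>
    have "sweedler K A B B (\<lambda>a b. \<epsilon>\<^sub>A a \<odot>\<^bsub>B\<^esub> b) t = sweedler K B A B (\<lambda>b a. \<epsilon>\<^sub>A a \<odot>\<^bsub>B\<^esub> b) (\<sigma> t)"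
      if "t \<in> carrier AB" for t
      by (rule tensor_ext[where W = B, OF _ _ _ _ _ _ that]) (simp_all add: e)
    then show "\<forall>t\<in>carrier AB. ?l1 t = ?r1 t" using l1 r1 by simp
  qed
  moreover have "(\<forall>t\<in>carrier AB. ?l2 t = ?r2 t) \<longleftrightarrow>
      (\<forall>a\<in>carrier A. \<forall>b\<in>carrier B. sT A (\<lambda>x y. \<epsilon>\<^sub>B x \<odot>\<^bsub>A\<^esub> y) a b = \<epsilon>\<^sub>B b \<odot>\<^bsub>A\<^esub> a)"
  proof
    assume e: "\<forall>t\<in>carrier AB. ?l2 t = ?r2 t"
    show "\<forall>a\<in>carrier A. \<forall>b\<in>carrier B. sT A (\<lambda>x y. \<epsilon>\<^sub>B x \<odot>\<^bsub>A\<^esub> y) a b = \<epsilon>\<^sub>B b \<odot>\<^bsub>A\<^esub> a"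
    proof (intro ballI)
      fix a b assume ab: "a \<in> carrier A" "b \<in> carrier B"
      then have "pure_tensor K A B a b \<in> carrier AB" by simp
      from l2[OF this] r2[OF this] e[rule_format, OF this] ab
      show "sT A (\<lambda>x y. \<epsilon>\<^sub>B x \<odot>\<^bsub>A\<^esub> y) a b = \<epsilon>\<^sub>B b \<odot>\<^bsub>A\<^esub> a" by simp
    qed
  next
    assume e: "\<forall>a\<in>carrier A. \<forall>b\<in>carrier B. sT A (\<lambda>x y. \<epsilon>\<^sub>B x \<odot>\<^bsub>A\<^esub> y) a b = \<epsilon>\<^sub>B b \<odot>\<^bsub>A\<^esub> a"
    have "sweedler K A B A (\<lambda>a b. \<epsilon>\<^sub>B b \<odot>\<^bsub>A\<^esub> a) t = sweedler K B A A (\<lambda>b a. \<epsilon>\<^sub>B b \<odot>\<^bsub>A\<^esub> a) (\<sigma> t)"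
      if "t \<in> carrier AB" for t
      by (rule tensor_ext[where W = A, OF _ _ _ _ _ _ that]) (simp_all add: e)
    then show "\<forall>t\<in>carrier AB. ?l2 t = ?r2 t" using l2 r2 by simp
  qed
  ultimately show ?thesis unfolding counit_compatible_def by blast
qed

text \<open>Apart from \<open>\<Delta>\<^sub>A \<otimes> \<Delta>\<^sub>B\<close>, the factors of
  \<open>hexagon_map\<close> are invertible, with inverses given by the same constructions for
  \<tau>. They are moved to the other side in reverse order.\<close>

lemma hexagon_map_inverse_iff:
  assumes \<tau>: "\<tau> \<in> linear_maps K (tensor K B A) AB"
    and \<tau>\<sigma>: "\<And>t. t \<in> carrier AB \<Longrightarrow> \<tau> (\<sigma> t) = t"
    and \<sigma>\<tau>: "\<And>t. t \<in> carrier (tensor K B A) \<Longrightarrow> \<sigma> (\<tau> t) = t"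
    and t: "t \<in> carrier AB"
  shows "tensor_map K (tensor K B B) (tensor K A A) \<Delta>\<^sub>B \<Delta>\<^sub>A (\<sigma> t) = hexagon_map t \<longleftrightarrow>
    tensor_map K (tensor K A A) (tensor K B B) \<Delta>\<^sub>A \<Delta>\<^sub>B t =
    (middle_map K A B A B A B \<tau> \<circ> tensor_map K AB AB \<tau> \<tau> \<circ> middle_map K B B A A A B \<tau> \<circ>
      tensor_map K (tensor K B B) (tensor K A A) \<Delta>\<^sub>B \<Delta>\<^sub>A) (\<sigma> t)"
proof -
  let ?BA = "tensor K B A"
  let ?M1 = "middle_map K A A B B B A \<sigma>" and ?T = "tensor_map K ?BA ?BA \<sigma> \<sigma>"
    and ?M2 = "middle_map K B A B A B A \<sigma>"
  let ?M1' = "middle_map K A B A B A B \<tau>" and ?T' = "tensor_map K AB AB \<tau> \<tau>"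
    and ?M2' = "middle_map K B B A A A B \<tau>"
  let ?y = "tensor_map K (tensor K A A) (tensor K B B) \<Delta>\<^sub>A \<Delta>\<^sub>B t"
  let ?z = "tensor_map K (tensor K B B) (tensor K A A) \<Delta>\<^sub>B \<Delta>\<^sub>A (\<sigma> t)"
  have y: "?y \<in> carrier (tensor K (tensor K A A) (tensor K B B))"
    by (rule linear_mapsD(1)[OF tensor_map_linear t]) simp_all
  have z: "?z \<in> carrier (tensor K (tensor K B B) (tensor K A A))"
    by (rule linear_mapsD(1)[OF tensor_map_linear[where A = B and B = A]]) (simp_all add: t)
  have M1: "?M1' (?M1 s) = s" "?M1 s \<in> carrier AB2" if "s \<in> carrier (tensor K (tensor K A A) (tensor K B B))" for s
    using that middle_map_inverse[of K A A B B B A \<sigma> \<tau> s] linear_mapsD(1)[OF middle_map_linear[of K A A B B B A \<sigma>]]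
    by (simp_all add: \<tau> \<tau>\<sigma>)
  have M1': "?M1 (?M1' s) = s" if "s \<in> carrier AB2" for s
    using that middle_map_inverse[of K A B A B A B \<tau> \<sigma> s] by (simp add: \<tau> \<sigma>\<tau>)
  have M2: "?M2' (?M2 s) = s" if "s \<in> carrier (tensor K ?BA ?BA)" for s
    using that middle_map_inverse[of K B A B A B A \<sigma> \<tau> s] by (simp add: \<tau> \<tau>\<sigma>)
  have M2': "?M2 (?M2' s) = s" "?M2' s \<in> carrier (tensor K ?BA ?BA)"
    if "s \<in> carrier (tensor K (tensor K B B) (tensor K A A))" for s
    using that middle_map_inverse[of K B B A A A B \<tau> \<sigma> s] linear_mapsD(1)[OF middle_map_linear[of K B B A A A B \<tau>]]
    by (simp_all add: \<tau> \<sigma>\<tau>)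
  have T: "?T' (?T s) = s" "?T s \<in> carrier (tensor K ?BA ?BA)" if "s \<in> carrier AB2" for s
    using that tensor_map_inverse[of K AB AB ?BA ?BA \<sigma> \<sigma> \<tau> \<tau> s] linear_mapsD(1)[OF tensor_map_linear[of K AB AB ?BA ?BA \<sigma> \<sigma>]]
    by (simp_all add: \<tau> \<tau>\<sigma>)
  have T': "?T (?T' s) = s" "?T' s \<in> carrier AB2" if "s \<in> carrier (tensor K ?BA ?BA)" for s
    using that tensor_map_inverse[of K ?BA ?BA AB AB \<tau> \<tau> \<sigma> \<sigma> s] linear_mapsD(1)[OF tensor_map_linear[of K ?BA ?BA AB AB \<tau> \<tau>]]
    by (simp_all add: \<tau> \<sigma>\<tau>)
  have "?z = ?M2 (?T (?M1 ?y)) \<longleftrightarrow> ?y = ?M1' (?T' (?M2' ?z))"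
  proof
    assume "?z = ?M2 (?T (?M1 ?y))"
    then show "?y = ?M1' (?T' (?M2' ?z))" using y by (simp only: M1 M2 T)
  next
    assume "?y = ?M1' (?T' (?M2' ?z))"
    then show "?z = ?M2 (?T (?M1 ?y))" using z by (simp only: M1' M2' T')
  qed
  then show ?thesis by (simp only: hexagon_map_def comp_def)
qed

end

lemma linear_inv_into:
  assumes "module K M" "f \<in> linear_maps K M N" "bij_betw f (carrier M) (carrier N)"
  shows "inv_into (carrier M) f \<in> linear_maps K N M"
proof -
  interpret M: module K M by fact
  let ?g = "inv_into (carrier M) f"
  note f = linear_mapsD[OF assms(2)]
  have g: "?g y \<in> carrier M" "f (?g y) = y" if "y \<in> carrier N" for y
    using that assms(3) by (metis bij_betw_def inv_into_into, metis bij_betw_inv_into_right)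
  have gf: "?g (f x) = x" if "x \<in> carrier M" for x
    using that assms(3) by (simp add: bij_betw_inv_into_left)
  show ?thesis
  proof (rule linear_mapsI)
    fix x y assume "x \<in> carrier N" "y \<in> carrier N"
    then show "?g (x \<oplus>\<^bsub>N\<^esub> y) = ?g x \<oplus>\<^bsub>M\<^esub> ?g y"
      using gf[of "?g x \<oplus>\<^bsub>M\<^esub> ?g y"] by (simp add: g f)
  next
    fix k x assume "k \<in> carrier K" "x \<in> carrier N"
    then show "?g (k \<odot>\<^bsub>N\<^esub> x) = k \<odot>\<^bsub>M\<^esub> ?g x"
      using gf[of "k \<odot>\<^bsub>M\<^esub> ?g x"] by (simp add: g f)
  qed (rule g)
qed

theorem proposition3p11:
  fixes K :: "('k, 'r) ring_scheme"
    and A :: "('k, 'a, 'm) module_scheme" and B :: "('k, 'b, 'n) module_scheme"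
    and \<Delta>\<^sub>A :: "'a \<Rightarrow> ('a \<times> 'a \<Rightarrow> 'k) set" and \<epsilon>\<^sub>A :: "'a \<Rightarrow> 'k"
    and \<Delta>\<^sub>B :: "'b \<Rightarrow> ('b \<times> 'b \<Rightarrow> 'k) set" and \<epsilon>\<^sub>B :: "'b \<Rightarrow> 'k"
    and \<tau> :: "('b \<times> 'a \<Rightarrow> 'k) set \<Rightarrow> ('a \<times> 'b \<Rightarrow> 'k) set"
  assumes "field K"
    and "coalgebra K A \<Delta>\<^sub>A \<epsilon>\<^sub>A"
    and "coalgebra K B \<Delta>\<^sub>B \<epsilon>\<^sub>B"
    and "\<tau> \<in> linear_maps K (tensor K B A) (tensor K A B)"
    and "bij_betw \<tau> (carrier (tensor K B A)) (carrier (tensor K A B))"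
  shows "coalgebra K (tensor K A B)
      (twisted_comult K A B \<Delta>\<^sub>A \<Delta>\<^sub>B \<tau>) (twisted_counit K \<epsilon>\<^sub>A \<epsilon>\<^sub>B) \<longleftrightarrow>
    (\<forall>x\<in>carrier (tensor K B A).
      left_unitor K B (tensor_map K (ground_module K) B \<epsilon>\<^sub>A id (\<tau> x)) =
      right_unitor K B (tensor_map K B (ground_module K) id \<epsilon>\<^sub>A x)) \<and>
    (\<forall>x\<in>carrier (tensor K B A).
      right_unitor K A (tensor_map K A (ground_module K) id \<epsilon>\<^sub>B (\<tau> x)) =
      left_unitor K A (tensor_map K (ground_module K) A \<epsilon>\<^sub>B id x)) \<and>
    (\<forall>x\<in>carrier (tensor K B A).
      tensor_map K (tensor K A A) (tensor K B B) \<Delta>\<^sub>A \<Delta>\<^sub>B (\<tau> x) =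
      (middle_map K A B A B A B \<tau> \<circ>
       tensor_map K (tensor K A B) (tensor K A B) \<tau> \<tau> \<circ>
       middle_map K B B A A A B \<tau> \<circ>
       tensor_map K (tensor K B B) (tensor K A A) \<Delta>\<^sub>B \<Delta>\<^sub>A) x)"
proof -
  interpret A: coalgebra K A \<Delta>\<^sub>A \<epsilon>\<^sub>A by fact
  interpret B: coalgebra K B \<Delta>\<^sub>B \<epsilon>\<^sub>B by fact
  let ?AB = "tensor K A B" and ?BA = "tensor K B A"
  define \<sigma> where "\<sigma> = inv_into (carrier ?BA) \<tau>"
  interpret twist K A B \<Delta>\<^sub>A \<epsilon>\<^sub>A \<Delta>\<^sub>B \<epsilon>\<^sub>B \<sigma>
  proof unfold_locales
    show "\<sigma> \<in> linear_maps K ?AB ?BA"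
      unfolding \<sigma>_def
      by (rule linear_inv_into[OF _ assms(4,5)]) (simp add: A.module_axioms B.module_axioms)
  qed
  have \<tau>\<sigma>: "\<tau> (\<sigma> t) = t" if "t \<in> carrier ?AB" for t
    using that assms(5) unfolding \<sigma>_def by (rule bij_betw_inv_into_right[rotated])
  have \<sigma>\<tau>: "\<sigma> (\<tau> x) = x" if "x \<in> carrier ?BA" for x
    using that assms(5) unfolding \<sigma>_def by (rule bij_betw_inv_into_left[rotated])
  \<comment> \<open>Every element of \<open>B \<otimes> A\<close> is some \<sigma> \<open>t\<close>,
    so the identities for \<tau> may be tested there; this puts them in the form of the preceding
    equivalences.\<close>
  have reindex: "(\<forall>x\<in>carrier ?BA. Q x) \<longleftrightarrow> (\<forall>t\<in>carrier ?AB. Q (\<sigma> t))" for Q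
    using \<tau>\<sigma> \<sigma>\<tau> linear_mapsD(1)[OF assms(4)] linear_mapsD(1)[OF twist_linear] by metis
  have "twisted_comult K A B \<Delta>\<^sub>A \<Delta>\<^sub>B \<tau> = comult" "twisted_counit K \<epsilon>\<^sub>A \<epsilon>\<^sub>B = counit"
    by (simp_all add: twisted_comult_def comult_def twisted_counit_def counit_def flip: \<sigma>_def)
  then show ?thesis
    by (simp only: coalgebra_iff counit_compatible_iff hexagon_map_inverse_iff[OF assms(4) \<tau>\<sigma> \<sigma>\<tau>]
        reindex \<tau>\<sigma> conj_assoc cong: ball_cong)
qed

end
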